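(* Let $\mathbb{K}$ be a field of characteristic $0$. For every integer $m\ge 0$ the two linear operators $h_m,k_m\colon\Omega_m\to\Omega_m$ of degree $-1$ defined by $$h_m(\eta)=\sum_{n=0}^m\sum_{f\in I(n,m)}\omega_f\wedge h_f(\eta),\qquad k_m(\eta)=\sum_{n=0}^m\sum_{f\in I(n,m)}\omega_f\wedge k_f(\eta)$$ (with $\Omega_m$, $I(n,m)$, $\omega_f$, $h_f$, $k_f$ as defined in the context) coincide: $k_m=h_m$.
   Context: $\mathbb{K}$ is a field of characteristic $0$. For $n\ge 0$, $[n]=\{0<1<\dots<n\}$, and $I(n,m)$ is the set of strictly increasing maps $[n]\to[m]$. The affine standard $n$-simplex is $\Delta^n_{\mathbb K}=\{(x_0,\dots,x_n)\in\mathbb{K}^{n+1} : x_0+\dots+x_n=1\}$, with vertices $e_0,\dots,e_n$ (standard basis vectors). The differential graded algebra of polynomial differential forms on it is $$\Omega_n=\bigoplus_{p=0}^n\Omega_n^p=\frac{\mathbb{K}[x_0,\dots,x_n,dx_0,\dots,dx_n]}{\left(\sum_i x_i-1,\ \sum_i dx_i\right)},$$ the graded-commutative algebra with $x_i$ in degree $0$, $dx_i$ in degree $1$, and the usual differential $d$. For $f\in I(n,m)$ the Whitney elementary form is $$\omega_f=n!\sum_{i=0}^n(-1)^i x_{f(i)}\,dx_{f(0)}\wedge\dots\wedge\widehat{dx_{f(i)}}\wedge\dots\wedge dx_{f(n)}\in\Omega_m^n.$$ Integration $\int_{\Delta^n_{\mathbb K}}\colon\Omega_n\to\mathbb{K}$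 is the linear map that vanishes on $\Omega_n^p$ for $p\ne n$ and satisfies $$\int_{\Delta^n_{\mathbb K}}x_0^{k_0}\cdots x_n^{k_n}\,dx_0\wedge\dots\wedge\widehat{dx_i}\wedge\dots\wedge dx_n=(-1)^i\frac{k_0!\cdots k_n!}{(k_0+\dots+k_n+n)!}.$$ Let $\widehat\Delta^n=\{(s,t_0,\dots,t_n)\in\mathbb{K}^{n+2} : s+t_0+\dots+t_n=1\}$ and let $\widehat\Omega_n$ be its algebra of polynomial differential forms. Identify $\widehat\Delta^n$ with $\Delta^{n+1}_{\mathbb K}$ via the ordered coordinates $(s,t_0,\dots,t_n)=(x_0,\dots,x_{n+1})$; this defines $\int_{\widehat\Delta^n}\colon\widehat\Omega_n\to\mathbb{K}$. Polynomial forms on $\widehat\Delta^n\times\Delta^m_{\mathbb K}$ are $\widehat\Omega_n\otimes\Omega_m$, and $\int_{\widehat\Delta^n}\otimes\mathrm{Id}$ sends $\alpha\otimes\beta$ to $\left(\int_{\widehat\Delta^n}\alpha\right)\beta$. Definition of $h_f$. For $0\le j\le m$ let $\widehat{f_j}\colon\widehat\Delta^0\times\Delta^m_{\mathbb K}\to\Delta^m_{\mathbb K}$, $\widehat{f_j}((s,t_0),v)=se_j+t_0v=se_j+(1-s)v$. For $\eta\in\Omega_m$, since $t_0=1-s$ and $dt_0=-ds$, there are unique $\alpha_\eta,\beta_\eta\in\Omega_m[s]$ with $\widehat{f_j}^{*}(\eta)=ds\wedge\alpha_\eta+\beta_\eta$. The linear operator $h_j\colon\Omega_m\to\Omega_m$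 of degree $-1$ is obtained by integrating $\alpha_\eta$ in $s$ from $0$ to $1$: if $\alpha_\eta=(1-s)^as^b\,x_0^{k_0}\cdots x_m^{k_m}\,dx_{c_1}\wedge\dots\wedge dx_{c_l}$, then $h_j(\eta)=\left(\int_0^1(1-s)^as^b\,ds\right)x_0^{k_0}\cdots x_m^{k_m}\,dx_{c_1}\wedge\dots\wedge dx_{c_l}$, where $\int_0^1(1-s)^as^b\,ds=\frac{a!\,b!}{(a+b+1)!}$, extended linearly. For $f\in I(n,m)$ set $h_f=h_{f(n)}\circ\dots\circ h_{f(0)}$, of degree $-n-1$. Definition of $k_f$. For $f\in I(n,m)$ let $\widehat f\colon\widehat\Delta^n\times\Delta^m_{\mathbb K}\to\Delta^m_{\mathbb K}$, $\widehat f((s,t_0,\dots,t_n),v)=sv+\sum_{i=0}^nt_ie_{f(i)}$. The operator $k_f\colon\Omega_m\to\Omega_m$ of degree $-n-1$ is the composition $\Omega_m\xrightarrow{\widehat f^{*}}\widehat\Omega_n\otimes\Omega_m\xrightarrow{\int_{\widehat\Delta^n}\otimes\mathrm{Id}}\Omega_m$. *)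

theory Defs
  imports
    "HOL-Algebra.QuotRing"
    "HOL-Library.Poly_Mapping"
    "HOL-Library.FSet"
    "HOL-Library.FuncSet"
begin

section \<open>The free graded-commutative algebra on countably many generators\<close>

text \<open>
  The algebra generated by \<open>x\<^sub>i\<close> in degree 0 and \<open>dx\<^sub>i\<close> in degree 1, for all
  natural numbers \<open>i\<close>. Its basis consists of the monomials
  \<open>x\<^sup>k dx\<^bsub>i1\<^esub> \<and> \<dots> \<and> dx\<^bsub>ip\<^esub>\<close> with \<open>i1 < \<dots> < ip\<close>; such a monomial is encoded as the pair
  of the exponent \<open>k\<close> and the finite set \<open>{i1, \<dots>, ip}\<close>.
\<close>

type_synonym dmon = "(nat \<Rightarrow>\<^sub>0 nat) \<times> nat fset"

typedef (overloaded) 'a dform = "UNIV :: (dmon \<Rightarrow>\<^sub>0 'a::zero) set"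
  morphisms coeffs Dform
  by simp

abbreviation expo :: "(nat \<Rightarrow>\<^sub>0 nat) \<Rightarrow> nat \<Rightarrow> nat" where
  "expo \<equiv> Poly_Mapping.lookup"

abbreviation vars :: "(nat \<Rightarrow>\<^sub>0 nat) \<Rightarrow> nat set" where
  "vars \<equiv> Poly_Mapping.keys"

definition coeff :: "'a::zero dform \<Rightarrow> dmon \<Rightarrow> 'a" where
  "coeff a p = Poly_Mapping.lookup (coeffs a) p"

definition supp :: "'a::zero dform \<Rightarrow> dmon set" where
  "supp a = {p. coeff a p \<noteq> 0}"

definition dmono :: "'a::zero \<Rightarrow> (nat \<Rightarrow>\<^sub>0 nat) \<Rightarrow> nat fset \<Rightarrow> 'a dform" where
  "dmono c k S = Dform (Poly_Mapping.single (k, S) c)"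

lemma dform_eqI: "(\<And>p. coeff a p = coeff b p) \<Longrightarrow> a = b"
  by (simp add: coeff_def coeffs_inject [symmetric] poly_mapping_eqI)

lemma finite_supp [simp]: "finite (supp a)"
  by (simp add: supp_def coeff_def)

lemma in_supp_iff: "p \<in> supp a \<longleftrightarrow> coeff a p \<noteq> 0"
  by (simp add: supp_def)

lemma coeff_dmono: "coeff (dmono c k S) p = (if p = (k, S) then c else 0)"
  by (auto simp: coeff_def dmono_def Dform_inverse lookup_single when_def)

instantiation dform :: (ab_group_add) ab_group_add
begin

definition zero_dform :: "'a dform" where
  "zero_dform = Dform 0"

definition plus_dform :: "'a dform \<Rightarrow> 'a dform \<Rightarrow> 'a dform" where
  "plus_dform a b = Dform (coeffs a + coeffs b)"

definition minus_dform :: "'a dform \<Rightarrow> 'a dform \<Rightarrow> 'a dform" where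
  "minus_dform a b = Dform (coeffs a - coeffs b)"

definition uminus_dform :: "'a dform \<Rightarrow> 'a dform" where
  "uminus_dform a = Dform (- coeffs a)"

instance
  by standard
    (simp_all add: zero_dform_def plus_dform_def minus_dform_def uminus_dform_def Dform_inverse
      coeffs_inverse algebra_simps)

end

lemma coeff_zero [simp]: "coeff 0 p = 0"
  by (simp add: coeff_def zero_dform_def Dform_inverse)

lemma coeff_add [simp]: "coeff (a + b) p = coeff a p + coeff b p"
  by (simp add: coeff_def plus_dform_def Dform_inverse lookup_add)

lemma coeff_uminus [simp]: "coeff (- a) p = - coeff a p"
  by (simp add: coeff_def uminus_dform_def Dform_inverse)

lemma coeff_minus [simp]: "coeff (a - b) p = coeff a p - coeff b p"
  by (simp add: coeff_def minus_dform_def Dform_inverse lookup_minus)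

lemma coeff_sum [simp]: "coeff (sum f A) p = (\<Sum>i\<in>A. coeff (f i) p)"
  by (induction A rule: infinite_finite_induct) auto

lemma dmono_0 [simp]: "dmono 0 k S = 0"
  by (rule dform_eqI) (simp add: coeff_dmono)

lemma dmono_add: "dmono (c + c') k S = dmono c k S + dmono c' k S"
  by (rule dform_eqI) (simp add: coeff_dmono)

lemma dform_expand: "a = (\<Sum>p\<in>supp a. dmono (coeff a p) (fst p) (snd p))"
  by (rule dform_eqI) (simp add: coeff_dmono sum.delta in_supp_iff)

text \<open>
  The sign in \<open>dx\<^sub>A \<and> dx\<^sub>B = \<plusminus> dx\<^bsub>A \<union> B\<^esub>\<close>, by counting inversions; the product
  vanishes if \<open>A\<close> and \<open>B\<close> meet.
\<close>

definition wedge_sign :: "nat fset \<Rightarrow> nat fset \<Rightarrow> 'a::comm_ring_1" where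
  "wedge_sign A B =
     (if A |\<inter>| B = {||} then (-1) ^ card {(a, b). a |\<in>| A \<and> b |\<in>| B \<and> b < a} else 0)"

lemma wedge_sign_empty [simp]: "wedge_sign {||} B = 1" "wedge_sign A {||} = 1"
  by (simp_all add: wedge_sign_def)

lemma finite_inversions: "finite {(a, b). a |\<in>| A \<and> b |\<in>| B \<and> b < (a::nat)}"
  by (rule finite_subset [of _ "fset A \<times> fset B"]) auto

lemma wedge_sign_union_left:
  assumes "A |\<inter>| B = {||}"
  shows "wedge_sign (A |\<union>| B) C = (wedge_sign A C * wedge_sign B C :: 'a::comm_ring_1)"
proof (cases "(A |\<union>| B) |\<inter>| C = {||}")
  case True
  then have d: "A |\<inter>| C = {||}" "B |\<inter>| C = {||}"
    by auto
  have "{(a, b). a |\<in>| A |\<union>| B \<and> b |\<in>| C \<and> b < a} =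
      {(a, b). a |\<in>| A \<and> b |\<in>| C \<and> b < a} \<union> {(a, b). a |\<in>| B \<and> b |\<in>| C \<and> b < a}"
    by auto
  moreover have "{(a, b). a |\<in>| A \<and> b |\<in>| C \<and> b < a} \<inter> {(a, b). a |\<in>| B \<and> b |\<in>| C \<and> b < a} = {}"
    using assms by auto
  ultimately have "card {(a, b). a |\<in>| A |\<union>| B \<and> b |\<in>| C \<and> b < a} =
      card {(a, b). a |\<in>| A \<and> b |\<in>| C \<and> b < a} + card {(a, b). a |\<in>| B \<and> b |\<in>| C \<and> b < a}"
    by (simp add: card_Un_disjoint finite_inversions)
  with d True show ?thesis
    by (simp add: wedge_sign_def power_add)
next
  case False
  then have "A |\<inter>| C \<noteq> {||} \<or> B |\<inter>| C \<noteq> {||}"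
    by auto
  with False show ?thesis
    by (auto simp: wedge_sign_def)
qed

lemma wedge_sign_union_right:
  assumes "B |\<inter>| C = {||}"
  shows "wedge_sign A (B |\<union>| C) = (wedge_sign A B * wedge_sign A C :: 'a::comm_ring_1)"
proof (cases "A |\<inter>| (B |\<union>| C) = {||}")
  case True
  then have d: "A |\<inter>| B = {||}" "A |\<inter>| C = {||}"
    by auto
  have "{(a, b). a |\<in>| A \<and> b |\<in>| B |\<union>| C \<and> b < a} =
      {(a, b). a |\<in>| A \<and> b |\<in>| B \<and> b < a} \<union> {(a, b). a |\<in>| A \<and> b |\<in>| C \<and> b < a}"
    by auto
  moreover have "{(a, b). a |\<in>| A \<and> b |\<in>| B \<and> b < a} \<inter> {(a, b). a |\<in>| A \<and> b |\<in>| C \<and> b < a} = {}"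
    using assms by auto
  ultimately have "card {(a, b). a |\<in>| A \<and> b |\<in>| B |\<union>| C \<and> b < a} =
      card {(a, b). a |\<in>| A \<and> b |\<in>| B \<and> b < a} + card {(a, b). a |\<in>| A \<and> b |\<in>| C \<and> b < a}"
    by (simp add: card_Un_disjoint finite_inversions)
  with d True show ?thesis
    by (simp add: wedge_sign_def power_add)
next
  case False
  then have "A |\<inter>| B \<noteq> {||} \<or> A |\<inter>| C \<noteq> {||}"
    by auto
  with False show ?thesis
    by (auto simp: wedge_sign_def)
qed

lemma wedge_sign_assoc:
  "wedge_sign A B * wedge_sign (A |\<union>| B) C =
   (wedge_sign B C * wedge_sign A (B |\<union>| C) :: 'a::comm_ring_1)"
proof -
  have z: "wedge_sign P Q = (0::'a)" if "P |\<inter>| Q \<noteq> {||}" for P Q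
    using that by (simp add: wedge_sign_def)
  consider "A |\<inter>| B = {||}" "B |\<inter>| C = {||}"
    | "A |\<inter>| B = {||}" "B |\<inter>| C \<noteq> {||}"
    | "A |\<inter>| B \<noteq> {||}" "B |\<inter>| C = {||}"
    | "A |\<inter>| B \<noteq> {||}" "B |\<inter>| C \<noteq> {||}"
    by blast
  then show ?thesis
    by cases (simp_all add: wedge_sign_union_left wedge_sign_union_right z mult_ac)
qed

instantiation dform :: (comm_ring_1) ring_1
begin

definition one_dform :: "'a dform" where
  "one_dform = dmono 1 0 {||}"

definition times_dform :: "'a dform \<Rightarrow> 'a dform \<Rightarrow> 'a dform" where
  "times_dform a b = (\<Sum>p\<in>supp a. \<Sum>q\<in>supp b.
     dmono (wedge_sign (snd p) (snd q) * coeff a p * coeff b q) (fst p + fst q) (snd p |\<union>| snd q))"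

instance
proof
  let ?E = "\<lambda>a b p q. dmono (wedge_sign (snd p) (snd q) * coeff a p * coeff b q)
      (fst p + fst q) (snd p |\<union>| snd q) :: 'a dform"
  have sup: "a * b = (\<Sum>p\<in>P. \<Sum>q\<in>Q. ?E a b p q)"
    if "finite P" "finite Q" "supp a \<subseteq> P" "supp b \<subseteq> Q" for a b :: "'a dform" and P Q
  proof -
    have "(\<Sum>q\<in>supp b. ?E a b p q) = (\<Sum>q\<in>Q. ?E a b p q)" for p
      by (rule sum.mono_neutral_left) (use that in \<open>auto simp: in_supp_iff\<close>)
    moreover have "(\<Sum>p\<in>supp a. \<Sum>q\<in>Q. ?E a b p q) = (\<Sum>p\<in>P. \<Sum>q\<in>Q. ?E a b p q)"
      by (rule sum.mono_neutral_left) (use that in \<open>auto simp: in_supp_iff\<close>)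
    ultimately show ?thesis
      by (simp add: times_dform_def)
  qed
  have distr: "(a + b) * c = a * c + b * c" for a b c :: "'a dform"
  proof -
    have "supp (a + b) \<subseteq> supp a \<union> supp b"
      by (auto simp: in_supp_iff)
    then show ?thesis
      by (simp add: sup [of "supp a \<union> supp b" "supp c"] algebra_simps dmono_add sum.distrib)
  qed
  have distl: "a * (b + c) = a * b + a * c" for a b c :: "'a dform"
  proof -
    have "supp (b + c) \<subseteq> supp b \<union> supp c"
      by (auto simp: in_supp_iff)
    then show ?thesis
      by (simp add: sup [of "supp a" "supp b \<union> supp c"] algebra_simps dmono_add sum.distrib)
  qed
  have zl: "0 * a = 0" and zr: "a * 0 = 0" for a :: "'a dform"
    using distr [of 0 0 a] distl [of a 0 0] by simp_all
  have suml: "sum f A * b = (\<Sum>i\<in>A. f i * b)" for f :: "dmon \<Rightarrow> 'a dform" and A b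
    by (induction A rule: infinite_finite_induct) (simp_all add: zl distr)
  have sumr: "b * sum f A = (\<Sum>i\<in>A. b * f i)" for f :: "dmon \<Rightarrow> 'a dform" and A b
    by (induction A rule: infinite_finite_induct) (simp_all add: zr distl)
  have mm: "dmono c k A * dmono c' l B = dmono (wedge_sign A B * c * c') (k + l) (A |\<union>| B)"
    for c c' :: 'a and k l A B
    by (subst sup [of "{(k, A)}" "{(l, B)}"]) (auto simp: in_supp_iff coeff_dmono split: if_splits)
  have m_assoc: "dmono c k A * dmono c' l B * dmono c'' r C = dmono c k A * (dmono c' l B * dmono c'' r C)"
    for c c' c'' :: 'a and k l r A B C
  proof -
    have "wedge_sign (A |\<union>| B) C * (wedge_sign A B * c * c') * c'' =
      wedge_sign A (B |\<union>| C) * c * (wedge_sign B C * c' * c'')"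
      using wedge_sign_assoc [of A B C, where 'a = 'a]
      by (simp add: mult_ac)
    then show ?thesis
      by (simp add: mm add.assoc sup_assoc)
  qed
  have m_assoc1: "dmono c k A * dmono c' l B * z = dmono c k A * (dmono c' l B * z)"
    for c c' :: 'a and k l A B z
    by (subst (1 2) dform_expand [of z]) (simp only: sumr m_assoc)
  have m_assoc2: "dmono c k A * y * z = dmono c k A * (y * z)" for c :: 'a and k A y z
    by (subst (1 2) dform_expand [of y]) (simp only: sumr suml m_assoc1)
  fix a b c :: "'a dform"
  show "a * b * c = a * (b * c)"
    by (subst (1 2) dform_expand [of a]) (simp only: suml m_assoc2)
  have "1 * a = (\<Sum>p\<in>supp a. 1 * dmono (coeff a p) (fst p) (snd p))"
    by (subst (1) dform_expand [of a]) (rule sumr)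
  also have "\<dots> = a"
    by (subst (3) dform_expand [of a])
      (simp only: one_dform_def mm wedge_sign_empty mult_1_left add_0_left funion_fempty_left)
  finally show "1 * a = a" .
  have "a * 1 = (\<Sum>p\<in>supp a. dmono (coeff a p) (fst p) (snd p) * 1)"
    by (subst (1) dform_expand [of a]) (rule suml)
  also have "\<dots> = a"
    by (subst (3) dform_expand [of a])
      (simp only: one_dform_def mm wedge_sign_empty mult_1_left mult_1_right add_0_right
        funion_fempty_right)
  finally show "a * 1 = a" .
  show "(0::'a dform) \<noteq> 1"
  proof
    assume "(0::'a dform) = 1"
    then have "coeff (0::'a dform) (0, {||}) = coeff 1 (0, {||})"
      by simp
    then show False
      by (simp add: one_dform_def coeff_dmono)
  qed
  show "(a + b) * c = a * c + b * c" "a * (b + c) = a * b + a * c"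
    by (fact distr distl)+
qed

end

lemma dmono_mult_dmono:
  "dmono c k A * dmono c' l B = dmono (wedge_sign A B * c * c') (k + l) (A |\<union>| B)"
  for c c' :: "'a::comm_ring_1"
proof -
  have supp: "supp (dmono c k A) = (if c = 0 then {} else {(k, A)})" for c :: 'a and k A
    by (cases "c = 0") (simp_all add: supp_def coeff_dmono)
  show ?thesis
  proof (cases "c = 0 \<or> c' = 0")
    case True
    then show ?thesis
      by (elim disjE) (simp_all only: dmono_0 mult_zero_left mult_zero_right)
  next
    case False
    then show ?thesis
      unfolding times_dform_def supp by (simp add: coeff_dmono)
  qed
qed

definition dconst :: "'a::zero \<Rightarrow> 'a dform" where
  "dconst c = dmono c 0 {||}"

definition coord :: "nat \<Rightarrow> 'a::comm_ring_1 dform" where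
  "coord i = dmono 1 (Poly_Mapping.single i 1) {||}"

definition dcoord :: "nat \<Rightarrow> 'a::comm_ring_1 dform" where
  "dcoord i = dmono 1 0 {|i|}"

lemma coord_commute: "coord i * a = a * coord i"
proof -
  have "coord i * dmono c k S = dmono c k S * coord i" for c :: 'a and k S
    by (simp add: coord_def dmono_mult_dmono add.commute)
  then show ?thesis
    by (subst (1 2) dform_expand [of a]) (simp only: sum_distrib_left sum_distrib_right)
qed

lemma dcoord_square: "dcoord i * dcoord i = 0"
  by (simp add: dcoord_def dmono_mult_dmono wedge_sign_def)

lemma dcoord_mult_dcoord:
  assumes "i < j"
  shows "dcoord i * dcoord j = (dmono 1 0 {|i, j|} :: 'a::comm_ring_1 dform)"
    and "dcoord j * dcoord i = - (dmono 1 0 {|i, j|} :: 'a::comm_ring_1 dform)"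
proof -
  have 1: "{(a, b). a |\<in>| {|i|} \<and> b |\<in>| {|j|} \<and> b < a} = {}"
    using assms by (simp add: set_eq_iff)
  have 2: "{(a, b). a |\<in>| {|j|} \<and> b |\<in>| {|i|} \<and> b < a} = {(j, i)}"
    using assms by (auto 0 0 simp: set_eq_iff)
  have 3: "{|i|} |\<inter>| {|j|} = {||}" "{|j|} |\<inter>| {|i|} = {||}"
    using assms by simp_all
  have "wedge_sign {|i|} {|j|} = (1::'a)" "wedge_sign {|j|} {|i|} = (- 1::'a)"
    unfolding wedge_sign_def 1 2 3 by simp_all
  moreover have "{|j|} |\<union>| {|i|} = {|i, j|}" "{|i|} |\<union>| {|j|} = {|i, j|}"
    by (simp_all add: finsert_commute)
  moreover have "dmono (- 1) k S = (- dmono 1 k S :: 'a dform)" for k S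
    by (rule dform_eqI) (simp add: coeff_dmono)
  ultimately show "dcoord i * dcoord j = (dmono 1 0 {|i, j|} :: 'a dform)"
    "dcoord j * dcoord i = (- dmono 1 0 {|i, j|} :: 'a dform)"
    by (simp_all add: dcoord_def dmono_mult_dmono)
qed

definition ext_d :: "'a::comm_ring_1 dform \<Rightarrow> 'a dform" where
  "ext_d a = (\<Sum>(k, S)\<in>supp a. \<Sum>i\<in>vars k.
     dmono (coeff a (k, S) * of_nat (expo k i)) (k - Poly_Mapping.single i 1) {||} *
     dcoord i * dmono 1 0 S)"

lemma ext_d_coord: "ext_d (coord i) = dcoord i"
proof -
  have "supp (coord i :: 'a dform) = {(Poly_Mapping.single i 1, {||})}"
    by (auto simp: supp_def coord_def coeff_dmono)
  then show ?thesis
    by (simp add: ext_d_def coord_def coeff_dmono one_dform_def [symmetric])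
qed

text \<open>
  The homomorphism of differential graded algebras with \<open>x\<^sub>i \<mapsto> \<phi> i\<close> and \<open>dx\<^sub>i \<mapsto> d (\<phi> i)\<close>:
  the pullback of forms along the polynomial map with components \<open>\<phi> i\<close>.
\<close>

definition subst_form :: "(nat \<Rightarrow> 'a::comm_ring_1 dform) \<Rightarrow> 'a dform \<Rightarrow> 'a dform" where
  "subst_form \<phi> a = (\<Sum>(k, S)\<in>supp a. dconst (coeff a (k, S)) *
     prod_list (map (\<lambda>i. \<phi> i ^ expo k i) (sorted_list_of_set (vars k))) *
     prod_list (map (\<lambda>i. ext_d (\<phi> i)) (sorted_list_of_set (fset S))))"


section \<open>Polynomial forms on simplices\<close>

definition forms_on :: "nat set \<Rightarrow> nat set \<Rightarrow> 'a::comm_ring_1 dform set" where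
  "forms_on V W = {a. \<forall>(k, S)\<in>supp a. vars k \<subseteq> V \<and> fset S \<subseteq> W}"

text \<open>\<open>\<bbbK>[x\<^sub>0, \<dots>, x\<^sub>N, dx\<^sub>0, \<dots>, dx\<^sub>N]\<close> as a ring.\<close>

definition dform_ring :: "nat \<Rightarrow> 'a::comm_ring_1 dform ring" where
  "dform_ring N =
     \<lparr>carrier = forms_on {..N} {..N}, monoid.mult = (*), one = 1, ring.zero = 0, add = (+)\<rparr>"

lemma zero_in_forms_on: "0 \<in> forms_on V W"
  by (auto simp: forms_on_def in_supp_iff)

lemma one_in_forms_on: "1 \<in> forms_on V W"
  by (auto simp: forms_on_def in_supp_iff one_dform_def coeff_dmono split: if_splits)

lemma dmono_in_forms_on: "vars k \<subseteq> V \<Longrightarrow> fset S \<subseteq> W \<Longrightarrow> dmono c k S \<in> forms_on V W"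
  by (auto simp: forms_on_def in_supp_iff coeff_dmono split: if_splits)

lemma add_in_forms_on:
  assumes "a \<in> forms_on V W" "b \<in> forms_on V W"
  shows "a + b \<in> forms_on V W"
proof -
  have "supp (a + b) \<subseteq> supp a \<union> supp b"
    by (auto simp: in_supp_iff)
  then show ?thesis
    using assms by (fastforce simp: forms_on_def)
qed

lemma uminus_in_forms_on: "a \<in> forms_on V W \<Longrightarrow> - a \<in> forms_on V W"
  by (simp add: forms_on_def in_supp_iff)

lemma minus_in_forms_on: "a \<in> forms_on V W \<Longrightarrow> b \<in> forms_on V W \<Longrightarrow> a - b \<in> forms_on V W"
  using add_in_forms_on [of a V W "- b"] uminus_in_forms_on by fastforce

lemma sum_in_forms_on: "(\<And>i. i \<in> A \<Longrightarrow> f i \<in> forms_on V W) \<Longrightarrow> sum f A \<in> forms_on V W"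
  by (induction A rule: infinite_finite_induct) (simp_all add: zero_in_forms_on add_in_forms_on)

lemma mult_in_forms_on:
  assumes "a \<in> forms_on V W" "b \<in> forms_on V W"
  shows "a * b \<in> forms_on V W"
  unfolding times_dform_def
proof (intro sum_in_forms_on dmono_in_forms_on)
  fix p q assume "p \<in> supp a" "q \<in> supp b"
  with assms have "vars (fst p) \<subseteq> V \<and> fset (snd p) \<subseteq> W"
    "vars (fst q) \<subseteq> V \<and> fset (snd q) \<subseteq> W"
    by (simp_all add: forms_on_def case_prod_unfold)
  then show "vars (fst p + fst q) \<subseteq> V" "fset (snd p |\<union>| snd q) \<subseteq> W"
    using keys_add [of "fst p" "fst q"] by (blast, simp)
qed

lemma ring_dform_ring: "Ring.ring (dform_ring N :: 'a::comm_ring_1 dform ring)"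
proof (rule ringI)
  show "abelian_group (dform_ring N :: 'a dform ring)"
  proof (rule abelian_groupI)
    fix a :: "'a dform" assume "a \<in> carrier (dform_ring N)"
    then show "\<exists>b\<in>carrier (dform_ring N). b \<oplus>\<^bsub>dform_ring N\<^esub> a = \<zero>\<^bsub>dform_ring N\<^esub>"
      by (intro bexI [of _ "- a"]) (simp_all add: dform_ring_def uminus_in_forms_on)
  qed (simp_all add: dform_ring_def add_in_forms_on zero_in_forms_on add_ac)
  show "Group.monoid (dform_ring N :: 'a dform ring)"
    by (rule monoidI)
      (simp_all add: dform_ring_def mult_in_forms_on one_in_forms_on mult.assoc)
qed (simp_all add: dform_ring_def distrib_left distrib_right)

definition simplex_ideal :: "nat \<Rightarrow> 'a::comm_ring_1 dform set" where
  "simplex_ideal n =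
     Idl\<^bsub>dform_ring n\<^esub> {(\<Sum>i\<le>n. coord i) - 1, (\<Sum>i\<le>n. dcoord i)}"

lemma coord_in_forms_on: "i \<in> V \<Longrightarrow> coord i \<in> forms_on V W"
  by (simp add: coord_def dmono_in_forms_on)

lemma dcoord_in_forms_on: "i \<in> W \<Longrightarrow> dcoord i \<in> forms_on V W"
  by (simp add: dcoord_def dmono_in_forms_on)

lemma ideal_simplex_ideal: "ideal (simplex_ideal n :: 'a::comm_ring_1 dform set) (dform_ring n)"
  unfolding simplex_ideal_def
  by (rule ring.genideal_ideal [OF ring_dform_ring])
    (auto simp: dform_ring_def intro!: minus_in_forms_on one_in_forms_on sum_in_forms_on
      coord_in_forms_on dcoord_in_forms_on)

definition Omega :: "nat \<Rightarrow> 'a::comm_ring_1 dform set ring" where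
  "Omega n = dform_ring n Quot simplex_ideal n"

definition Omega_class :: "nat \<Rightarrow> 'a::comm_ring_1 dform \<Rightarrow> 'a dform set" where
  "Omega_class n a = simplex_ideal n +>\<^bsub>dform_ring n\<^esub> a"

text \<open>
  Forms on the product of the simplex with coordinates \<open>(s, t\<^sub>0, \<dots>, t\<^sub>n)\<close> and the simplex with
  coordinates \<open>(v\<^sub>0, \<dots>, v\<^sub>m)\<close>. The tensor product of the two graded-commutative algebras is
  presented by the union of the generators and of the relations of its factors; the generators
  \<open>(s, t\<^sub>0, \<dots>, t\<^sub>n, v\<^sub>0, \<dots>, v\<^sub>m)\<close> are numbered consecutively, so that \<open>\<alpha> \<otimes> \<beta>\<close> is the product
  of \<open>\<alpha>\<close> and of \<open>\<beta>\<close> shifted by \<open>n + 2\<close>.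
\<close>

definition coord_s :: "'a::comm_ring_1 dform" where
  "coord_s = coord 0"

definition coord_t :: "nat \<Rightarrow> 'a::comm_ring_1 dform" where
  "coord_t i = coord (i + 1)"

definition coord_v :: "nat \<Rightarrow> nat \<Rightarrow> 'a::comm_ring_1 dform" where
  "coord_v n l = coord (n + 2 + l)"

definition product_ideal :: "nat \<Rightarrow> nat \<Rightarrow> 'a::comm_ring_1 dform set" where
  "product_ideal n m = Idl\<^bsub>dform_ring (n + m + 2)\<^esub>
     {coord_s + (\<Sum>i\<le>n. coord_t i) - 1, ext_d coord_s + (\<Sum>i\<le>n. ext_d (coord_t i)),
      (\<Sum>l\<le>m. coord_v n l) - 1, (\<Sum>l\<le>m. ext_d (coord_v n l))}"

lemma ideal_product_ideal:
  "ideal (product_ideal n m :: 'a::comm_ring_1 dform set) (dform_ring (n + m + 2))"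
  unfolding product_ideal_def
  by (rule ring.genideal_ideal [OF ring_dform_ring])
    (auto simp: dform_ring_def coord_s_def coord_t_def coord_v_def ext_d_coord
      intro!: minus_in_forms_on add_in_forms_on one_in_forms_on sum_in_forms_on coord_in_forms_on dcoord_in_forms_on)

definition Omega_prod :: "nat \<Rightarrow> nat \<Rightarrow> 'a::comm_ring_1 dform set ring" where
  "Omega_prod n m = dform_ring (n + m + 2) Quot product_ideal n m"

definition prod_class :: "nat \<Rightarrow> nat \<Rightarrow> 'a::comm_ring_1 dform \<Rightarrow> 'a dform set" where
  "prod_class n m a = product_ideal n m +>\<^bsub>dform_ring (n + m + 2)\<^esub> a"

text \<open>
  The map of quotients induced by a linear map \<open>F\<close> that respects the ideals, where \<open>cls\<close>
  is the projection to the target quotient (the union is then over equal sets).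
\<close>

definition descend :: "('b \<Rightarrow> 'c set) \<Rightarrow> ('a \<Rightarrow> 'b) \<Rightarrow> 'a set \<Rightarrow> 'c set" where
  "descend cls F \<eta> = (\<Union>a\<in>\<eta>. cls (F a))"


section \<open>Integration\<close>

text \<open>
  The integral of \<open>x\<^sup>k dx\<^sub>A\<close> over the \<open>n\<close>-simplex; at most one summand is nonzero, and none is
  unless \<open>A\<close> has \<open>n\<close> elements.
\<close>

definition simplex_int :: "nat \<Rightarrow> (nat \<Rightarrow>\<^sub>0 nat) \<Rightarrow> nat fset \<Rightarrow> 'a::field_char_0" where
  "simplex_int n k A = (\<Sum>i\<le>n. if fset A = {..n} - {i}
     then (-1) ^ i * (\<Prod>j\<le>n. fact (expo k j)) / fact ((\<Sum>j\<le>n. expo k j) + n)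
     else 0)"

definition fibre_exp :: "nat \<Rightarrow> (nat \<Rightarrow>\<^sub>0 nat) \<Rightarrow> (nat \<Rightarrow>\<^sub>0 nat)" where
  "fibre_exp r k = Poly_Mapping.map_key (\<lambda>l. r + l) k"

lemma expo_fibre_exp: "expo (fibre_exp r k) l = expo k (r + l)"
  by (simp add: fibre_exp_def map_key.rep_eq)

definition fibre_set :: "nat \<Rightarrow> nat fset \<Rightarrow> nat fset" where
  "fibre_set r S = (\<lambda>i. i - r) |`| ffilter (\<lambda>i. r \<le> i) S"

text \<open>
  The map \<open>\<integral> \<otimes> Id\<close> on representatives: the generators with index at most \<open>n + 1\<close> are those of
  the first factor, and they precede those of the second factor in each basis monomial.
\<close>

definition fibre_int :: "nat \<Rightarrow> 'a::field_char_0 dform \<Rightarrow> 'a dform" where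
  "fibre_int n a = (\<Sum>(k, S)\<in>supp a.
     dmono (coeff a (k, S) * simplex_int (n + 1) k (ffilter (\<lambda>i. i \<le> n + 1) S))
       (fibre_exp (n + 2) k) (fibre_set (n + 2) S))"


section \<open>The operators\<close>

definition strict_incr :: "nat \<Rightarrow> nat \<Rightarrow> (nat \<Rightarrow> nat) set" where
  "strict_incr n m = {f \<in> {..n} \<rightarrow>\<^sub>E {..m}. strict_mono_on {..n} f}"

definition whitney :: "nat \<Rightarrow> nat \<Rightarrow> (nat \<Rightarrow> nat) \<Rightarrow> 'a::field_char_0 dform set" where
  "whitney m n f = Omega_class m (dconst (fact n) *
     (\<Sum>i\<le>n. (-1) ^ i * coord (f i) *
        prod_list (map (\<lambda>j. dcoord (f j)) (filter (\<lambda>j. j \<noteq> i) [0..<Suc n]))))"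

definition pullback :: "nat \<Rightarrow> nat \<Rightarrow> (nat \<Rightarrow> 'a::comm_ring_1 dform) \<Rightarrow> 'a dform set \<Rightarrow> 'a dform set"
  where "pullback n m \<phi> = descend (prod_class n m) (subst_form \<phi>)"

text \<open>
  \<open>\<Omega>\<^sub>m[s]\<close> inside the forms on the product for \<open>n = 0\<close>: the classes of forms in which
  \<open>ds\<close>, \<open>t\<^sub>0\<close> and \<open>dt\<^sub>0\<close> do not occur.
\<close>

definition Omega_s :: "nat \<Rightarrow> 'a::comm_ring_1 dform set set" where
  "Omega_s m = prod_class 0 m ` forms_on ({..m + 2} - {1}) {2..m + 2}"

text \<open>
  Integration in \<open>s\<close> from 0 to 1 of an element of \<open>\<Omega>\<^sub>m[s]\<close>. Monomials containing \<open>ds\<close> or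
  \<open>dt\<^sub>0\<close> are discarded, so that this respects the relation \<open>ds + dt\<^sub>0 = 0\<close>; the exponents of
  \<open>t\<^sub>0 = 1 - s\<close> and \<open>s\<close> are \<open>expo k 1\<close> and \<open>expo k 0\<close>.
\<close>

definition s_int :: "'a::field_char_0 dform \<Rightarrow> 'a dform" where
  "s_int a = (\<Sum>(k, S)\<in>supp a. if 0 |\<in>| S \<or> 1 |\<in>| S then 0 else
     dmono (coeff a (k, S) *
         (fact (expo k 1) * fact (expo k 0) / fact (expo k 1 + expo k 0 + 1)))
       (fibre_exp 2 k) (fibre_set 2 S))"

definition contraction_map :: "nat \<Rightarrow> nat \<Rightarrow> 'a::comm_ring_1 dform" where
  "contraction_map j l = coord_s * (if l = j then 1 else 0) + coord_t 0 * coord_v 0 l"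

definition h_vertex :: "nat \<Rightarrow> nat \<Rightarrow> 'a::field_char_0 dform set \<Rightarrow> 'a dform set" where
  "h_vertex m j \<eta> = descend (Omega_class m) s_int
     (THE \<alpha>. \<alpha> \<in> Omega_s m \<and> (\<exists>\<beta>\<in>Omega_s m. pullback 0 m (contraction_map j) \<eta> =
        prod_class 0 m (ext_d coord_s) \<otimes>\<^bsub>Omega_prod 0 m\<^esub> \<alpha> \<oplus>\<^bsub>Omega_prod 0 m\<^esub> \<beta>))"

text \<open>The composition of \<open>h_vertex m (f i)\<close> in which \<open>i = 0\<close> is applied first.\<close>

definition h_simplex ::
  "nat \<Rightarrow> nat \<Rightarrow> (nat \<Rightarrow> nat) \<Rightarrow> 'a::field_char_0 dform set \<Rightarrow> 'a dform set" where
  "h_simplex m n f = fold (\<lambda>i. h_vertex m (f i)) [0..<Suc n]"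

definition join_map :: "nat \<Rightarrow> (nat \<Rightarrow> nat) \<Rightarrow> nat \<Rightarrow> 'a::comm_ring_1 dform" where
  "join_map n f l = coord_s * coord_v n l + (\<Sum>i\<le>n. coord_t i * (if l = f i then 1 else 0))"

definition k_simplex ::
  "nat \<Rightarrow> nat \<Rightarrow> (nat \<Rightarrow> nat) \<Rightarrow> 'a::field_char_0 dform set \<Rightarrow> 'a dform set" where
  "k_simplex m n f \<eta> = descend (Omega_class m) (fibre_int n) (pullback n m (join_map n f) \<eta>)"

definition h_op :: "nat \<Rightarrow> 'a::field_char_0 dform set \<Rightarrow> 'a dform set" where
  "h_op m \<eta> = (\<Oplus>\<^bsub>Omega m\<^esub>n\<in>{..m}. \<Oplus>\<^bsub>Omega m\<^esub>f\<in>strict_incr n m.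
     whitney m n f \<otimes>\<^bsub>Omega m\<^esub> h_simplex m n f \<eta>)"

definition k_op :: "nat \<Rightarrow> 'a::field_char_0 dform set \<Rightarrow> 'a dform set" where
  "k_op m \<eta> = (\<Oplus>\<^bsub>Omega m\<^esub>n\<in>{..m}. \<Oplus>\<^bsub>Omega m\<^esub>f\<in>strict_incr n m.
     whitney m n f \<otimes>\<^bsub>Omega m\<^esub> k_simplex m n f \<eta>)"

end

theory Submission
  imports Defs "HOL.Modules"
begin

text \<open>
  For every \<open>f\<close> the operators \<open>h\<^sub>f\<close> and \<open>k\<^sub>f\<close> coincide, so the two sums agree term by term. The
  reason is Fubini's theorem: \<open>k\<^sub>f\<close> integrates over a simplex, and \<open>h\<^sub>f\<close> evaluates the same integral
  one vertex at a time.

  Consider the map \<open>((s, t), (\<sigma>, \<tau>)) \<mapsto> (s \<sigma>, t\<^sub>0, \<dots>, t\<^sub>n, s \<tau>)\<close>, called \<open>join_split\<close> below, from the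
  product of the simplices with coordinates \<open>(s, t\<^sub>0, \<dots>, t\<^sub>n)\<close> and \<open>(\<sigma>, \<tau>)\<close> to the simplex with one
  more coordinate \<open>t\<^bsub>n+1\<^esub>\<close>. Since
  \<open>s (\<sigma> v + \<tau> e\<^bsub>f(n+1)\<^esub>) + \<Sum>\<^sub>i t\<^sub>i e\<^bsub>f(i)\<^esub> = (s \<sigma>) v + \<Sum>\<^sub>i t\<^sub>i e\<^bsub>f(i)\<^esub> + (s \<tau>) e\<^bsub>f(n+1)\<^esub>\<close>, the join map of
  \<open>f\<close> composed with it is the join map of the restriction of \<open>f\<close> to \<open>{0, \<dots>, n}\<close> with \<open>v\<close> replaced by
  \<open>\<sigma> v + \<tau> e\<^bsub>f(n+1)\<^esub>\<close>. The integral over the big simplex is the iterated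
  integral of the pullback (\<open>fibre_int_Suc\<close>). Together, by naturality of fibre integration
  (\<open>subst_form_fibre_int\<close>), these facts express \<open>k\<^sub>f\<close> through the previous operator and the operator
  of one vertex (\<open>join_int_Suc\<close>). For one vertex, the contraction \<open>s e\<^sub>j + t\<^sub>0 v\<close> that defines \<open>h\<^sub>j\<close> and
  the join map \<open>s v + t\<^sub>0 e\<^sub>j\<close> differ by the exchange of \<open>s\<close> and \<open>t\<^sub>0\<close>. This reverses the orientation,
  and the coefficient of \<open>ds\<close> integrated from 0 to 1 is minus the integral over the simplex with
  coordinates \<open>(s, t\<^sub>0)\<close>; the two signs cancel (\<open>join_int_0\<close>).

  All these identities hold for representatives, that is, for forms in free generators. They become
  finite computations for two reasons: pullbacks are homomorphisms of graded algebras commuting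
  with \<open>d\<close> on functions, and integration is linear over the forms of the second factor and kills
  multiples of \<open>\<Sum>\<^sub>i dx\<^sub>i\<close>, so that only monomials without \<open>dx\<^sub>0\<close> in the variables of the simplex have
  to be compared. The quotients enter at the end. Integration and pullback respect the ideals of
  relations, and the form \<open>\<alpha>\<close> in the definition of \<open>h\<^sub>j\<close> exists because \<open>t\<^sub>0\<close> can be replaced by
  \<open>1 - s\<close>; it is unique because taking the coefficient of \<open>ds\<close> after this substitution preserves
  the ideal.
\<close>

section \<open>Monomials and generators\<close>

lemma sum_supp_mono:
  fixes F :: "dmon \<Rightarrow> 'a::ab_group_add \<Rightarrow> 'b::comm_monoid_add"
  assumes "\<And>p. F p 0 = 0" "finite X" "supp a \<subseteq> X"
  shows "(\<Sum>p\<in>supp a. F p (coeff a p)) = (\<Sum>p\<in>X. F p (coeff a p))"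
  by (rule sum.mono_neutral_left) (use assms in \<open>auto simp: in_supp_iff\<close>)

lemma sum_supp_add:
  fixes F :: "dmon \<Rightarrow> 'a::ab_group_add \<Rightarrow> 'b::comm_monoid_add"
  assumes "\<And>p. F p 0 = 0" "\<And>p c c'. F p (c + c') = F p c + F p c'"
  shows "(\<Sum>p\<in>supp (a + b). F p (coeff (a + b) p)) =
    (\<Sum>p\<in>supp a. F p (coeff a p)) + (\<Sum>p\<in>supp b. F p (coeff b p))"
proof -
  have "supp (a + b) \<subseteq> supp a \<union> supp b"
    by (auto simp: in_supp_iff)
  then show ?thesis
    by (simp add: sum_supp_mono [where X = "supp a \<union> supp b" and F = F] assms sum.distrib
        del: coeff_add) (simp add: assms sum.distrib)
qed

lemma sum_supp_dmono:
  fixes F :: "dmon \<Rightarrow> 'a::ab_group_add \<Rightarrow> 'b::comm_monoid_add"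
  assumes "\<And>p. F p 0 = 0"
  shows "(\<Sum>p\<in>supp (dmono c k S). F p (coeff (dmono c k S) p)) = F (k, S) c"
proof -
  have "supp (dmono c k S) \<subseteq> {(k, S)}"
    by (auto simp: in_supp_iff coeff_dmono split: if_splits)
  then show ?thesis
    by (simp only: sum_supp_mono [where X = "{(k, S)}" and F = F] assms finite.intros)
      (simp add: coeff_dmono)
qed

lemma additive_eqI:
  fixes F G :: "'a::ab_group_add dform \<Rightarrow> 'b::ab_group_add"
  assumes "additive F" "additive G" "\<And>c k S. F (dmono c k S) = G (dmono c k S)"
  shows "F a = G a"
  by (subst (1 2) dform_expand [of a]) (simp only: additive.sum [OF assms(1)] additive.sum [OF assms(2)] assms(3))

lemma dmono_split: "dmono (c * c') k S = dconst c * dmono c' k S"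
  by (simp add: dconst_def dmono_mult_dmono)

lemma dconst_simps:
  "dconst 0 = 0" "dconst 1 = 1" "dconst (c + c') = dconst c + dconst c'" "dconst (- c) = - dconst c"
  "dconst (c * c') = dconst c * dconst c'"
  for c c' :: "'a::comm_ring_1"
proof -
  show "dconst (- c) = - dconst c"
    by (rule dform_eqI) (simp add: dconst_def coeff_dmono)
qed (simp_all add: dconst_def one_dform_def dmono_add dmono_mult_dmono)

lemma dconst_in_forms_on: "dconst c \<in> forms_on V W"
  by (simp add: dconst_def dmono_in_forms_on)

lemma forms_on_mono: "a \<in> forms_on V W \<Longrightarrow> V \<subseteq> V' \<Longrightarrow> W \<subseteq> W' \<Longrightarrow> a \<in> forms_on V' W'"
  by (force simp: forms_on_def)

lemma in_forms_on_UNIV [simp]: "a \<in> forms_on UNIV UNIV"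
  by (auto simp: forms_on_def)

lemma coord_mult_dmono: "coord i * dmono c k S = dmono c (Poly_Mapping.single i 1 + k) S"
  by (simp add: coord_def dmono_mult_dmono)

lemma wedge_sign_unit: "i |\<notin>| S \<Longrightarrow> wedge_sign {|i|} S * wedge_sign {|i|} S = (1::'a::comm_ring_1)"
  by (simp add: wedge_sign_def power_mult_distrib [symmetric])

lemma wedge_sign_single_left:
  assumes "i |\<notin>| S"
  shows "wedge_sign {|i|} S = ((- 1) ^ card {b \<in> fset S. b < i} :: 'a::comm_ring_1)"
proof -
  have "{(a, b). a |\<in>| {|i|} \<and> b |\<in>| S \<and> b < a} = Pair i ` {b \<in> fset S. b < i}"
    by auto
  then have "card {(a, b). a |\<in>| {|i|} \<and> b |\<in>| S \<and> b < a} = card {b \<in> fset S. b < i}"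
    by (simp add: card_image inj_on_def)
  with assms show ?thesis
    by (simp add: wedge_sign_def)
qed

lemma dcoord_mult_dmono: "dcoord i * dmono c k S = dmono (wedge_sign {|i|} S * c) k (finsert i S)"
  by (simp add: dcoord_def dmono_mult_dmono)

lemma dmono_mult_dcoord: "dmono c k S * dcoord i = dmono (wedge_sign S {|i|} * c) k (finsert i S)"
  by (simp add: dcoord_def dmono_mult_dmono)

lemma exponent_induct [consumes 1, case_names zero add]:
  assumes "vars k \<subseteq> V" "P 0"
    and step: "\<And>i k. i \<in> V \<Longrightarrow> vars k \<subseteq> V \<Longrightarrow> P k \<Longrightarrow> P (Poly_Mapping.single i 1 + k)"
  shows "P k"
proof -
  have "P k" if "finite A" "vars k \<subseteq> A" "A \<subseteq> V" for A k
    using that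
  proof (induction A arbitrary: k rule: finite_induct)
    case empty
    then show ?case
      using assms(2) by simp
  next
    case (insert i A)
    define k' where "k' = k - Poly_Mapping.single i (expo k i)"
    have k': "vars k' \<subseteq> A"
    proof
      fix j assume "j \<in> vars k'"
      then have "expo k j - (expo k i when i = j) \<noteq> 0"
        by (simp add: k'_def in_keys_iff lookup_minus lookup_single)
      then have "j \<noteq> i" "j \<in> vars k"
        by (auto simp: in_keys_iff when_def split: if_splits)
      then show "j \<in> A"
        using insert.prems by auto
    qed
    have "P (Poly_Mapping.single i n + k')" for n
    proof (induction n)
      case 0
      then show ?case
        using insert.IH [OF k'] insert.prems by simp
    next
      case (Suc n)
      have "vars (Poly_Mapping.single i n + k') \<subseteq> V"
        using k' keys_add [of "Poly_Mapping.single i n" k'] insert.prems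
        by (auto split: if_splits)
      then have "P (Poly_Mapping.single i 1 + (Poly_Mapping.single i n + k'))"
        using Suc insert.prems by (intro step) auto
      then show ?case
        by (simp add: add.assoc [symmetric] single_add [symmetric])
    qed
    moreover have "Poly_Mapping.single i (expo k i) + k' = k"
      by (rule poly_mapping_eqI) (simp add: k'_def lookup_add lookup_minus lookup_single when_def)
    ultimately show ?case
      by metis
  qed
  from this [of "vars k" k] show ?thesis
    using assms(1) by simp
qed

lemma forms_on_dmono_induct [consumes 1, case_names add dmono]:
  fixes a :: "'a::comm_ring_1 dform"
  assumes "a \<in> forms_on V W"
    and add: "\<And>a b. a \<in> forms_on V W \<Longrightarrow> b \<in> forms_on V W \<Longrightarrow> P a \<Longrightarrow> P b \<Longrightarrow> P (a + b)"
    and dmono: "\<And>c k S. vars k \<subseteq> V \<Longrightarrow> fset S \<subseteq> W \<Longrightarrow> P (dmono c k S)"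
  shows "P a"
proof -
  have sum: "(\<Sum>p\<in>X. f p) \<in> forms_on V W \<and> P (\<Sum>p\<in>X. f p)"
    if "finite X" "\<And>p. p \<in> X \<Longrightarrow> f p \<in> forms_on V W \<and> P (f p)" for f :: "dmon \<Rightarrow> 'a dform" and X
    using that
  proof (induction X rule: finite_induct)
    case empty
    then show ?case
      using dmono [of 0 "{||}" 0] by (simp add: zero_in_forms_on)
  next
    case (insert p X)
    then show ?case
      by (simp add: add add_in_forms_on)
  qed
  have "P (\<Sum>p\<in>supp a. dmono (coeff a p) (fst p) (snd p))"
  proof (rule sum [THEN conjunct2])
    fix p assume "p \<in> supp a"
    then have "vars (fst p) \<subseteq> V" "fset (snd p) \<subseteq> W"
      using assms(1) by (simp_all add: forms_on_def case_prod_unfold)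
    then show "dmono (coeff a p) (fst p) (snd p) \<in> forms_on V W \<and>
        P (dmono (coeff a p) (fst p) (snd p))"
      by (intro conjI dmono dmono_in_forms_on)
  qed simp
  then show ?thesis
    using dform_expand [of a] by simp
qed

lemma forms_on_induct [consumes 1, case_names add const coord dcoord]:
  fixes a :: "'a::comm_ring_1 dform"
  assumes "a \<in> forms_on V W"
    and add: "\<And>a b. a \<in> forms_on V W \<Longrightarrow> b \<in> forms_on V W \<Longrightarrow> P a \<Longrightarrow> P b \<Longrightarrow> P (a + b)"
    and const: "\<And>c. P (dconst c)"
    and coord: "\<And>i a. i \<in> V \<Longrightarrow> a \<in> forms_on V W \<Longrightarrow> P a \<Longrightarrow> P (coord i * a)"
    and dcoord: "\<And>i a. i \<in> W \<Longrightarrow> a \<in> forms_on V W \<Longrightarrow> P a \<Longrightarrow> P (dcoord i * a)"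
  shows "P a"
proof -
  have odd: "P (dmono c 0 S)" if "fset S \<subseteq> W" for c S
    using that
  proof (induction S arbitrary: c)
    case empty
    then show ?case
      using const by (simp add: dconst_def)
  next
    case (insert i S)
    \<comment> \<open>The coefficient absorbs the sign of moving \<open>dx\<^sub>i\<close> into place.\<close>
    have "P (dcoord i * dmono (wedge_sign {|i|} S * c) 0 S)"
      using insert by (intro dcoord) (auto intro: dmono_in_forms_on)
    moreover have "wedge_sign {|i|} S * (wedge_sign {|i|} S * c) = c"
      by (simp only: mult.assoc [symmetric] wedge_sign_unit [OF insert.hyps] mult_1_left)
    ultimately show ?case
      by (simp add: dcoord_mult_dmono)
  qed
  have mono: "P (dmono c k S)" if "vars k \<subseteq> V" "fset S \<subseteq> W" for c k S
    using that(1)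
  proof (induction k rule: exponent_induct)
    case (add i k)
    then have "P (coord i * dmono c k S)"
      using that(2) by (intro coord dmono_in_forms_on)
    then show ?case
      by (simp only: coord_mult_dmono)
  qed (use odd that in simp)
  show ?thesis
    using assms(1) by (rule forms_on_dmono_induct) (fact add, fact mono)
qed

lemmas dform_induct = forms_on_induct [of _ UNIV UNIV, simplified, case_names add const coord dcoord]

section \<open>Graded commutativity\<close>

lemma dconst_commute: "dconst c * a = a * dconst c"
proof -
  have "dconst c * dmono c' k S = dmono c' k S * dconst c" for c' :: 'a and k S
    by (simp add: dconst_def dmono_mult_dmono mult.commute)
  then show ?thesis
    by (subst (1 2) dform_expand [of a]) (simp only: sum_distrib_left sum_distrib_right)
qed

lemma function_commute:
  assumes "f \<in> forms_on V {}"
  shows "f * a = a * f"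
  using assms
proof (induction rule: forms_on_induct)
  case (add f g)
  then show ?case by (simp add: distrib_left distrib_right)
next
  case (coord i f)
  have "coord i * f * a = (coord i * a) * f"
    using coord by (simp add: mult.assoc)
  also have "\<dots> = a * (coord i * f)"
    by (simp only: coord_commute [of i a] mult.assoc)
  finally show ?case .
qed (simp_all add: dconst_commute)

lemma dcoord_anticommute: "dcoord i * dcoord j = - (dcoord j * dcoord i)"
  by (cases i j rule: linorder_cases) (simp_all add: dcoord_mult_dcoord dcoord_square)

text \<open>
  The form \<open>a'\<close> is \<open>a\<close> with the sign of its odd part reversed. As it does not depend on \<open>i\<close>, the rule
  also moves sums such as \<open>\<Sum>\<^sub>i dx\<^sub>i\<close> past an arbitrary form.
\<close>

lemma dcoord_mult_swap:
  fixes a :: "'a::comm_ring_1 dform"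
  assumes "a \<in> forms_on V W"
  obtains a' where "a' \<in> forms_on V W" "\<And>i. dcoord i * a = a' * dcoord i" "\<And>i. dcoord i * a' = a * dcoord i"
proof -
  have "\<exists>a' \<in> forms_on V W. \<forall>i. dcoord i * a = a' * dcoord i \<and> dcoord i * a' = a * dcoord i"
    using assms
  proof (induction rule: forms_on_induct)
    case (add a b)
    then obtain a' b' where "a' \<in> forms_on V W" "b' \<in> forms_on V W"
      "\<forall>i. dcoord i * a = a' * dcoord i \<and> dcoord i * a' = a * dcoord i"
      "\<forall>i. dcoord i * b = b' * dcoord i \<and> dcoord i * b' = b * dcoord i"
      by blast
    then show ?case
      by (intro bexI [of _ "a' + b'"]) (simp_all add: distrib_left distrib_right add_in_forms_on)
  next
    case (const c)
    then show ?case
      by (intro bexI [of _ "dconst c"]) (simp_all add: dconst_commute dconst_in_forms_on)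
  next
    case (coord j a)
    then obtain a' where a': "a' \<in> forms_on V W"
      "\<And>i. dcoord i * a = a' * dcoord i" "\<And>i. dcoord i * a' = a * dcoord i"
      by blast
    have "dcoord i * (coord j * b) = coord j * (dcoord i * b)" for i and b :: "'a dform"
      by (simp only: mult.assoc [symmetric] coord_commute [of j "dcoord i"])
    with a' show ?case
      using coord by (intro bexI [of _ "coord j * a'"])
        (simp_all add: mult.assoc mult_in_forms_on coord_in_forms_on)
  next
    case (dcoord j a)
    then obtain a' where a': "a' \<in> forms_on V W"
      "\<And>i. dcoord i * a = a' * dcoord i" "\<And>i. dcoord i * a' = a * dcoord i"
      by blast
    have swap: "dcoord i * (dcoord j * b) = - (dcoord j * (dcoord i * b))" for i and b :: "'a dform"
      by (simp only: mult.assoc [symmetric] dcoord_anticommute [of i j] mult_minus_left)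
    have "dcoord i * (dcoord j * a) = - (dcoord j * a') * dcoord i"
      "dcoord i * - (dcoord j * a') = dcoord j * a * dcoord i" for i
      by (simp_all only: swap [of i] a'(2) [of i] a'(3) [of i] mult_minus_right mult_minus_left
          mult.assoc minus_minus)
    then show ?case
      using dcoord a'(1) by (intro bexI [of _ "- (dcoord j * a')"])
        (simp_all add: mult_in_forms_on dcoord_in_forms_on uminus_in_forms_on)
  qed
  then show ?thesis
    using that by blast
qed

section \<open>The differential on functions\<close>

text \<open>
  The differential, pullback, both integrals and the contraction below are sums over the support of
  terms that depend additively on the coefficient.
\<close>

lemma additive_extension:
  fixes F :: "dmon \<Rightarrow> 'a::ab_group_add \<Rightarrow> 'b::ab_group_add"
  assumes "\<And>p. F p 0 = 0" "\<And>p c c'. F p (c + c') = F p c + F p c'"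
  shows "additive (\<lambda>a. \<Sum>p\<in>supp a. F p (coeff a p))"
  by standard (rule sum_supp_add [OF assms])

lemma ext_d_eq: "ext_d a = (\<Sum>p\<in>supp a. \<Sum>i\<in>vars (fst p).
     dmono (coeff a p * of_nat (expo (fst p) i)) (fst p - Poly_Mapping.single i 1) {||} *
     dcoord i * dmono 1 0 (snd p))"
  by (simp add: ext_d_def case_prod_unfold)

lemma additive_ext_d: "additive (ext_d :: 'a::comm_ring_1 dform \<Rightarrow> _)"
  unfolding ext_d_eq [abs_def]
  by (rule additive_extension [where F = "\<lambda>p c. \<Sum>i\<in>vars (fst p).
     dmono (c * of_nat (expo (fst p) i)) (fst p - Poly_Mapping.single i 1) {||} *
     dcoord i * dmono 1 0 (snd p)"])
    (simp_all add: distrib_right dmono_add sum.distrib)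

lemma ext_d_dmono:
  fixes c :: "'a::comm_ring_1"
  assumes "finite X" "vars k \<subseteq> X"
  shows "ext_d (dmono c k S) = (\<Sum>i\<in>X.
     dmono (c * of_nat (expo k i)) (k - Poly_Mapping.single i 1) {||} * dcoord i * dmono 1 0 S)"
proof -
  have "ext_d (dmono c k S) = (\<Sum>i\<in>vars k.
     dmono (c * of_nat (expo k i)) (k - Poly_Mapping.single i 1) {||} * dcoord i * dmono 1 0 S)"
    unfolding ext_d_eq
    by (subst sum_supp_dmono [where F = "\<lambda>p c. \<Sum>i\<in>vars (fst p).
     dmono (c * of_nat (expo (fst p) i)) (fst p - Poly_Mapping.single i 1) {||} *
     dcoord i * dmono 1 0 (snd p)"]) simp_all
  also have "\<dots> = (\<Sum>i\<in>X.
     dmono (c * of_nat (expo k i)) (k - Poly_Mapping.single i 1) {||} * dcoord i * dmono 1 0 S)"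
    by (rule sum.mono_neutral_left) (use assms in \<open>auto simp: in_keys_iff\<close>)
  finally show ?thesis .
qed

text \<open>
  The Leibniz rule for multiplication by a generator \<open>x\<^sub>j\<close>; induction over the generators extends it
  to all functions.
\<close>

lemma ext_d_coord_mult:
  fixes a :: "'a::comm_ring_1 dform"
  shows "ext_d (coord j * a) = dcoord j * a + coord j * ext_d a"
proof (rule additive_eqI [where F = "\<lambda>a. ext_d (coord j * a)" and
    G = "\<lambda>a. dcoord j * a + coord j * ext_d a"])
  show "additive (\<lambda>a::'a dform. ext_d (coord j * a))"
    "additive (\<lambda>a::'a dform. dcoord j * a + coord j * ext_d a)"
    by standard (simp_all add: distrib_left additive.add [OF additive_ext_d])
  fix c :: 'a and k S
  \<comment> \<open>The sums on both sides run over different variables, as \<open>x\<^sub>j\<close> need not divide \<open>x\<^sup>k\<close>.\<close>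
  let ?k = "Poly_Mapping.single j 1 + k" and ?X = "insert j (vars k)"
  have *: "dmono (c * of_nat (expo ?k i)) (?k - Poly_Mapping.single i 1) {||} =
     (if i = j then dmono c k {||} else 0) +
     coord j * dmono (c * of_nat (expo k i)) (k - Poly_Mapping.single i 1) {||}" for i
  proof (cases "expo k i = 0")
    case True
    then show ?thesis
      by (simp add: lookup_add lookup_single when_def)
  next
    case False
    then have "?k - Poly_Mapping.single i 1 = Poly_Mapping.single j 1 + (k - Poly_Mapping.single i 1)"
      by (intro poly_mapping_eqI) (auto simp: lookup_add lookup_minus lookup_single when_def)
    moreover have "?k - Poly_Mapping.single i 1 = k" if "i = j"
      using that by simp
    ultimately show ?thesis
      by (auto simp: coord_mult_dmono lookup_add lookup_single when_def distrib_left dmono_add add.commute)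
  qed
  have "vars ?k \<subseteq> ?X"
    using keys_add [of "Poly_Mapping.single j 1" k] by (auto split: if_splits)
  then have "ext_d (coord j * dmono c k S) = (\<Sum>i\<in>?X. dmono (c * of_nat (expo ?k i))
      (?k - Poly_Mapping.single i 1) {||} * dcoord i * dmono 1 0 S)"
    unfolding coord_mult_dmono by (intro ext_d_dmono) simp_all
  also have "\<dots> = (\<Sum>i\<in>?X. ((if i = j then dmono c k {||} else 0) +
      coord j * dmono (c * of_nat (expo k i)) (k - Poly_Mapping.single i 1) {||}) *
      dcoord i * dmono 1 0 S)"
    by (simp only: *)
  also have "\<dots> = (\<Sum>i\<in>?X. if i = j then dmono c k {||} * dcoord j * dmono 1 0 S else 0)
     + coord j * ext_d (dmono c k S)"
    by (subst ext_d_dmono [of ?X]; (simp only: sum_distrib_left flip: sum.distrib)?; (rule sum.cong)?)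
      (auto simp: distrib_right mult.assoc)
  also have "(\<Sum>i\<in>?X. if i = j then dmono c k {||} * dcoord j * dmono 1 0 S else 0) =
      dmono c k {||} * dcoord j * dmono 1 0 S"
    by (simp add: sum.delta)
  also have "\<dots> = dcoord j * dmono c k S"
    by (simp add: dcoord_def dmono_mult_dmono mult.commute)
  finally show "ext_d (coord j * dmono c k S) = dcoord j * dmono c k S + coord j * ext_d (dmono c k S)" .
qed

lemma ext_d_dconst [simp]: "ext_d (dconst c) = 0"
  using ext_d_dmono [of "{}" 0 c "{||}"] by (simp add: dconst_def)

lemma ext_d_one [simp]: "ext_d 1 = 0"
  using ext_d_dconst [of 1] by (simp add: dconst_simps)

abbreviation fun_forms :: "'a::comm_ring_1 dform set" where
  "fun_forms \<equiv> forms_on UNIV {}"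

lemma function_left_commute: "f \<in> forms_on V {} \<Longrightarrow> a * (f * b) = f * (a * b)"
  by (simp only: mult.assoc [symmetric] function_commute [of f V a])

lemma coord_left_commute: "a * (coord i * b) = coord i * (a * b)"
  by (simp only: mult.assoc [symmetric] coord_commute [of i a])

lemma ext_d_function_mult:
  assumes "f \<in> forms_on V {}"
  shows "ext_d (f * a) = ext_d f * a + f * ext_d a"
  using assms
proof (induction rule: forms_on_induct)
  case (const c)
  show ?case
  proof (rule additive_eqI [of "\<lambda>a. ext_d (dconst c * a)" "\<lambda>a. ext_d (dconst c) * a + dconst c * ext_d a"])
    show "additive (\<lambda>a. ext_d (dconst c * a))" "additive (\<lambda>a. ext_d (dconst c) * a + dconst c * ext_d a)"
      by standard (simp_all add: distrib_left additive.add [OF additive_ext_d])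
    fix c' k S
    show "ext_d (dconst c * dmono c' k S) = ext_d (dconst c) * dmono c' k S + dconst c * ext_d (dmono c' k S)"
      by (simp add: ext_d_dmono [of "vars k"] sum_distrib_left mult.assoc [symmetric]
          dmono_split [symmetric])
  qed
next
  case (coord i f)
  then show ?case
    by (simp add: ext_d_coord_mult mult.assoc distrib_left distrib_right add.assoc)
qed (simp_all add: additive.add [OF additive_ext_d] distrib_right)

lemma dcoord_ext_d_anticommute:
  assumes "f \<in> forms_on V {}"
  shows "dcoord i * ext_d f = - (ext_d f * dcoord i)"
  using assms
proof (induction rule: forms_on_induct)
  case (coord j f)
  have "dcoord i * (dcoord j * f) = - (dcoord j * f * dcoord i)"
    using function_commute [OF coord.hyps(2), of "dcoord i"]
    by (simp only: mult.assoc [symmetric] dcoord_anticommute [of i j] mult_minus_left) (simp add: mult.assoc)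
  then show ?case
    using coord
    by (simp add: ext_d_coord_mult distrib_left distrib_right coord_left_commute [of "dcoord i"] mult.assoc)
qed (simp_all add: additive.add [OF additive_ext_d] distrib_left distrib_right)

text \<open>
  Differentials of functions are combinations of the \<open>dx\<^sub>i\<close> with central coefficients. Hence they
  anticommute like the \<open>dx\<^sub>i\<close>, which makes pullback compatible with the signs of wedge products.
\<close>

lemma ext_d_anticommute:
  assumes "f \<in> forms_on V {}" "g \<in> forms_on V {}"
  shows "ext_d f * ext_d g = - (ext_d g * ext_d f)"
  using assms(1)
proof (induction rule: forms_on_induct)
  case (coord j f)
  have "dcoord j * f * ext_d g = - (ext_d g * (dcoord j * f))"
    using function_commute [OF coord.hyps(2), of "ext_d g"] dcoord_ext_d_anticommute [OF assms(2), of j]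
    by (simp add: mult.assoc) (simp add: mult.assoc [symmetric])
  then show ?case
    using coord
    by (simp add: ext_d_coord_mult distrib_left distrib_right coord_left_commute [of "ext_d g"] mult.assoc)
qed (simp_all add: additive.add [OF additive_ext_d] distrib_left distrib_right)

lemma ext_d_square:
  assumes "f \<in> forms_on V {}"
  shows "ext_d f * ext_d f = 0"
  using assms
proof (induction rule: forms_on_induct)
  case (add f g)
  then show ?case
    using ext_d_anticommute [OF add.hyps(1,2)]
    by (simp add: additive.add [OF additive_ext_d] distrib_left distrib_right)
next
  case (coord j f)
  let ?x = "coord j" and ?d = "dcoord j" and ?e = "ext_d f"
  note f = coord.hyps(2)
  have "?d * (?d * f) = 0"
    by (simp add: mult.assoc [symmetric] dcoord_square)
  then have dd: "?d * (f * (?d * f)) = 0"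
    by (simp only: function_left_commute [OF f, of ?d] mult_zero_right)
  have ee: "?e * (?x * ?e) = 0"
    using coord by (simp only: coord_left_commute [of ?e] mult_zero_right)
  have "?e * (?d * f) = f * (?e * ?d)"
    by (simp only: function_commute [OF f, of ?d, symmetric] function_left_commute [OF f, of ?e])
  moreover have "?d * (f * (?x * ?e)) = ?x * (f * (?d * ?e))"
    by (simp only: coord_left_commute [of f] coord_left_commute [of ?d] function_left_commute [OF f, of ?d])
  ultimately have "?x * (?e * (?d * f)) + ?d * (f * (?x * ?e)) = ?x * (f * (?e * ?d + ?d * ?e))"
    by (simp add: distrib_left)
  also have "\<dots> = 0"
    using dcoord_ext_d_anticommute [OF f, of j] by simp
  finally show ?case
    using dd ee by (simp add: ext_d_coord_mult distrib_left distrib_right mult.assoc add.commute)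
qed simp_all

section \<open>Pullback is a homomorphism\<close>

text \<open>
  The values of a pullback on \<open>x\<^sup>k\<close> and on \<open>dx\<^sub>S\<close>.
\<close>

definition mono_value :: "(nat \<Rightarrow> 'a::comm_ring_1 dform) \<Rightarrow> (nat \<Rightarrow>\<^sub>0 nat) \<Rightarrow> 'a dform" where
  "mono_value \<phi> k = prod_list (map (\<lambda>i. \<phi> i ^ expo k i) (sorted_list_of_set (vars k)))"

definition wedge_value :: "(nat \<Rightarrow> 'a::comm_ring_1 dform) \<Rightarrow> nat fset \<Rightarrow> 'a dform" where
  "wedge_value \<phi> S = prod_list (map (\<lambda>i. ext_d (\<phi> i)) (sorted_list_of_set (fset S)))"

lemma subst_form_eq:
  "subst_form \<phi> a = (\<Sum>p\<in>supp a. dconst (coeff a p) * mono_value \<phi> (fst p) * wedge_value \<phi> (snd p))"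
  by (simp add: subst_form_def mono_value_def wedge_value_def case_prod_unfold)

lemma additive_subst_form: "additive (subst_form \<phi>)"
  unfolding subst_form_eq [abs_def]
  by (rule additive_extension [where F = "\<lambda>p c. dconst c * mono_value \<phi> (fst p) * wedge_value \<phi> (snd p)"])
    (simp_all add: dconst_simps distrib_right)

lemma subst_form_dmono:
  "subst_form \<phi> (dmono c k S) = dconst c * mono_value \<phi> k * wedge_value \<phi> S"
  unfolding subst_form_eq
  by (subst sum_supp_dmono [where F = "\<lambda>p c. dconst c * mono_value \<phi> (fst p) * wedge_value \<phi> (snd p)"])
    (simp_all add: dconst_simps)

text \<open>
  Components of degree 0 are central and have anticommuting differentials; for them the pullback is
  an algebra homomorphism.
\<close>

definition function_map :: "(nat \<Rightarrow> 'a::comm_ring_1 dform) \<Rightarrow> bool" where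
  "function_map \<phi> \<longleftrightarrow> (\<forall>i. \<phi> i \<in> fun_forms)"

lemma function_mapD: "function_map \<phi> \<Longrightarrow> \<phi> i \<in> fun_forms"
  by (simp add: function_map_def)

lemma power_in_forms_on: "a \<in> forms_on V W \<Longrightarrow> a ^ n \<in> forms_on V W"
  by (induction n) (simp_all add: one_in_forms_on mult_in_forms_on)

lemma prod_list_in_forms_on:
  "(\<And>x. x \<in> set xs \<Longrightarrow> f x \<in> forms_on V W) \<Longrightarrow> prod_list (map f xs) \<in> forms_on V W"
  by (induction xs) (simp_all add: one_in_forms_on mult_in_forms_on)

lemma prod_list_filter_one:
  "(\<And>x. \<not> P x \<Longrightarrow> f x = 1) \<Longrightarrow> prod_list (map f (filter P xs)) = (prod_list (map f xs) :: 'a::monoid_mult)"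
  by (induction xs) auto

text \<open>
  The list of variables in \<open>mono_value\<close> depends on the exponent. Over a common range of indices the
  products for different exponents can be multiplied factor by factor.
\<close>

lemma mono_value_upt:
  assumes "vars k \<subseteq> {..<N}"
  shows "mono_value \<phi> k = prod_list (map (\<lambda>i. \<phi> i ^ expo k i) [0..<N])"
proof -
  have "sorted_list_of_set (vars k) = filter (\<lambda>i. i \<in> vars k) [0..<N]"
    by (rule sorted_distinct_set_unique) (use assms in \<open>auto intro: sorted_wrt_filter\<close>)
  then show ?thesis
    unfolding mono_value_def by (simp only:) (rule prod_list_filter_one, simp add: in_keys_iff)
qed

lemma prod_list_power_add:
  fixes \<phi> :: "'i \<Rightarrow> 'a::monoid_mult"
  assumes "\<And>i a. \<phi> i * a = a * \<phi> i"
  shows "prod_list (map (\<lambda>i. \<phi> i ^ (k i + l i)) xs) =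
    prod_list (map (\<lambda>i. \<phi> i ^ k i) xs) * prod_list (map (\<lambda>i. \<phi> i ^ l i) xs)"
proof (induction xs)
  case (Cons i xs)
  have comm: "a * \<phi> i ^ n = \<phi> i ^ n * a" for a n
  proof (induction n)
    case (Suc n)
    have "a * \<phi> i ^ Suc n = \<phi> i * (a * \<phi> i ^ n)"
      by (simp only: power_Suc mult.assoc [symmetric] assms [of i a])
    then show ?case
      by (simp add: Suc mult.assoc)
  qed simp
  have "prod_list (map (\<lambda>i. \<phi> i ^ k i) xs) * (\<phi> i ^ l i * b) =
      \<phi> i ^ l i * (prod_list (map (\<lambda>i. \<phi> i ^ k i) xs) * b)" for b
    by (simp only: mult.assoc [symmetric] comm [of "prod_list (map (\<lambda>i. \<phi> i ^ k i) xs)"])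
  with Cons.IH show ?case
    by (simp add: power_add mult.assoc)
qed simp_all

lemma mono_value_add:
  assumes "function_map \<phi>"
  shows "mono_value \<phi> (k + l) = mono_value \<phi> k * mono_value \<phi> l"
proof -
  obtain N where N: "vars k \<union> vars l \<subseteq> {..<N}"
    using finite_nat_set_iff_bounded [of "vars k \<union> vars l"] by auto
  with keys_add [of k l] have "vars (k + l) \<subseteq> {..<N}"
    by auto
  with N show ?thesis
    by (simp add: mono_value_upt [of _ N] lookup_add prod_list_power_add [OF function_commute [OF function_mapD [OF assms]]])
qed

lemma mono_value_single [simp]: "mono_value \<phi> (Poly_Mapping.single i 1) = \<phi> i" "mono_value \<phi> 0 = 1"
  by (simp_all add: mono_value_def)

lemma wedge_value_empty [simp]: "wedge_value \<phi> {||} = 1"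
  by (simp add: wedge_value_def)

text \<open>
  Inserting \<open>e\<^sub>i\<close> into a sorted product of anticommuting factors costs one sign for each smaller index.
  These are the inversions counted by \<open>wedge_sign\<close>.
\<close>

lemma prod_list_anticommute:
  fixes e :: "nat \<Rightarrow> 'a::comm_ring_1 dform"
  assumes "\<And>i j. e i * e j = - (e j * e i)" "\<And>i. e i * e i = 0"
  shows "i \<in> set xs \<Longrightarrow> e i * prod_list (map e xs) = 0"
    and "sorted xs \<Longrightarrow> i \<notin> set xs \<Longrightarrow> e i * prod_list (map e xs) =
      dconst ((- 1) ^ length (filter (\<lambda>j. j < i) xs)) * prod_list (map e (insort i xs))"
proof -
  have swap: "e i * (e j * b) = - (e j * (e i * b))" for i j and b :: "'a dform"
    by (simp only: mult.assoc [symmetric] assms(1) [of i j] mult_minus_left)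
  show "i \<in> set xs \<Longrightarrow> e i * prod_list (map e xs) = 0"
  proof (induction xs)
    case (Cons j xs)
    show ?case
    proof (cases "i = j")
      case True
      then show ?thesis
        by (simp add: mult.assoc [symmetric] assms(2))
    next
      case False
      with Cons show ?thesis
        by (simp add: swap [of i j])
    qed
  qed simp
  show "sorted xs \<Longrightarrow> i \<notin> set xs \<Longrightarrow> e i * prod_list (map e xs) =
      dconst ((- 1) ^ length (filter (\<lambda>j. j < i) xs)) * prod_list (map e (insort i xs))"
  proof (induction xs)
    case (Cons j xs)
    show ?case
    proof (cases "i < j")
      case True
      with Cons.prems have "filter (\<lambda>j. j < i) xs = []"
        by (auto simp: filter_empty_conv)
      with True show ?thesis
        by (simp add: dconst_simps)
    next
      case False
      with Cons.prems have "j < i"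
        by auto
      then have "e i * prod_list (map e (j # xs)) = - (e j * (dconst ((- 1) ^ length (filter (\<lambda>j. j < i) xs)) * prod_list (map e (insort i xs))))"
        using Cons by (simp add: swap [of i j])
      also have "\<dots> = - (dconst ((- 1) ^ length (filter (\<lambda>j. j < i) xs)) * (e j * prod_list (map e (insort i xs))))"
        by (simp only: mult.assoc [symmetric] dconst_commute [of _ "e j"])
      finally show ?thesis
        using \<open>j < i\<close> by (simp add: dconst_simps)
    qed
  qed (simp add: dconst_simps)
qed

lemma wedge_value_insert:
  assumes "function_map \<phi>"
  shows "ext_d (\<phi> i) * wedge_value \<phi> S = dconst (wedge_sign {|i|} S) * wedge_value \<phi> (finsert i S)"
proof -
  let ?e = "\<lambda>i. ext_d (\<phi> i)" and ?xs = "sorted_list_of_set (fset S)"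
  have e: "?e i * ?e j = - (?e j * ?e i)" "?e i * ?e i = 0" for i j
    by (rule ext_d_anticommute [OF function_mapD [OF assms] function_mapD [OF assms]], rule ext_d_square [OF function_mapD [OF assms]])
  show ?thesis
  proof (cases "i |\<in>| S")
    case True
    then have "wedge_sign {|i|} S = (0::'a)"
      by (auto simp: wedge_sign_def)
    with True show ?thesis
      using prod_list_anticommute(1) [of ?e i ?xs, OF e] by (simp add: wedge_value_def dconst_simps)
  next
    case False
    have "card {b \<in> fset S. b < i} = length (filter (\<lambda>j. j < i) ?xs)"
      using distinct_card [of "filter (\<lambda>j. j < i) ?xs"] by simp
    then have "wedge_sign {|i|} S = ((- 1) ^ length (filter (\<lambda>j. j < i) ?xs) :: 'a)"
      by (simp add: wedge_sign_single_left [OF False])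
    with False show ?thesis
      using prod_list_anticommute(2) [of ?e ?xs i, OF e]
      by (simp add: wedge_value_def)
  qed
qed

lemma subst_form_dconst [simp]: "subst_form \<phi> (dconst c) = dconst c"
  by (simp add: dconst_def subst_form_dmono)

lemma subst_form_one [simp]: "subst_form \<phi> 1 = 1"
  using subst_form_dconst [of \<phi> 1] by (simp add: dconst_simps)

lemma subst_form_coord_mult:
  assumes "function_map \<phi>"
  shows "subst_form \<phi> (coord i * a) = \<phi> i * subst_form \<phi> a"
proof (rule additive_eqI [where F = "\<lambda>a. subst_form \<phi> (coord i * a)" and G = "\<lambda>a. \<phi> i * subst_form \<phi> a"])
  show "additive (\<lambda>a. subst_form \<phi> (coord i * a))" "additive (\<lambda>a. \<phi> i * subst_form \<phi> a)"
    by standard (simp_all add: distrib_left additive.add [OF additive_subst_form])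
  show "subst_form \<phi> (coord i * dmono c k S) = \<phi> i * subst_form \<phi> (dmono c k S)" for c k S
    using function_left_commute [OF function_mapD [OF assms, of i], of "dconst c"]
    by (simp add: coord_mult_dmono subst_form_dmono mono_value_add [OF assms] mult.assoc
        flip: One_nat_def)
qed

lemma subst_form_dcoord_mult:
  assumes "function_map \<phi>"
  shows "subst_form \<phi> (dcoord i * a) = ext_d (\<phi> i) * subst_form \<phi> a"
proof (rule additive_eqI [where F = "\<lambda>a. subst_form \<phi> (dcoord i * a)" and G = "\<lambda>a. ext_d (\<phi> i) * subst_form \<phi> a"])
  show "additive (\<lambda>a. subst_form \<phi> (dcoord i * a))" "additive (\<lambda>a. ext_d (\<phi> i) * subst_form \<phi> a)"
    by standard (simp_all add: distrib_left additive.add [OF additive_subst_form])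
  fix c k S
  have mv: "mono_value \<phi> k \<in> fun_forms"
    unfolding mono_value_def
    by (intro prod_list_in_forms_on power_in_forms_on function_mapD [OF assms])
  have "ext_d (\<phi> i) * (dconst c * mono_value \<phi> k * wedge_value \<phi> S) =
      dconst c * (mono_value \<phi> k * (ext_d (\<phi> i) * wedge_value \<phi> S))"
    by (simp only: mult.assoc function_left_commute [OF mv, of "ext_d (\<phi> i)"]
        function_left_commute [OF dconst_in_forms_on [of c UNIV "{}"], of "ext_d (\<phi> i)"])
  also have "\<dots> = dconst (wedge_sign {|i|} S * c) * mono_value \<phi> k * wedge_value \<phi> (finsert i S)"
    by (simp only: wedge_value_insert [OF assms] dconst_simps mult.assoc
        function_left_commute [OF dconst_in_forms_on [of "wedge_sign {|i|} S" UNIV "{}"], of "mono_value \<phi> k"]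
        function_left_commute [OF dconst_in_forms_on [of "wedge_sign {|i|} S" UNIV "{}"], of "dconst c"])
  finally show "subst_form \<phi> (dcoord i * dmono c k S) = ext_d (\<phi> i) * subst_form \<phi> (dmono c k S)"
    by (simp add: dcoord_mult_dmono subst_form_dmono)
qed

lemma subst_form_mult:
  assumes "function_map \<phi>"
  shows "subst_form \<phi> (a * b) = subst_form \<phi> a * subst_form \<phi> b"
proof (induction a rule: dform_induct)
  case (add a a')
  then show ?case
    by (simp add: distrib_right additive.add [OF additive_subst_form])
next
  case (const c)
  show ?case
    by (rule additive_eqI [where F = "\<lambda>b. subst_form \<phi> (dconst c * b)" and
        G = "\<lambda>b. subst_form \<phi> (dconst c) * subst_form \<phi> b"])
      (unfold_locales, simp_all add: distrib_left additive.add [OF additive_subst_form]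
        subst_form_dmono dmono_split [symmetric] dconst_simps mult.assoc)
next
  case (coord i a)
  then show ?case
    by (simp add: subst_form_coord_mult [OF assms] mult.assoc)
next
  case (dcoord i a)
  then show ?case
    by (simp add: subst_form_dcoord_mult [OF assms] mult.assoc)
qed

lemma subst_form_coord:
  assumes "function_map \<phi>"
  shows "subst_form \<phi> (coord i) = \<phi> i"
  using subst_form_coord_mult [OF assms, where i = i and a = 1] by simp

lemma subst_form_dcoord:
  assumes "function_map \<phi>"
  shows "subst_form \<phi> (dcoord i) = ext_d (\<phi> i)"
  using subst_form_dcoord_mult [OF assms, where i = i and a = 1] by simp

lemma ext_d_in_forms_on:
  assumes "f \<in> forms_on V {}"
  shows "ext_d f \<in> forms_on V V"
  using assms
proof (induction rule: forms_on_induct)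
  case (coord i f)
  moreover have "f \<in> forms_on V V"
    using coord.hyps(2) by (rule forms_on_mono) auto
  ultimately show ?case
    by (simp add: ext_d_coord_mult add_in_forms_on mult_in_forms_on coord_in_forms_on dcoord_in_forms_on)
qed (simp_all add: additive.add [OF additive_ext_d] add_in_forms_on zero_in_forms_on)

lemma subst_form_in_forms_on:
  assumes "function_map \<phi>" "\<And>i. i \<in> V \<Longrightarrow> \<phi> i \<in> forms_on V' W'"
    "\<And>i. i \<in> W \<Longrightarrow> ext_d (\<phi> i) \<in> forms_on V' W'" "a \<in> forms_on V W"
  shows "subst_form \<phi> a \<in> forms_on V' W'"
  using assms(4)
  by (induction rule: forms_on_induct)
    (simp_all add: additive.add [OF additive_subst_form] subst_form_coord_mult [OF assms(1)] 
      subst_form_dcoord_mult [OF assms(1)] add_in_forms_on mult_in_forms_on assms dconst_in_forms_on)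

lemma subst_form_cong:
  assumes "function_map \<phi>" "function_map \<psi>" 
    "\<And>i. i \<in> V \<union> W \<Longrightarrow> \<phi> i = \<psi> i" "a \<in> forms_on V W"
  shows "subst_form \<phi> a = subst_form \<psi> a"
  using assms(4)
  by (induction rule: forms_on_induct)
    (simp_all add: additive.add [OF additive_subst_form] subst_form_coord_mult [OF assms(1)] 
      subst_form_dcoord_mult [OF assms(1)] subst_form_coord_mult [OF assms(2)] 
      subst_form_dcoord_mult [OF assms(2)] assms(3))

lemma ext_d_subst_form:
  assumes "function_map \<phi>" "f \<in> fun_forms"
  shows "ext_d (subst_form \<phi> f) = subst_form \<phi> (ext_d f)"
  using assms(2)
  by (induction rule: forms_on_induct)
    (simp_all add: additive.add [OF additive_subst_form] additive.add [OF additive_ext_d]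
      additive.zero [OF additive_subst_form] ext_d_coord_mult
      subst_form_coord_mult [OF assms(1)] subst_form_dcoord_mult [OF assms(1)]
      ext_d_function_mult [OF function_mapD [OF assms(1)]])

lemma subst_form_function:
  assumes "function_map \<phi>" "f \<in> fun_forms"
  shows "subst_form \<phi> f \<in> fun_forms"
  by (rule subst_form_in_forms_on [OF assms(1) _ _ assms(2)]) (simp_all add: function_mapD [OF assms(1)])

lemma subst_form_comp:
  assumes "function_map \<phi>" "function_map \<psi>"
  shows "subst_form \<phi> (subst_form \<psi> a) = subst_form (\<lambda>i. subst_form \<phi> (\<psi> i)) a"
proof -
  have \<chi>: "function_map (\<lambda>i. subst_form \<phi> (\<psi> i))"
    using subst_form_function [OF assms(1) function_mapD [OF assms(2)]] by (simp add: function_map_def)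
  show ?thesis
    by (induction a rule: dform_induct)
      (simp_all add: additive.add [OF additive_subst_form] subst_form_coord_mult [OF assms(2)]
        subst_form_dcoord_mult [OF assms(2)] subst_form_mult [OF assms(1)]
        subst_form_coord_mult [OF \<chi>] subst_form_dcoord_mult [OF \<chi>] ext_d_subst_form [OF assms(1) function_mapD [OF assms(2)]])
qed

lemma subst_form_ident: "subst_form coord a = (a :: 'a::comm_ring_1 dform)"
proof -
  have c: "function_map (coord :: nat \<Rightarrow> 'a dform)"
    by (simp add: function_map_def coord_in_forms_on)
  show ?thesis
    by (induction a rule: dform_induct)
      (simp_all add: additive.add [OF additive_subst_form] subst_form_coord_mult [OF c]
        subst_form_dcoord_mult [OF c] ext_d_coord)
qed

section \<open>Splitting off a block of variables\<close>

definition shift :: "nat \<Rightarrow> 'a::comm_ring_1 dform \<Rightarrow> 'a dform" where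
  "shift r = subst_form (\<lambda>i. coord (i + r))"

lemma function_map_coord: "function_map (\<lambda>i. coord (g i))"
  by (simp add: function_map_def coord_in_forms_on)

lemmas additive_shift = additive_subst_form [of "\<lambda>i. coord (i + r)" for r, folded shift_def]

lemma shift_simps:
  "shift r (dconst c) = dconst c" "shift r 1 = 1" "shift r (a * b) = shift r a * shift r b"
  "shift r (coord i) = coord (i + r)" "shift r (dcoord i) = dcoord (i + r)"
  by (simp_all add: shift_def subst_form_mult [OF function_map_coord]
      subst_form_coord [OF function_map_coord] subst_form_dcoord [OF function_map_coord] ext_d_coord)

lemma shift_shift: "shift r (shift s a) = shift (s + r) a"
  by (simp add: shift_def subst_form_comp [OF function_map_coord function_map_coord]
      subst_form_coord [OF function_map_coord] add.assoc)

text \<open>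
  Sums of products \<open>\<alpha> \<otimes> \<beta>\<close>, where \<open>\<alpha>\<close> involves the first \<open>r\<close> pairs of generators and \<open>\<beta>\<close> the
  remaining ones.
\<close>

inductive_set blocks :: "nat \<Rightarrow> 'a::comm_ring_1 dform set" for r where
  product: "\<alpha> \<in> forms_on {..<r} {..<r} \<Longrightarrow> \<alpha> * shift r \<beta> \<in> blocks r"
| sum: "x \<in> blocks r \<Longrightarrow> y \<in> blocks r \<Longrightarrow> x + y \<in> blocks r"

text \<open>
  A generator of the second block is moved past \<open>\<alpha>\<close>. For \<open>dx\<^sub>i\<close> this reverses the sign of the odd
  part of \<open>\<alpha>\<close>, which stays in the first block.
\<close>

lemma in_blocks: "x \<in> blocks r"
proof (induction x rule: dform_induct)
  case (add a b)
  then show ?case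
    by (rule blocks.sum)
next
  case (const c)
  have "dconst c * shift r 1 \<in> blocks r"
    by (rule blocks.product) (rule dconst_in_forms_on)
  then show ?case
    by (simp add: shift_simps)
next
  case (coord i x)
  then show ?case
  proof (induction rule: blocks.induct)
    case (product \<alpha> \<beta>)
    show ?case
    proof (cases "i < r")
      case True
      then have "(coord i * \<alpha>) * shift r \<beta> \<in> blocks r"
        using product by (intro blocks.product mult_in_forms_on coord_in_forms_on) auto
      then show ?thesis
        by (simp add: mult.assoc)
    next
      case False
      then have "\<alpha> * shift r (coord (i - r) * \<beta>) = coord i * (\<alpha> * shift r \<beta>)"
        by (simp add: shift_simps coord_left_commute [of \<alpha>])
      then show ?thesis
        using blocks.product [OF product] by metis
    qed
  next
    case (sum x y)
    then show ?case
      by (simp add: distrib_left blocks.sum)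
  qed
next
  case (dcoord i x)
  then show ?case
  proof (induction rule: blocks.induct)
    case (product \<alpha> \<beta>)
    show ?case
    proof (cases "i < r")
      case True
      then have "(dcoord i * \<alpha>) * shift r \<beta> \<in> blocks r"
        using product by (intro blocks.product mult_in_forms_on dcoord_in_forms_on) auto
      then show ?thesis
        by (simp add: mult.assoc)
    next
      case False
      obtain \<alpha>' where \<alpha>': "\<alpha>' \<in> forms_on {..<r} {..<r}" "dcoord i * \<alpha> = \<alpha>' * dcoord i"
        using dcoord_mult_swap [OF product] by metis
      have "\<alpha>' * shift r (dcoord (i - r) * \<beta>) = \<alpha>' * dcoord i * shift r \<beta>"
        using False by (simp add: shift_simps mult.assoc)
      also have "\<dots> = dcoord i * (\<alpha> * shift r \<beta>)"
        by (simp only: \<alpha>'(2) [symmetric] mult.assoc)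
      finally show ?thesis
        using blocks.product [OF \<alpha>'(1)] by metis
    qed
  next
    case (sum x y)
    then show ?case
      by (simp add: distrib_left blocks.sum)
  qed
qed

lemma additive_blocks_eqI:
  assumes "additive F" "additive G"
    and "\<And>\<alpha> \<beta>. \<alpha> \<in> forms_on {..<r} {..<r} \<Longrightarrow> F (\<alpha> * shift r \<beta>) = G (\<alpha> * shift r \<beta>)"
  shows "F x = G x"
  using in_blocks [of x r]
  by (induction rule: blocks.induct) (simp_all add: assms(3) additive.add [OF assms(1)] additive.add [OF assms(2)])

section \<open>Integration over the fibre\<close>

lemma simplex_int_cong:
  assumes "\<And>j. j \<le> n \<Longrightarrow> expo k j = expo k' j"
  shows "simplex_int n k A = (simplex_int n k' A :: 'a::field_char_0)"
proof -
  have "(\<Sum>j\<le>n. expo k j) = (\<Sum>j\<le>n. expo k' j)"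
    "(\<Prod>j\<le>n. fact (expo k j) :: 'a) = (\<Prod>j\<le>n. fact (expo k' j))"
    by (rule sum.cong prod.cong; simp add: assms)+
  then show ?thesis
    by (simp only: simplex_int_def)
qed

text \<open>
  Integration respects \<open>\<Sum>\<^sub>i x\<^sub>i = 1\<close>: raising the exponent \<open>k\<^sub>i\<close> multiplies the product of factorials
  by \<open>k\<^sub>i + 1\<close>, and the sum of these factors is the quotient of the two denominators.
\<close>

lemma simplex_int_coord:
  "(\<Sum>i\<le>N. simplex_int N (Poly_Mapping.single i 1 + k) A) = (simplex_int N k A :: 'a::field_char_0)"
proof -
  let ?P = "\<Prod>j\<le>N. fact (expo k j) :: 'a" and ?s = "\<Sum>j\<le>N. expo k j"
  have step: "(\<Prod>j\<le>N. fact (expo (Poly_Mapping.single i 1 + k) j)) = of_nat (expo k i + 1) * ?P"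
    "(\<Sum>j\<le>N. expo (Poly_Mapping.single i 1 + k) j) = Suc ?s" if "i \<le> N" for i
  proof -
    have "(\<Prod>j\<le>N. fact (expo (Poly_Mapping.single i 1 + k) j) :: 'a) =
        (\<Prod>j\<le>N. (if j = i then of_nat (expo k i + 1) else 1) * fact (expo k j))"
      by (rule prod.cong) (auto simp: lookup_add lookup_single when_def)
    then show "(\<Prod>j\<le>N. fact (expo (Poly_Mapping.single i 1 + k) j) :: 'a) = of_nat (expo k i + 1) * ?P"
      using that by (simp add: prod.distrib prod.delta)
    show "(\<Sum>j\<le>N. expo (Poly_Mapping.single i 1 + k) j) = Suc ?s"
      using that by (simp add: lookup_add sum.distrib lookup_single when_def sum.delta)
  qed
  have "(\<Sum>i\<le>N. of_nat (expo k i + 1) :: 'a) = of_nat (Suc (?s + N))"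
    by (simp add: sum.distrib)
  then have quot: "(\<Sum>i\<le>N. of_nat (expo k i + 1) * ?P / fact (Suc ?s + N)) = ?P / fact (?s + N)"
    by (simp add: sum_divide_distrib [symmetric] sum_distrib_right [symmetric] del: of_nat_Suc)
  have "(\<Sum>i\<le>N. simplex_int N (Poly_Mapping.single i 1 + k) A) = (\<Sum>i\<le>N. \<Sum>j\<le>N. 
      if fset A = {..N} - {j} then (- 1) ^ j * (of_nat (expo k i + 1) * ?P / fact (Suc ?s + N)) else 0 :: 'a)"
    unfolding simplex_int_def by (intro sum.cong refl) (simp only: step atMost_iff times_divide_eq_right)
  also have "\<dots> = (\<Sum>j\<le>N. if fset A = {..N} - {j} then
      (- 1) ^ j * (\<Sum>i\<le>N. of_nat (expo k i + 1) * ?P / fact (Suc ?s + N)) else 0 :: 'a)"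
    by (subst sum.swap, intro sum.cong refl) (auto simp: sum_distrib_left)
  finally show ?thesis
    by (simp only: quot simplex_int_def times_divide_eq_right)
qed

text \<open>
  Integration respects \<open>\<Sum>\<^sub>i dx\<^sub>i = 0\<close>. The form \<open>dx\<^sub>i \<and> dx\<^sub>A\<close> can be the product of all
  differentials except \<open>dx\<^sub>j\<close> only if \<open>A\<close> misses exactly \<open>i\<close> and \<open>j\<close>, and its integral \<open>T i j\<close> is then
  antisymmetric in \<open>i\<close> and \<open>j\<close>.
\<close>

lemma simplex_int_dcoord:
  "(\<Sum>i\<le>N. wedge_sign {|i|} A * simplex_int N k (finsert i A)) = (0 :: 'a::field_char_0)"
proof -
  define C where "C = (\<Prod>j\<le>N. fact (expo k j)) / (fact ((\<Sum>j\<le>N. expo k j) + N) :: 'a)"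
  define T :: "nat \<Rightarrow> nat \<Rightarrow> 'a" where
    "T i j = wedge_sign {|i|} A * (if fset (finsert i A) = {..N} - {j} then (- 1) ^ j * C else 0)" for i j
  have T: "T i j = (if i \<noteq> j \<and> fset A = {..N} - {i, j}
      then (- 1) ^ (if j < i then i - 1 else i) * ((- 1) ^ j * C) else 0)" if "i \<le> N" "j \<le> N" for i j
  proof (cases "i \<noteq> j \<and> fset A = {..N} - {i, j}")
    case True
    have "i |\<notin>| A"
      unfolding True [THEN conjunct2] by simp
    moreover have "{b \<in> fset A. b < i} = {..<i} - {j}"
      unfolding True [THEN conjunct2] using \<open>i \<le> N\<close> by auto
    ultimately have "wedge_sign {|i|} A = ((- 1) ^ (if j < i then i - 1 else i) :: 'a)"
      by (simp add: wedge_sign_single_left card_Diff_singleton_if)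
    moreover have "fset (finsert i A) = {..N} - {j}"
      unfolding finsert.rep_eq True [THEN conjunct2] using True that by blast
    ultimately show ?thesis
      using True by (simp only: T_def if_True simp_thms)
  next
    case False
    have "T i j = 0"
    proof (cases "i |\<in>| A")
      case True
      then show ?thesis
        by (auto simp: T_def wedge_sign_def)
    next
      case i: False
      have "fset (finsert i A) \<noteq> {..N} - {j}"
      proof
        assume *: "fset (finsert i A) = {..N} - {j}"
        then have "fset A = {..N} - {i, j}"
          using i unfolding finsert.rep_eq by blast
        moreover have "i \<noteq> j"
          using * by auto
        ultimately show False
          using False by simp
      qed
      then show ?thesis
        by (simp only: T_def if_False mult_zero_right)
    qed
    with False show ?thesis
      by (simp only: if_False)
  qed
  have anti: "T i j = - T j i" if "i \<le> N" "j \<le> N" for i j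
  proof -
    have *: "T i j = - T j i" if "i < j" "j \<le> N" for i j
    proof -
      obtain l where "j = Suc l"
        using \<open>i < j\<close> by (cases j) auto
      then show ?thesis
        using that by (simp add: T insert_commute mult.left_commute)
    qed
    show ?thesis
      using * [of i j] * [of j i] T [of i i] that by (cases i j rule: linorder_cases) simp_all
  qed
  define X where "X = (\<Sum>i\<le>N. \<Sum>j\<le>N. T i j)"
  have "X = (\<Sum>i\<le>N. \<Sum>j\<le>N. - T j i)"
    unfolding X_def by (intro sum.cong refl anti) simp_all
  also have "\<dots> = - X"
    unfolding X_def by (subst sum.swap) (simp add: sum_negf)
  finally have "X + X = 0"
    by (simp only: eq_neg_iff_add_eq_0)
  then have "2 * X = 0"
    by (simp only: mult_2)
  then have "X = 0"
    by simp
  moreover have "(\<Sum>i\<le>N. wedge_sign {|i|} A * simplex_int N k (finsert i A)) = X"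
    unfolding simplex_int_def X_def T_def C_def sum_distrib_left times_divide_eq_right ..
  ultimately show ?thesis
    by simp
qed

lemma fibre_int_eq: "fibre_int n a = (\<Sum>p\<in>supp a.
     dmono (coeff a p * simplex_int (n + 1) (fst p) (ffilter (\<lambda>i. i \<le> n + 1) (snd p)))
       (fibre_exp (n + 2) (fst p)) (fibre_set (n + 2) (snd p)))"
  by (simp add: fibre_int_def case_prod_unfold)

lemma additive_fibre_int: "additive (fibre_int n)"
  unfolding fibre_int_eq [abs_def]
  by (rule additive_extension [where F = "\<lambda>p c.
     dmono (c * simplex_int (n + 1) (fst p) (ffilter (\<lambda>i. i \<le> n + 1) (snd p)))
       (fibre_exp (n + 2) (fst p)) (fibre_set (n + 2) (snd p))"])
    (simp_all add: dmono_add distrib_right)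

lemma fibre_int_dmono: "fibre_int n (dmono c k S) =
   dmono (c * simplex_int (n + 1) k (ffilter (\<lambda>i. i \<le> n + 1) S)) (fibre_exp (n + 2) k) (fibre_set (n + 2) S)"
  unfolding fibre_int_eq
  by (subst sum_supp_dmono [where F = "\<lambda>p c.
     dmono (c * simplex_int (n + 1) (fst p) (ffilter (\<lambda>i. i \<le> n + 1) (snd p)))
       (fibre_exp (n + 2) (fst p)) (fibre_set (n + 2) (snd p))"]) simp_all

lemma in_fibre_set_iff [simp]: "i |\<in>| fibre_set r S \<longleftrightarrow> i + r |\<in>| S"
proof
  assume "i + r |\<in>| S"
  then have "i + r - r |\<in>| fibre_set r S"
    unfolding fibre_set_def by (intro fimageI) simp
  then show "i |\<in>| fibre_set r S"
    by simp
qed (auto simp: fibre_set_def)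

lemma fibre_set_finsert_low: "i < r \<Longrightarrow> fibre_set r (finsert i S) = fibre_set r S"
  and fibre_set_finsert_high: "fibre_set r (finsert (i + r) S) = finsert i (fibre_set r S)"
  by (auto simp: fset_eq_iff)

lemma fibre_exp_add: "fibre_exp r (k + l) = fibre_exp r k + fibre_exp r l"
  by (rule poly_mapping_eqI) (simp add: expo_fibre_exp lookup_add)

lemma fibre_exp_single:
  "fibre_exp r (Poly_Mapping.single (i + r) c) = Poly_Mapping.single i c"
  "i < r \<Longrightarrow> fibre_exp r (Poly_Mapping.single i c) = 0"
  by (rule poly_mapping_eqI, simp add: expo_fibre_exp lookup_single when_def)+

lemma fibre_int_mult_coord: "fibre_int n (a * coord (i + (n + 2))) = fibre_int n a * coord i"
proof (rule additive_eqI [where F = "\<lambda>a. fibre_int n (a * coord (i + (n + 2)))" and G = "\<lambda>a. fibre_int n a * coord i"])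
  show "additive (\<lambda>a. fibre_int n (a * coord (i + (n + 2))))" "additive (\<lambda>a. fibre_int n a * coord i)"
    by standard (simp_all add: distrib_right additive.add [OF additive_fibre_int])
  fix c :: 'a and k S
  have "simplex_int (n + 1) (Poly_Mapping.single (i + (n + 2)) 1 + k) A = (simplex_int (n + 1) k A :: 'a)" for A
    by (rule simplex_int_cong) (auto simp: lookup_add lookup_single)
  then show "fibre_int n (dmono c k S * coord (i + (n + 2))) = fibre_int n (dmono c k S) * coord i"
    by (simp only: coord_commute [symmetric] coord_mult_dmono fibre_int_dmono fibre_exp_add fibre_exp_single)
qed

text \<open>
  Generators of the first block precede those of the second, so they cause no inversion with \<open>dx\<^bsub>i+r\<^esub>\<close>
  on the right.
\<close>

lemma wedge_sign_fibre_set: "wedge_sign S {|i + r|} = wedge_sign (fibre_set r S) {|i|}"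
proof -
  have "{(a, b). a |\<in>| S \<and> b |\<in>| {|i + r|} \<and> b < a} =
      (\<lambda>(a, b). (a + r, b + r)) ` {(a, b). a |\<in>| fibre_set r S \<and> b |\<in>| {|i|} \<and> b < a}"
    (is "?L = ?f ` ?R")
  proof (intro equalityI subsetI)
    fix p assume "p \<in> ?L"
    then have "p = ?f (fst p - r, i)" "(fst p - r, i) \<in> ?R"
      by auto
    then show "p \<in> ?f ` ?R"
      by blast
  qed auto
  then have "card ?L = card ?R"
    by (simp add: card_image inj_on_def split_def prod_eq_iff)
  then show ?thesis
    by (simp add: wedge_sign_def)
qed

lemma fibre_int_mult_dcoord: "fibre_int n (a * dcoord (i + (n + 2))) = fibre_int n a * dcoord i"
proof (rule additive_eqI [where F = "\<lambda>a. fibre_int n (a * dcoord (i + (n + 2)))" and G = "\<lambda>a. fibre_int n a * dcoord i"])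
  show "additive (\<lambda>a. fibre_int n (a * dcoord (i + (n + 2))))" "additive (\<lambda>a. fibre_int n a * dcoord i)"
    by standard (simp_all add: distrib_right additive.add [OF additive_fibre_int])
  fix c :: 'a and k S
  have "ffilter (\<lambda>j. j \<le> n + 1) (finsert (i + (n + 2)) S) = ffilter (\<lambda>j. j \<le> n + 1) S"
    by (auto simp: fset_eq_iff)
  then show "fibre_int n (dmono c k S * dcoord (i + (n + 2))) = fibre_int n (dmono c k S) * dcoord i"
    by (simp only: dmono_mult_dcoord fibre_int_dmono fibre_set_finsert_high wedge_sign_fibre_set mult.assoc)
qed

lemma fibre_int_mult_dconst: "fibre_int n (a * dconst c) = fibre_int n a * dconst c"
proof (rule additive_eqI [where F = "\<lambda>a. fibre_int n (a * dconst c)" and G = "\<lambda>a. fibre_int n a * dconst c"])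
  show "additive (\<lambda>a. fibre_int n (a * dconst c))" "additive (\<lambda>a. fibre_int n a * dconst c)"
    by standard (simp_all add: distrib_right additive.add [OF additive_fibre_int])
qed (simp add: dconst_commute [symmetric] dmono_split [symmetric] fibre_int_dmono mult.assoc)

text \<open>
  Fibre integration is linear over the forms of the second factor. These stand on the right, as in
  \<open>\<integral> \<otimes> Id\<close>, hence there is no sign.
\<close>

lemma fibre_int_mult_shift: "fibre_int n (a * shift (n + 2) b) = fibre_int n a * b"
proof (induction b arbitrary: a rule: dform_induct)
  case (add b b')
  then show ?case
    by (simp add: additive.add [OF additive_shift] distrib_left additive.add [OF additive_fibre_int])
next
  case (const c)
  show ?case
    by (simp add: shift_simps fibre_int_mult_dconst)
next
  case (coord i b)
  then show ?case
    by (simp only: shift_simps mult.assoc [symmetric] fibre_int_mult_coord)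
next
  case (dcoord i b)
  then show ?case
    by (simp only: shift_simps mult.assoc [symmetric] fibre_int_mult_dcoord)
qed

lemma fibre_int_coord_sum: "fibre_int n ((\<Sum>i\<le>n + 1. coord i) * a) = fibre_int n a"
proof (rule additive_eqI [where F = "\<lambda>a. fibre_int n ((\<Sum>i\<le>n + 1. coord i) * a)" and G = "fibre_int n"])
  show "additive (\<lambda>a. fibre_int n ((\<Sum>i\<le>n + 1. coord i) * a))" "additive (fibre_int n)"
    by standard (simp_all add: distrib_left additive.add [OF additive_fibre_int])
  fix c :: 'a and k S
  let ?A = "ffilter (\<lambda>i. i \<le> n + 1) S"
  have "fibre_int n ((\<Sum>i\<le>n + 1. coord i) * dmono c k S) =
      (\<Sum>i\<le>n + 1. dmono (c * simplex_int (n + 1) (Poly_Mapping.single i 1 + k) ?A)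
        (fibre_exp (n + 2) k) (fibre_set (n + 2) S))"
    unfolding sum_distrib_right additive.sum [OF additive_fibre_int]
  proof (intro sum.cong refl)
    fix i assume "i \<in> {..n + 1}"
    then show "fibre_int n (coord i * dmono c k S) =
       dmono (c * simplex_int (n + 1) (Poly_Mapping.single i 1 + k) ?A)
        (fibre_exp (n + 2) k) (fibre_set (n + 2) S)"
      unfolding coord_mult_dmono fibre_int_dmono fibre_exp_add by (simp add: fibre_exp_single)
  qed
  also have "\<dots> = dmono (\<Sum>i\<le>n + 1. c * simplex_int (n + 1) (Poly_Mapping.single i 1 + k) ?A)
        (fibre_exp (n + 2) k) (fibre_set (n + 2) S)"
    by (rule additive.sum [symmetric]) (unfold_locales, rule dmono_add)
  finally show "fibre_int n ((\<Sum>i\<le>n + 1. coord i) * dmono c k S) = fibre_int n (dmono c k S)"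
    by (simp only: sum_distrib_left [symmetric] simplex_int_coord fibre_int_dmono)
qed

lemma fibre_int_dcoord_sum: "fibre_int n ((\<Sum>i\<le>n + 1. dcoord i) * a) = 0"
proof (rule additive_eqI [where F = "\<lambda>a. fibre_int n ((\<Sum>i\<le>n + 1. dcoord i) * a)" and G = "\<lambda>a. 0"])
  show "additive (\<lambda>a. fibre_int n ((\<Sum>i\<le>n + 1. dcoord i) * a))" "additive (\<lambda>a::'a dform. 0 :: 'a dform)"
    by standard (simp_all add: distrib_left additive.add [OF additive_fibre_int])
  fix c :: 'a and k S
  let ?A = "ffilter (\<lambda>i. i \<le> n + 1) S"
  have "fibre_int n ((\<Sum>i\<le>n + 1. dcoord i) * dmono c k S) =
      (\<Sum>i\<le>n + 1. dmono (c * (wedge_sign {|i|} ?A * simplex_int (n + 1) k (finsert i ?A)))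
        (fibre_exp (n + 2) k) (fibre_set (n + 2) S))"
    unfolding sum_distrib_right additive.sum [OF additive_fibre_int]
  proof (intro sum.cong refl)
    fix i assume "i \<in> {..n + 1}"
    then have i: "i < n + 2" "i \<le> n + 1"
      by auto
    have "ffilter (\<lambda>j. j \<le> n + 1) (finsert i S) = finsert i ?A"
      using i by (auto simp: fset_eq_iff)
    moreover have "wedge_sign {|i|} S = (wedge_sign {|i|} ?A :: 'a)"
    proof (cases "i |\<in>| S")
      case True
      with i show ?thesis
        by (auto simp: wedge_sign_def)
    next
      case False
      moreover have "{b \<in> fset S. b < i} = {b \<in> fset ?A. b < i}"
        using i by auto
      ultimately show ?thesis
        by (simp add: wedge_sign_single_left)
    qed
    ultimately show "fibre_int n (dcoord i * dmono c k S) =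
       dmono (c * (wedge_sign {|i|} ?A * simplex_int (n + 1) k (finsert i ?A)))
        (fibre_exp (n + 2) k) (fibre_set (n + 2) S)"
      using i(1) by (simp only: dcoord_mult_dmono fibre_int_dmono fibre_set_finsert_low mult_ac)
  qed
  also have "\<dots> = dmono (\<Sum>i\<le>n + 1. c * (wedge_sign {|i|} ?A * simplex_int (n + 1) k (finsert i ?A)))
        (fibre_exp (n + 2) k) (fibre_set (n + 2) S)"
    by (rule additive.sum [symmetric]) (unfold_locales, rule dmono_add)
  finally show "fibre_int n ((\<Sum>i\<le>n + 1. dcoord i) * dmono c k S) = 0"
    by (simp only: sum_distrib_left [symmetric] simplex_int_dcoord mult_zero_right dmono_0)
qed

lemma fibre_int_in_forms_on:
  assumes "a \<in> forms_on {..n + m + 2} {..n + m + 2}"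
  shows "fibre_int n a \<in> forms_on {..m} {..m}"
  using assms
proof (induction rule: forms_on_dmono_induct)
  case (add a b)
  then show ?case
    by (simp add: additive.add [OF additive_fibre_int] add_in_forms_on)
next
  case (dmono c k S)
  have "i \<le> m" if "n + 2 + i \<in> vars k \<or> i + (n + 2) |\<in>| S" for i
    using that subsetD [OF dmono(1), of "n + 2 + i"] subsetD [OF dmono(2), of "i + (n + 2)"] by auto
  then have "vars (fibre_exp (n + 2) k) \<subseteq> {..m}" "fset (fibre_set (n + 2) S) \<subseteq> {..m}"
    by (auto simp: in_keys_iff expo_fibre_exp)
  then show ?case
    by (simp only: fibre_int_dmono dmono_in_forms_on)
qed

lemma fibre_int_first_block:
  assumes "\<alpha> \<in> forms_on {..<n + 2} {..<n + 2}"
  obtains c where "fibre_int n \<alpha> = dconst c"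
proof -
  have "\<exists>c. fibre_int n \<alpha> = dconst c"
    using assms
  proof (induction rule: forms_on_dmono_induct)
    case (add a b)
    then show ?case
      by (metis additive.add [OF additive_fibre_int] dconst_simps(3))
  next
    case (dmono c k S)
    have "fibre_exp (n + 2) k = 0"
    proof (rule poly_mapping_eqI)
      show "expo (fibre_exp (n + 2) k) i = expo 0 i" for i
        using subsetD [OF dmono(1), of "n + 2 + i"] by (auto simp: expo_fibre_exp in_keys_iff)
    qed
    moreover have "fibre_set (n + 2) S = {||}"
      using subsetD [OF dmono(2), of "i + (n + 2)" for i] by (auto simp: fset_eq_iff)
    ultimately show ?case
      by (auto simp: fibre_int_dmono dconst_def)
  qed
  then show ?thesis
    using that by blast
qed

section \<open>Iterated integration\<close>

text \<open>
  The map \<open>id \<times> \<phi>\<close>, where the first factor has \<open>r\<close> coordinates.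
\<close>

definition block_lift :: "nat \<Rightarrow> (nat \<Rightarrow> 'a::comm_ring_1 dform) \<Rightarrow> nat \<Rightarrow> 'a dform" where
  "block_lift r \<phi> i = (if i < r then coord i else shift r (\<phi> (i - r)))"

lemma function_map_shift: "function_map \<phi> \<Longrightarrow> function_map (\<lambda>i. shift r (\<phi> i))"
  by (simp add: function_map_def shift_def subst_form_function [OF function_map_coord])

lemma function_map_block_lift:
  assumes "function_map \<phi>"
  shows "function_map (block_lift r \<phi>)"
  using function_map_shift [OF assms, of r]
  by (simp add: function_map_def block_lift_def coord_in_forms_on)

lemma subst_form_block_lift:
  assumes "function_map \<phi>"
  shows "\<alpha> \<in> forms_on {..<r} {..<r} \<Longrightarrow> subst_form (block_lift r \<phi>) \<alpha> = \<alpha>"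
    and "subst_form (block_lift r \<phi>) (shift r \<beta>) = shift r (subst_form \<phi> \<beta>)"
proof -
  note bl = function_map_block_lift [OF assms, of r]
  show "subst_form (block_lift r \<phi>) \<alpha> = \<alpha>" if "\<alpha> \<in> forms_on {..<r} {..<r}"
    using subst_form_cong [OF bl function_map_coord [of "\<lambda>i. i"] _ that]
    by (simp add: block_lift_def subst_form_ident)
  show "subst_form (block_lift r \<phi>) (shift r \<beta>) = shift r (subst_form \<phi> \<beta>)"
    by (simp add: shift_def subst_form_comp [OF bl function_map_coord]
        subst_form_comp [OF function_map_coord assms] subst_form_coord [OF bl])
      (simp add: block_lift_def shift_def)
qed

text \<open>
  Naturality of fibre integration: on \<open>\<alpha> \<otimes> \<beta>\<close> both sides are \<open>\<phi>\<close> applied to \<open>\<beta>\<close>, times the constant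
  \<open>\<integral> \<alpha>\<close>.
\<close>

lemma subst_form_fibre_int:
  assumes "function_map \<phi>"
  shows "subst_form \<phi> (fibre_int n b) = fibre_int n (subst_form (block_lift (n + 2) \<phi>) b)"
proof (rule additive_blocks_eqI [where r = "n + 2" and F = "\<lambda>b. subst_form \<phi> (fibre_int n b)"
      and G = "\<lambda>b. fibre_int n (subst_form (block_lift (n + 2) \<phi>) b)"])
  show "additive (\<lambda>b. subst_form \<phi> (fibre_int n b))"
    "additive (\<lambda>b. fibre_int n (subst_form (block_lift (n + 2) \<phi>) b))"
    by standard (simp_all add: additive.add [OF additive_fibre_int] additive.add [OF additive_subst_form])
  fix \<alpha> \<beta> :: "'a dform" assume \<alpha>: "\<alpha> \<in> forms_on {..<n + 2} {..<n + 2}"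
  obtain c where "fibre_int n \<alpha> = dconst c"
    using fibre_int_first_block [OF \<alpha>] .
  then show "subst_form \<phi> (fibre_int n (\<alpha> * shift (n + 2) \<beta>)) =
      fibre_int n (subst_form (block_lift (n + 2) \<phi>) (\<alpha> * shift (n + 2) \<beta>))"
    by (simp only: subst_form_mult [OF function_map_block_lift [OF assms]] subst_form_mult [OF assms]
        subst_form_block_lift [OF assms] \<alpha> fibre_int_mult_shift subst_form_dconst)
qed

lemma fibre_int_relations:
  "fibre_int n (((\<Sum>i\<le>n + 1. coord i) - 1) * a) = 0" "fibre_int n (a * ((\<Sum>i\<le>n + 1. coord i) - 1)) = 0"
  "fibre_int n ((\<Sum>i\<le>n + 1. dcoord i) * a) = 0" "fibre_int n (a * (\<Sum>i\<le>n + 1. dcoord i)) = 0"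
proof -
  show left: "fibre_int n (((\<Sum>i\<le>n + 1. coord i) - 1) * a) = 0"
    by (simp only: left_diff_distrib additive.diff [OF additive_fibre_int] fibre_int_coord_sum mult_1_left) simp
  have g: "((\<Sum>i\<le>n + 1. coord i) - 1) \<in> fun_forms"
    by (intro minus_in_forms_on sum_in_forms_on coord_in_forms_on one_in_forms_on) simp
  show "fibre_int n (a * ((\<Sum>i\<le>n + 1. coord i) - 1)) = 0"
    using left by (simp only: function_commute [OF g, of a])
  show "fibre_int n ((\<Sum>i\<le>n + 1. dcoord i) * a) = 0"
    by (rule fibre_int_dcoord_sum)
  obtain a' where "\<And>i. dcoord i * a' = a * dcoord i"
    using dcoord_mult_swap [OF in_forms_on_UNIV, of a] by metis
  then have "a * (\<Sum>i\<le>n + 1. dcoord i) = (\<Sum>i\<le>n + 1. dcoord i) * a'"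
    by (simp only: sum_distrib_left sum_distrib_right)
  then show "fibre_int n (a * (\<Sum>i\<le>n + 1. dcoord i)) = 0"
    by (simp only: fibre_int_dcoord_sum)
qed

text \<open>
  Modulo \<open>\<Sum>\<^sub>i dx\<^sub>i\<close> the generator \<open>dx\<^sub>0\<close> can be eliminated. On the remaining monomials only the
  summand for \<open>i = 0\<close> contributes to \<open>simplex_int\<close>.
\<close>

lemma additive_eqI_mod_dcoord_sum:
  fixes F G :: "'a::comm_ring_1 dform \<Rightarrow> 'b::ab_group_add"
  assumes F: "additive F" "\<And>a. F ((\<Sum>i\<le>N. dcoord i) * a) = 0"
    and G: "additive G" "\<And>a. G ((\<Sum>i\<le>N. dcoord i) * a) = 0"
    and eq: "\<And>c k S. vars k \<subseteq> {..N} \<Longrightarrow> fset S \<subseteq> {1..N} \<Longrightarrow> F (dmono c k S) = G (dmono c k S)"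
    and a: "a \<in> forms_on {..N} {..N}"
  shows "F a = G a"
  using a
proof (induction rule: forms_on_dmono_induct)
  case (add a b)
  then show ?case
    by (simp add: additive.add [OF F(1)] additive.add [OF G(1)])
next
  case (dmono c k S)
  show ?case
  proof (cases "0 |\<in>| S")
    case False
    have "fset S \<subseteq> {1..N}"
    proof
      fix i assume "i \<in> fset S"
      with False dmono(2) show "i \<in> {1..N}"
        by (cases i) auto
    qed
    with dmono(1) show ?thesis
      by (rule eq)
  next
    case True
    define B where "B = S |-| {|0|}"
    have S: "S = finsert 0 B" "0 |\<notin>| B"
      using True by (auto simp: B_def)
    have B: "fset B \<subseteq> {1..N}"
    proof
      fix i assume "i \<in> fset B"
      with S dmono(2) show "i \<in> {1..N}"
        by (cases i) auto
    qed
    have "dmono c k S = dcoord 0 * dmono c k B"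
      using S(2) unfolding S(1) dcoord_mult_dmono by (simp add: wedge_sign_single_left)
    also have "\<dots> = (\<Sum>i\<le>N. dcoord i) * dmono c k B - (\<Sum>i\<in>{1..N}. dcoord i * dmono c k B)"
    proof -
      have "{..N} = insert 0 {1..N}"
        by auto
      then show ?thesis
        by (simp add: distrib_right sum_distrib_right)
    qed
    finally have split: "dmono c k S = (\<Sum>i\<le>N. dcoord i) * dmono c k B -
        (\<Sum>i\<in>{1..N}. dcoord i * dmono c k B)" .
    have "F (dcoord i * dmono c k B) = G (dcoord i * dmono c k B)" if "i \<in> {1..N}" for i
      unfolding dcoord_mult_dmono using that B by (intro eq dmono(1)) auto
    then show ?thesis
      unfolding split additive.diff [OF F(1)] additive.diff [OF G(1)] F(2) G(2)
        additive.sum [OF F(1)] additive.sum [OF G(1)] by simp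
  qed
qed

lemma subst_form_monomial:
  assumes "function_map \<phi>" "\<And>i. \<phi> i = dmono 1 (T (Poly_Mapping.single i 1)) {||}"
    and "T 0 = 0" "\<And>k l. T (k + l) = T k + T l"
  shows "subst_form \<phi> (dmono c k {||}) = dmono c (T k) {||}"
proof -
  have "vars k \<subseteq> UNIV"
    by simp
  then show ?thesis
  proof (induction k rule: exponent_induct)
    case zero
    show ?case
      using subst_form_dconst [of \<phi> c] by (simp add: assms(3) dconst_def)
  next
    case (add i k)
    then show ?case
      by (simp only: coord_mult_dmono [symmetric] subst_form_coord_mult [OF assms(1)])
        (simp add: assms(2,4) dmono_mult_dmono)
  qed
qed

lemma simplex_int_empty: "simplex_int (n + 1) k {||} = 0"
proof -
  have "{..Suc n} - {i} \<noteq> {}" for i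
    by (cases i) force+
  then show ?thesis
    unfolding simplex_int_def by (intro sum.neutral) (simp add: eq_commute [of "{}"])
qed

lemma fibre_int_function: "fibre_int n (dmono c k {||}) = 0"
proof -
  have "ffilter (\<lambda>i. i \<le> n + 1) {||} = {||}"
    by (auto simp: fset_eq_iff)
  then show ?thesis
    by (simp only: fibre_int_dmono simplex_int_empty mult_zero_right dmono_0)
qed

lemma simplex_int_without_first:
  assumes "0 |\<notin>| A"
  shows "simplex_int N k A = (if fset A = {1..N} then (\<Prod>j\<le>N. fact (expo k j)) / fact ((\<Sum>j\<le>N. expo k j) + N)
    else (0 :: 'a::field_char_0))"
proof -
  have "simplex_int N k A = (\<Sum>i\<le>N. if i = 0 then (if fset A = {1..N}
     then (\<Prod>j\<le>N. fact (expo k j)) / fact ((\<Sum>j\<le>N. expo k j) + N) else 0) else (0::'a))"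
    unfolding simplex_int_def
  proof (intro sum.cong refl)
    fix i assume "i \<in> {..N}"
    have "{..N} - {0} = {1..N}"
      by auto
    moreover have "fset A \<noteq> {..N} - {i}" if "i \<noteq> 0"
      using that assms by auto
    ultimately show "(if fset A = {..N} - {i} then (- 1) ^ i * (\<Prod>j\<le>N. fact (expo k j)) /
        fact ((\<Sum>j\<le>N. expo k j) + N) else (0::'a)) = (if i = 0 then (if fset A = {1..N}
        then (\<Prod>j\<le>N. fact (expo k j)) / fact ((\<Sum>j\<le>N. expo k j) + N) else 0) else 0)"
      by (cases "i = 0") (simp_all only: if_False simp_thms if_True power_0 mult_1_left)
  qed
  then show ?thesis
    by (simp add: sum.delta)
qed

text \<open>
  The map \<open>((s, t), (\<sigma>, \<tau>)) \<mapsto> (s \<sigma>, t\<^sub>0, \<dots>, t\<^sub>n, s \<tau>)\<close>, where \<open>s, t\<^sub>0, \<dots>, t\<^sub>n, \<sigma>, \<tau>\<close> are the coordinates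
  0 to \<open>n + 3\<close>. The coordinates \<open>v\<close> of the second factor are only renumbered: they start at \<open>n + 3\<close> in
  the target and at \<open>n + 4\<close> in the source.
\<close>

definition join_split :: "nat \<Rightarrow> nat \<Rightarrow> 'a::comm_ring_1 dform" where
  "join_split n i = (if i = 0 then coord 0 * coord (n + 2) else if i \<le> n + 1 then coord i
     else if i = n + 2 then coord 0 * coord (n + 3) else coord (i + 1))"

lemma function_map_join_split: "function_map (join_split n)"
  by (simp add: function_map_def join_split_def coord_in_forms_on mult_in_forms_on)

text \<open>
  The exponent of the pullback of \<open>x\<^sup>k\<close> along \<open>join_split\<close>, which maps coordinates to monomials.
\<close>

lift_definition join_split_exp :: "nat \<Rightarrow> (nat \<Rightarrow>\<^sub>0 nat) \<Rightarrow> (nat \<Rightarrow>\<^sub>0 nat)" is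
  "\<lambda>n k j. if j = 0 then k 0 + k (n + 2) else if j \<le> n + 1 then k j else if j = n + 2 then k 0
     else k (j - 1)"
proof -
  fix n :: nat and k :: "nat \<Rightarrow> nat"
  assume "finite {j. k j \<noteq> 0}"
  then have "finite ({..n + 2} \<union> Suc ` {j. k j \<noteq> 0})"
    by simp
  moreover have "{j. (if j = 0 then k 0 + k (n + 2) else if j \<le> n + 1 then k j else if j = n + 2 then k 0
     else k (j - 1)) \<noteq> 0} \<subseteq> {..n + 2} \<union> Suc ` {j. k j \<noteq> 0}" (is "?L \<subseteq> ?R")
  proof
    fix j assume "j \<in> ?L"
    then show "j \<in> ?R"
      by (cases j) (auto split: if_splits)
  qed
  ultimately show "finite {j. (if j = 0 then k 0 + k (n + 2) else if j \<le> n + 1 then k j else if j = n + 2 then k 0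
     else k (j - 1)) \<noteq> 0}"
    by (rule finite_subset [rotated])
qed

lemma subst_form_join_split_monomial:
  "subst_form (join_split n) (dmono c k {||}) = dmono c (join_split_exp n k) {||}"
proof (rule subst_form_monomial [OF function_map_join_split])
  show "join_split_exp n 0 = 0"
    by (rule poly_mapping_eqI) (simp add: join_split_exp.rep_eq)
  show "join_split_exp n (k + l) = join_split_exp n k + join_split_exp n l" for k l
    by (rule poly_mapping_eqI) (simp add: join_split_exp.rep_eq lookup_add)
  fix i
  have "join_split_exp n (Poly_Mapping.single i 1) =
    (if i = 0 then Poly_Mapping.single 0 1 + Poly_Mapping.single (n + 2) 1
     else if i \<le> n + 1 then Poly_Mapping.single i 1
     else if i = n + 2 then Poly_Mapping.single 0 1 + Poly_Mapping.single (n + 3) 1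
     else Poly_Mapping.single (i + 1) 1)"
    by (rule poly_mapping_eqI) (auto simp: join_split_exp.rep_eq lookup_add lookup_single when_def)
  then show "join_split n i = dmono 1 (join_split_exp n (Poly_Mapping.single i 1)) {||}"
    by (simp add: join_split_def coord_def dmono_mult_dmono)
qed

lemma subst_form_join_split_form:
  assumes "fset B \<subseteq> {1..n + 1}"
  shows "subst_form (join_split n) (dmono c k B) = dmono c (join_split_exp n k) B"
proof -
  have "dmono 1 0 B \<in> forms_on {} {1..n + 1}"
    using assms by (simp add: dmono_in_forms_on)
  then have "subst_form (join_split n) (dmono 1 0 B) = (subst_form coord (dmono 1 0 B) :: 'a dform)"
    by (rule subst_form_cong [OF function_map_join_split function_map_coord, rotated])
      (auto simp: join_split_def)
  then have "subst_form (join_split n) (dmono c k {||} * dmono 1 0 B) = dmono c (join_split_exp n k) {||} * dmono 1 0 B"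
    by (simp only: subst_form_mult [OF function_map_join_split] subst_form_ident
        subst_form_join_split_monomial)
  then show ?thesis
    by (simp add: dmono_mult_dmono)
qed

text \<open>
  Fubini's theorem for a monomial. The factor \<open>s\<close> in \<open>s d\<tau>\<close>, the part of \<open>d(s \<tau>)\<close> that matters, adds 1
  to the exponent of \<open>s\<close>. For \<open>a = k\<^sub>0\<close> and \<open>b = k\<^bsub>n+2\<^esub>\<close> the inner integral thus contributes
  \<open>(a + b + 1)!\<close> to the numerator, and this is the denominator of the outer integral
  \<open>a! b! / (a + b + 1)!\<close>.
\<close>

lemma simplex_int_join_split:
  fixes k :: "nat \<Rightarrow>\<^sub>0 nat"
  assumes B: "fset B \<subseteq> {1..n + 1}" and k1: "k1 = Poly_Mapping.single 0 1 + join_split_exp n k"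
  shows "simplex_int (n + 2) k (finsert (n + 2) B) =
    (simplex_int (n + 1) k1 B * simplex_int 1 (fibre_exp (n + 2) k1) {|1|} :: 'a::field_char_0)"
proof (cases "fset B = {1..n + 1}")
  case False
  have "fset (finsert (n + 2) B) \<noteq> {1..n + 2}"
  proof
    assume *: "fset (finsert (n + 2) B) = {1..n + 2}"
    have "fset B = fset (finsert (n + 2) B) - {n + 2}"
      using B by auto
    also have "\<dots> = {1..n + 1}"
      unfolding * by auto
    finally show False
      using False by simp
  qed
  moreover have zero: "0 |\<notin>| finsert (n + 2) B" "0 |\<notin>| B"
    using B by auto
  ultimately show ?thesis
    using False by (simp only: simplex_int_without_first [OF zero(1)] simplex_int_without_first [OF zero(2)]
        if_False mult_zero_left)
next
  case True
  have B': "fset (finsert (n + 2) B) = {1..n + 2}"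
    unfolding finsert.rep_eq True by (simp add: atLeastAtMostSuc_conv)
  have zero: "0 |\<notin>| finsert (n + 2) B" "0 |\<notin>| B" "0 |\<notin>| {|1::nat|}" "fset {|1|} = {1..1::nat}"
    using B by auto
  let ?p = "\<Prod>j=1..n + 1. fact (expo k j) :: 'a" and ?s = "\<Sum>j=1..n + 1. expo k j"
  have K1: "expo k1 0 = expo k 0 + expo k (n + 2) + 1" "\<And>j. j \<in> {1..n + 1} \<Longrightarrow> expo k1 j = expo k j"
    "expo k1 (n + 2) = expo k 0" "expo k1 (n + 3) = expo k (n + 2)"
    unfolding k1 lookup_add join_split_exp.rep_eq lookup_single by auto
  have range: "{..n + 1} = insert 0 {1..n + 1}" "{..n + 2} = insert 0 (insert (n + 2) {1..n + 1})"
    "{..1} = {0, 1::nat}"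
    by auto
  have P: "(\<Prod>j\<le>n + 1. fact (expo k1 j) :: 'a) = fact (expo k 0 + expo k (n + 2) + 1) * ?p"
    "(\<Prod>j\<le>n + 2. fact (expo k j) :: 'a) = fact (expo k 0) * fact (expo k (n + 2)) * ?p"
    "(\<Prod>j\<le>1. fact (expo (fibre_exp (n + 2) k1) j) :: 'a) = fact (expo k 0) * fact (expo k (n + 2))"
    unfolding range using K1 by (simp_all add: expo_fibre_exp mult.assoc numeral_3_eq_3)
  have S: "(\<Sum>j\<le>n + 1. expo k1 j) + (n + 1) = expo k 0 + expo k (n + 2) + ?s + (n + 2)"
    "(\<Sum>j\<le>n + 2. expo k j) + (n + 2) = expo k 0 + expo k (n + 2) + ?s + (n + 2)"
    "(\<Sum>j\<le>1. expo (fibre_exp (n + 2) k1) j) + 1 = expo k 0 + expo k (n + 2) + 1"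
    unfolding range using K1 by (simp_all add: expo_fibre_exp numeral_3_eq_3)
  have "simplex_int (n + 2) k (finsert (n + 2) B) =
      fact (expo k 0) * fact (expo k (n + 2)) * ?p / fact (expo k 0 + expo k (n + 2) + ?s + (n + 2))"
    by (simp only: simplex_int_without_first [OF zero(1)] B' if_True simp_thms P S)
  moreover have "simplex_int (n + 1) k1 B =
      fact (expo k 0 + expo k (n + 2) + 1) * ?p / fact (expo k 0 + expo k (n + 2) + ?s + (n + 2))"
    by (simp only: simplex_int_without_first [OF zero(2)] True if_True simp_thms P S)
  moreover have "simplex_int 1 (fibre_exp (n + 2) k1) {|1|} =
      (fact (expo k 0) * fact (expo k (n + 2)) / fact (expo k 0 + expo k (n + 2) + 1) :: 'a)"
    by (simp only: simplex_int_without_first [OF zero(3)] zero(4) if_True simp_thms P S)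
  ultimately show ?thesis
    by (simp del: fact_Suc)
qed

text \<open>
  Of the two parts of \<open>d(s \<tau>) = \<tau> ds + s d\<tau>\<close> the first contributes nothing: together with the \<open>dt\<^sub>i\<close> it
  has no differential of \<open>\<sigma>\<close> or \<open>\<tau>\<close>, so that the outer integral is that of a function. The same happens
  if the form does not contain the differential of the last coordinate.
\<close>

lemma fibre_int_join_split_monomial:
  fixes c :: "'a::field_char_0"
  assumes k: "vars k \<subseteq> {..n + 2}" and S: "fset S \<subseteq> {1..n + 2}"
  shows "fibre_int (Suc n) (dmono c k S) =
    fibre_int 0 (fibre_int n (subst_form (join_split n) (dmono c k S)))"
proof (cases "n + 2 |\<in>| S")
  case False
  have S': "fset S \<subseteq> {1..n + 1}"
  proof
    fix i assume "i \<in> fset S"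
    with S False show "i \<in> {1..n + 1}"
      by (cases "i = n + 2") (auto dest: subsetD)
  qed
  have "fibre_set (n + 2) S = {||}"
    using subsetD [OF S', of "i + (n + 2)" for i] by (auto simp: fset_eq_iff)
  then have right: "fibre_int 0 (fibre_int n (subst_form (join_split n) (dmono c k S))) = 0"
    by (simp only: subst_form_join_split_form [OF S'] fibre_int_dmono [of n] fibre_int_function)
  let ?S = "ffilter (\<lambda>i. i \<le> n + 2) S"
  have "n + 2 \<notin> fset ?S"
    using False by simp
  then have "fset ?S \<noteq> {1..n + 2}"
    by (metis atLeastAtMost_iff le_add2 one_le_numeral order.trans order_refl)
  moreover have "0 |\<notin>| ?S"
    using S by auto
  ultimately have "simplex_int (Suc n + 1) k ?S = (0::'a)"
    by (simp add: simplex_int_without_first)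
  then show ?thesis
    by (simp add: right fibre_int_dmono)
next
  case True
  define B where "B = S |-| {|n + 2|}"
  have SB: "S = finsert (n + 2) B"
    using True by (auto simp: B_def)
  have B: "fset B \<subseteq> {1..n + 1}"
  proof
    fix i assume "i \<in> fset B"
    then have "i \<in> fset S" "i \<noteq> n + 2"
      by (auto simp: B_def)
    then show "i \<in> {1..n + 1}"
      using subsetD [OF S, of i] by auto
  qed
  have low: "i \<le> n + 1" "i \<noteq> 0" if "i |\<in>| B" for i
    using subsetD [OF B, of i] that by auto
  have inv: "{(a, b). a |\<in>| B \<and> b |\<in>| {|n + 2|} \<and> b < a} = {}"
    using low by fastforce
  have "B |\<inter>| {|n + 2|} = {||}"
    by (simp add: B_def)
  then have "wedge_sign B {|n + 2|} = (1::'a)"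
    unfolding wedge_sign_def inv by simp
  then have split: "dmono c k S = dmono c k B * dcoord (n + 2)"
    by (simp add: SB dmono_mult_dcoord)
  let ?k = "join_split_exp n k"
  \<comment> \<open>The additional factor \<open>x\<^sub>0\<close> comes from \<open>s d\<tau>\<close>.\<close>
  define k1 where "k1 = Poly_Mapping.single 0 1 + ?k"
  have js: "join_split n (n + 2) = (coord 0 * coord (1 + (n + 2)) :: 'a dform)"
    by (simp add: join_split_def numeral_3_eq_3)
  have P: "subst_form (join_split n) (dmono c k S) =
      dmono c ?k B * dcoord 0 * coord (1 + (n + 2)) + coord 0 * dmono c ?k B * dcoord (1 + (n + 2))"
    unfolding split subst_form_mult [OF function_map_join_split] subst_form_dcoord [OF function_map_join_split]
      subst_form_join_split_form [OF B] js ext_d_coord_mult ext_d_coord distrib_left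
      coord_left_commute [of "dmono c ?k B"] mult.assoc ..
  have "fibre_set (n + 2) (finsert 0 B) = {||}" "fibre_set (n + 2) B = {||}"
    using low(1) [of "i + (n + 2)" for i] by (auto simp: fset_eq_iff)
  note fs = this
  have first: "fibre_int 0 (fibre_int n (dmono c ?k B * dcoord 0 * coord (1 + (n + 2)))) = 0"
    unfolding fibre_int_mult_coord
    by (simp only: dmono_mult_dcoord fibre_int_dmono [of n] fs coord_commute [symmetric]
        coord_mult_dmono fibre_int_function)
  have filt: "ffilter (\<lambda>i. i \<le> n + 1) B = B" "ffilter (\<lambda>i. i \<le> 0 + 1) {|1|} = {|1::nat|}"
    "ffilter (\<lambda>i. i \<le> Suc n + 1) S = S"
    using low(1) unfolding SB by (fastforce simp: fset_eq_iff)+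
  have second: "fibre_int 0 (fibre_int n (coord 0 * dmono c ?k B * dcoord (1 + (n + 2)))) =
      dmono (c * simplex_int (n + 1) k1 B * simplex_int 1 (fibre_exp (n + 2) k1) {|1|}) 0 {||}"
  proof -
    have "fibre_exp (0 + 2) (fibre_exp (n + 2) k1) = 0"
    proof (rule poly_mapping_eqI)
      fix i
      have "n + 3 + i \<notin> vars k"
        using k by auto
      then show "expo (fibre_exp (0 + 2) (fibre_exp (n + 2) k1)) i = expo 0 i"
        by (simp add: expo_fibre_exp k1_def lookup_add lookup_single join_split_exp.rep_eq in_keys_iff
            numeral_3_eq_3 add_ac)
    qed
    moreover have "fibre_set (0 + 2) {|1|} = {||}"
      by (auto simp: fset_eq_iff)
    ultimately show ?thesis
      unfolding fibre_int_mult_dcoord coord_mult_dmono k1_def [symmetric]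
      by (simp only: fibre_int_dmono fs filt dmono_mult_dcoord wedge_sign_empty mult_1_left) simp
  qed
  have "fibre_exp (Suc n + 2) k = 0"
    using subsetD [OF k, of "Suc n + 2 + i" for i] by (intro poly_mapping_eqI) (auto simp: expo_fibre_exp in_keys_iff)
  moreover have "fibre_set (Suc n + 2) S = {||}"
    using low(1) [of "i + (Suc n + 2)" for i] unfolding SB by (auto simp: fset_eq_iff)
  moreover have "simplex_int (Suc n + 1) k S = simplex_int (n + 1) k1 B * (simplex_int 1 (fibre_exp (n + 2) k1) {|1|} :: 'a)"
    using simplex_int_join_split [OF B k1_def] by (simp add: SB)
  ultimately have left: "fibre_int (Suc n) (dmono c k S) =
      dmono (c * simplex_int (n + 1) k1 B * simplex_int 1 (fibre_exp (n + 2) k1) {|1|}) 0 {||}"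
    by (simp only: fibre_int_dmono filt mult.assoc)
  show ?thesis
    unfolding left P additive.add [OF additive_fibre_int] first second by simp
qed

text \<open>
  The relation pulls back to \<open>(ds + \<Sum>\<^sub>i dt\<^sub>i) + ds (\<sigma> + \<tau> - 1) + s d(\<sigma> + \<tau>)\<close>. The inner integral kills
  multiples of the first summand, the outer one those of the others.
\<close>

lemma fibre_int_join_split_dcoord_sum:
  "fibre_int 0 (fibre_int n (subst_form (join_split n) ((\<Sum>i\<le>n + 2. dcoord i) * a))) = 0"
proof -
  let ?u = "(\<Sum>i\<le>0 + 1. coord i) - 1 :: 'a dform" and ?v = "\<Sum>i\<le>0 + 1. dcoord i :: 'a dform"
  let ?y = "subst_form (join_split n) a"
  have "(\<Sum>i\<le>n + 2. ext_d (join_split n i)) = (\<Sum>i\<in>{1..n + 1}. dcoord i) +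
      ext_d (coord 0 * coord (n + 2)) + ext_d (coord 0 * coord (n + 3) :: 'a dform)"
  proof -
    have "{..n + 2} = insert 0 (insert (n + 2) {1..n + 1})"
      by auto
    moreover have "(\<Sum>i\<in>{1..n + 1}. ext_d (join_split n i :: 'a dform)) = (\<Sum>i\<in>{1..n + 1}. dcoord i)"
      by (intro sum.cong refl) (auto simp: join_split_def ext_d_coord)
    ultimately show ?thesis
      by (simp add: join_split_def add_ac)
  qed
  also have "\<dots> = (\<Sum>i\<le>n + 1. dcoord i) + dcoord 0 * shift (n + 2) ?u + coord 0 * shift (n + 2) ?v"
  proof -
    have "{..n + 1} = insert 0 {1..n + 1}"
      by auto
    then show ?thesis
      by (simp add: ext_d_coord_mult ext_d_coord shift_simps additive.add [OF additive_shift]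
          additive.diff [OF additive_shift] distrib_left right_diff_distrib numeral_3_eq_3)
  qed
  finally have g: "subst_form (join_split n) (\<Sum>i\<le>n + 2. dcoord i) =
      (\<Sum>i\<le>n + 1. dcoord i) + dcoord 0 * shift (n + 2) ?u + coord 0 * shift (n + 2) ?v"
    by (simp only: additive.sum [OF additive_subst_form] subst_form_dcoord [OF function_map_join_split])
  have su: "shift (n + 2) ?u \<in> fun_forms"
    unfolding shift_def
    by (intro subst_form_function [OF function_map_coord] minus_in_forms_on sum_in_forms_on
        coord_in_forms_on one_in_forms_on) simp
  have u: "dcoord 0 * shift (n + 2) ?u * ?y = dcoord 0 * ?y * shift (n + 2) ?u"
    by (simp only: mult.assoc function_commute [OF su, of ?y])
  obtain y' where "\<And>i. dcoord i * ?y = y' * dcoord i"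
    using dcoord_mult_swap [OF in_forms_on_UNIV, of ?y] by metis
  then have "shift (n + 2) ?v * ?y = y' * shift (n + 2) ?v"
    by (simp add: additive.add [OF additive_shift] shift_simps distrib_left distrib_right)
  then have v: "coord 0 * shift (n + 2) ?v * ?y = coord 0 * y' * shift (n + 2) ?v"
    by (simp only: mult.assoc)
  show ?thesis
    unfolding subst_form_mult [OF function_map_join_split] g distrib_right additive.add [OF additive_fibre_int]
      u v fibre_int_mult_shift fibre_int_relations additive.zero [OF additive_fibre_int] by simp
qed

text \<open>
  Fubini's theorem. Forms \<open>\<beta>\<close> of the second factor can be taken out of all integrals, and modulo the
  relation between the differentials it remains to compare monomials.
\<close>

theorem fibre_int_Suc:
  "fibre_int (Suc n) b = fibre_int 0 (fibre_int n (subst_form (join_split n) b))"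
proof (rule additive_blocks_eqI [where r = "n + 3" and F = "fibre_int (Suc n)" and
      G = "\<lambda>b. fibre_int 0 (fibre_int n (subst_form (join_split n) b))"])
  show G: "additive (\<lambda>b. fibre_int 0 (fibre_int n (subst_form (join_split n) b)) :: 'a dform)"
    by standard (simp add: additive.add [OF additive_fibre_int] additive.add [OF additive_subst_form])
  show "additive (fibre_int (Suc n))"
    by (rule additive_fibre_int)
  fix \<alpha> \<beta> :: "'a dform" assume "\<alpha> \<in> forms_on {..<n + 3} {..<n + 3}"
  moreover have "{..<n + 3} = {..n + 2}"
    by auto
  ultimately have "\<alpha> \<in> forms_on {..n + 2} {..n + 2}"
    by simp
  then have \<alpha>: "fibre_int (Suc n) \<alpha> = fibre_int 0 (fibre_int n (subst_form (join_split n) \<alpha>))"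
  proof (rule additive_eqI_mod_dcoord_sum [OF additive_fibre_int _ G, rotated -1])
    show "fibre_int (Suc n) ((\<Sum>i\<le>n + 2. dcoord i) * a) = 0" for a :: "'a dform"
      using fibre_int_relations(3) [of "Suc n" a] by simp
  qed (rule fibre_int_join_split_dcoord_sum, rule fibre_int_join_split_monomial)
  have "subst_form (join_split n) (shift (n + 3) \<beta>) = shift (n + 2) (shift (0 + 2) \<beta>)"
    unfolding shift_shift
    by (simp add: shift_def subst_form_comp [OF function_map_join_split function_map_coord]
        subst_form_coord [OF function_map_join_split] join_split_def add_ac numeral_eq_Suc)
  moreover have "fibre_int (Suc n) (\<alpha> * shift (n + 3) \<beta>) = fibre_int (Suc n) \<alpha> * \<beta>"
    using fibre_int_mult_shift [of "Suc n" \<alpha> \<beta>] by (simp add: numeral_3_eq_3)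
  ultimately show "fibre_int (Suc n) (\<alpha> * shift (n + 3) \<beta>) =
      fibre_int 0 (fibre_int n (subst_form (join_split n) (\<alpha> * shift (n + 3) \<beta>)))"
    by (simp only: subst_form_mult [OF function_map_join_split] fibre_int_mult_shift \<alpha>)
qed

text \<open>
  The operator \<open>k\<^sub>f\<close> on representatives.
\<close>

definition join_int :: "nat \<Rightarrow> (nat \<Rightarrow> nat) \<Rightarrow> 'a::field_char_0 dform \<Rightarrow> 'a dform" where
  "join_int n f a = fibre_int n (subst_form (join_map n f) a)"

lemma function_map_join_map: "function_map (join_map n f)"
  unfolding function_map_def join_map_def coord_s_def coord_t_def coord_v_def
  by (auto intro!: add_in_forms_on mult_in_forms_on sum_in_forms_on coord_in_forms_on
      one_in_forms_on zero_in_forms_on)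

text \<open>
  By naturality the right-hand side is a single pullback followed by two integrations, so with Fubini's
  theorem the claim is an identity of polynomial maps, \<open>join_split\<close> followed by the join map of \<open>f\<close> being
  the join map of \<open>f\<close> on \<open>{0, \<dots>, n}\<close> with \<open>v\<close> replaced by \<open>\<sigma> v + \<tau> e\<^bsub>f(n+1)\<^esub>\<close>.
\<close>

lemma join_int_Suc: "join_int (Suc n) f a = join_int 0 (\<lambda>_. f (Suc n)) (join_int n f a)"
proof -
  let ?j = "join_map 0 (\<lambda>_. f (Suc n)) :: nat \<Rightarrow> 'a dform"
  have delta: "subst_form \<phi> (if P then 1 else 0) = (if P then 1 else 0 :: 'a dform)" for \<phi> P
    by (simp add: additive.zero [OF additive_subst_form])
  define L where "L = block_lift (n + 2) ?j"
  have bl: "function_map L"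
    unfolding L_def by (rule function_map_block_lift [OF function_map_join_map])
  have L: "L 0 = coord 0" "\<And>i. i \<le> n \<Longrightarrow> L (i + 1) = coord (i + 1)"
    "\<And>l. L (n + 2 + l) = coord (n + 2) * coord (n + 4 + l) +
      coord (n + 3) * (if l = f (Suc n) then 1 else 0)"
    by (simp_all add: L_def block_lift_def join_map_def coord_s_def coord_t_def coord_v_def shift_simps
        additive.add [OF additive_shift] additive.zero [OF additive_shift] numeral_eq_Suc add_ac)
  have "subst_form (join_split n) (join_map (Suc n) f l) = subst_form L (join_map n f l)" for l
  proof -
    have "subst_form (join_split n) (join_map (Suc n) f l) =
        coord 0 * coord (n + 2) * coord (n + 4 + l) + ((\<Sum>i\<le>n. coord (i + 1) * (if l = f i then 1 else 0)) +
        coord 0 * coord (n + 3) * (if l = f (Suc n) then 1 else 0 :: 'a dform))"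
      by (simp add: join_map_def coord_s_def coord_t_def coord_v_def additive.add [OF additive_subst_form]
          additive.sum [OF additive_subst_form] subst_form_mult [OF function_map_join_split]
          subst_form_coord [OF function_map_join_split] delta join_split_def numeral_eq_Suc mult.assoc)
    also have "\<dots> = subst_form L (join_map n f l)"
      unfolding join_map_def coord_s_def coord_t_def coord_v_def additive.add [OF additive_subst_form]
        additive.sum [OF additive_subst_form] subst_form_mult [OF bl] subst_form_coord [OF bl] delta L
      using L(2) by (simp add: distrib_left mult.assoc add_ac)
    finally show ?thesis .
  qed
  then show ?thesis
    by (simp only: join_int_def fibre_int_Suc subst_form_fibre_int [OF function_map_join_map] L_def [symmetric]
        subst_form_comp [OF bl function_map_join_map] subst_form_comp [OF function_map_join_split function_map_join_map])
qed

section \<open>Integration over one edge\<close>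

text \<open>
  The exchange of \<open>s\<close> and \<open>t\<^sub>0\<close>.
\<close>

definition swap_index :: "nat \<Rightarrow> nat" where
  "swap_index i = (if i = 0 then 1 else if i = 1 then 0 else i)"

lemma swap_index_simps [simp]: "swap_index 0 = 1" "swap_index (Suc 0) = 0" "swap_index (Suc (Suc i)) = Suc (Suc i)"
  by (simp_all add: swap_index_def)

lemma inj_swap_index: "inj swap_index"
  by (rule injI) (auto simp: swap_index_def split: if_splits)

lift_definition swap_exp :: "(nat \<Rightarrow>\<^sub>0 nat) \<Rightarrow> (nat \<Rightarrow>\<^sub>0 nat)" is "\<lambda>k j. k (swap_index j)"
proof -
  fix k :: "nat \<Rightarrow> nat"
  assume "finite {j. k j \<noteq> 0}"
  then have "finite (swap_index -` {j. k j \<noteq> 0})"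
    by (rule finite_vimageI [OF _ inj_swap_index])
  then show "finite {j. k (swap_index j) \<noteq> 0}"
    by (simp add: vimage_def)
qed

abbreviation swap_map :: "nat \<Rightarrow> 'a::comm_ring_1 dform" where
  "swap_map i \<equiv> coord (swap_index i)"

lemma subst_form_swap_monomial: "subst_form swap_map (dmono c k {||}) = dmono c (swap_exp k) {||}"
proof (rule subst_form_monomial [OF function_map_coord])
  show "swap_exp 0 = 0"
    by (rule poly_mapping_eqI) (simp add: swap_exp.rep_eq)
  show "swap_exp (k + l) = swap_exp k + swap_exp l" for k l
    by (rule poly_mapping_eqI) (simp add: swap_exp.rep_eq lookup_add)
  have "swap_exp (Poly_Mapping.single i 1) = Poly_Mapping.single (swap_index i) 1" for i
    by (rule poly_mapping_eqI) (auto simp: swap_exp.rep_eq lookup_single when_def swap_index_def)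
  then show "swap_map i = dmono 1 (swap_exp (Poly_Mapping.single i 1)) {||}" for i
    by (simp add: coord_def)
qed

lemma simplex_int_edge:
  "simplex_int 1 k {|1|} = (fact (expo k 0) * fact (expo k 1) / fact (expo k 0 + expo k 1 + 1) :: 'a::field_char_0)"
  "simplex_int 1 k {|0|} = (- (fact (expo k 0) * fact (expo k 1)) / fact (expo k 0 + expo k 1 + 1) :: 'a::field_char_0)"
proof -
  have "{..1::nat} = {0, 1}"
    by auto
  then show "simplex_int 1 k {|1|} = (fact (expo k 0) * fact (expo k 1) / fact (expo k 0 + expo k 1 + 1) :: 'a)"
    "simplex_int 1 k {|0|} = (- (fact (expo k 0) * fact (expo k 1)) / fact (expo k 0 + expo k 1 + 1) :: 'a)"
    unfolding simplex_int_def by (simp_all add: insert_Diff_if del: fact_Suc One_nat_def)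
qed

text \<open>
  Exchanging the two coordinates of the edge reverses its orientation.
\<close>

lemma fibre_int_swap: "fibre_int 0 (subst_form swap_map b) = - fibre_int 0 b"
proof (rule additive_blocks_eqI [where r = 2 and F = "\<lambda>b. fibre_int 0 (subst_form swap_map b)" and G = "\<lambda>b. - fibre_int 0 b"])
  show F: "additive (\<lambda>b. fibre_int 0 (subst_form swap_map b) :: 'a dform)" and G: "additive (\<lambda>b. - fibre_int 0 b :: 'a dform)"
    by standard (simp_all add: additive.add [OF additive_fibre_int] additive.add [OF additive_subst_form])
  fix \<alpha> \<beta> :: "'a dform" assume "\<alpha> \<in> forms_on {..<2} {..<2}"
  moreover have "{..<2} = {..1::nat}"
    by auto
  ultimately have "\<alpha> \<in> forms_on {..1} {..1}"
    by simp
  then have \<alpha>: "fibre_int 0 (subst_form swap_map \<alpha>) = - fibre_int 0 \<alpha>"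
  proof (rule additive_eqI_mod_dcoord_sum [OF F _ G, rotated -1])
    fix a :: "'a dform"
    have "subst_form swap_map (\<Sum>i\<le>1. dcoord i) = (\<Sum>i\<le>1. dcoord i :: 'a dform)"
      by (simp add: additive.add [OF additive_subst_form] subst_form_dcoord [OF function_map_coord] ext_d_coord add.commute)
    then show "fibre_int 0 (subst_form swap_map ((\<Sum>i\<le>1. dcoord i) * a)) = 0"
      using fibre_int_relations(3) [of 0 "subst_form swap_map a"]
      by (simp add: subst_form_mult [OF function_map_coord])
    show "- fibre_int 0 ((\<Sum>i\<le>1. dcoord i) * a) = 0"
      using fibre_int_relations(3) [of 0 a] by simp
  next
    fix c :: 'a and k and S :: "nat fset" assume "fset S \<subseteq> {1..1}"
    then have "fset S = fset {||} \<or> fset S = fset {|1|}"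
      by (simp add: subset_singleton_iff)
    then consider "S = {||}" | "S = {|1|}"
      unfolding fset_inject by blast
    then show "fibre_int 0 (subst_form swap_map (dmono c k S)) = - fibre_int 0 (dmono c k S)"
    proof cases
      case 1
      then show ?thesis
        by (simp only: subst_form_swap_monomial fibre_int_function) simp
    next
      case 2
      have "dmono c k S = dmono c k {||} * dcoord 1"
        by (simp add: 2 dmono_mult_dcoord)
      then have "subst_form swap_map (dmono c k S) = dmono c (swap_exp k) {||} * dcoord 0"
        by (simp only: subst_form_mult [OF function_map_coord] subst_form_swap_monomial
            subst_form_dcoord [OF function_map_coord] ext_d_coord) simp
      then have sw: "subst_form swap_map (dmono c k S) = dmono c (swap_exp k) {|0|}"
        by (simp add: dmono_mult_dcoord)
      have "fibre_exp 2 (swap_exp k) = fibre_exp 2 k"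
        by (rule poly_mapping_eqI) (simp add: expo_fibre_exp swap_exp.rep_eq)
      moreover have "fibre_set 2 {|0|} = {||}" "fibre_set 2 {|1|} = {||}"
        by (auto simp: fset_eq_iff)
      moreover have "ffilter (\<lambda>i. i \<le> 0 + 1) {|0|} = {|0 :: nat|}" "ffilter (\<lambda>i. i \<le> 0 + 1) {|1|} = {|1 :: nat|}"
        by (auto simp: fset_eq_iff)
      moreover have "simplex_int 1 (swap_exp k) {|0|} = (- simplex_int 1 k {|1|} :: 'a)"
        by (simp only: simplex_int_edge swap_exp.rep_eq) (simp add: mult.commute add.commute)
      moreover have "dmono (- x) l A = (- dmono x l A :: 'a dform)" for x l A
        by (rule dform_eqI) (simp add: coeff_dmono)
      ultimately show ?thesis
        unfolding sw unfolding 2 fibre_int_dmono by (simp add: numeral_2_eq_2)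
    qed
  qed
  have "subst_form swap_map (shift 2 \<beta>) = shift 2 \<beta>"
    by (simp add: shift_def subst_form_comp [OF function_map_coord function_map_coord]
        subst_form_coord [OF function_map_coord] numeral_2_eq_2)
  then show "fibre_int 0 (subst_form swap_map (\<alpha> * shift 2 \<beta>)) = - fibre_int 0 (\<alpha> * shift 2 \<beta>)"
    by (simp only: subst_form_mult [OF function_map_coord] fibre_int_mult_shift [of 0, unfolded add_0] \<alpha> mult_minus_left)
qed

lemma s_int_eq: "s_int a = (\<Sum>p\<in>supp a. if 0 |\<in>| snd p \<or> 1 |\<in>| snd p then 0 else
     dmono (coeff a p * (fact (expo (fst p) 1) * fact (expo (fst p) 0) / fact (expo (fst p) 1 + expo (fst p) 0 + 1)))
       (fibre_exp 2 (fst p)) (fibre_set 2 (snd p)))"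
  by (simp add: s_int_def case_prod_unfold cong: if_cong)

lemma additive_s_int: "additive s_int"
  unfolding s_int_eq [abs_def]
  by (rule additive_extension [where F = "\<lambda>p c. if 0 |\<in>| snd p \<or> 1 |\<in>| snd p then 0 else
     dmono (c * (fact (expo (fst p) 1) * fact (expo (fst p) 0) / fact (expo (fst p) 1 + expo (fst p) 0 + 1)))
       (fibre_exp 2 (fst p)) (fibre_set 2 (snd p))"])
    (simp_all add: dmono_add distrib_right add_divide_distrib del: fact_Suc)

lemma s_int_dmono: "s_int (dmono c k S) = (if 0 |\<in>| S \<or> 1 |\<in>| S then 0 else
     dmono (c * (fact (expo k 1) * fact (expo k 0) / fact (expo k 1 + expo k 0 + 1)))
       (fibre_exp 2 k) (fibre_set 2 S))"
  unfolding s_int_eq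
  by (subst sum_supp_dmono [where F = "\<lambda>p c. if 0 |\<in>| snd p \<or> 1 |\<in>| snd p then 0 else
     dmono (c * (fact (expo (fst p) 1) * fact (expo (fst p) 0) / fact (expo (fst p) 1 + expo (fst p) 0 + 1)))
       (fibre_exp 2 (fst p)) (fibre_set 2 (snd p))"]) (simp_all del: fact_Suc)

text \<open>
  In the coordinates \<open>(s, t\<^sub>0)\<close> the edge is oriented by \<open>dt\<^sub>0 = - ds\<close>, whence the sign. Multiplication by
  \<open>ds\<close> followed by integration discards monomials with \<open>ds\<close> or \<open>dt\<^sub>0\<close>, as \<open>s_int\<close> does.
\<close>

lemma s_int_eq_fibre_int: "s_int a = - fibre_int 0 (dcoord 0 * a)"
proof (rule additive_eqI [where F = s_int and G = "\<lambda>a. - fibre_int 0 (dcoord 0 * a)"])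
  show "additive (\<lambda>a. - fibre_int 0 (dcoord 0 * a))"
    by standard (simp add: additive.add [OF additive_fibre_int] distrib_left)
  fix c :: 'a and k and S :: "nat fset"
  have neg: "dmono (- x) l A = (- dmono x l A :: 'a dform)" for x l A
    by (rule dform_eqI) (simp add: coeff_dmono)
  consider "0 |\<in>| S" | "0 |\<notin>| S" "1 |\<in>| S" | "0 |\<notin>| S" "1 |\<notin>| S"
    by blast
  then show "s_int (dmono c k S) = - fibre_int 0 (dcoord 0 * dmono c k S)"
  proof cases
    case 1
    then have "wedge_sign {|0|} S = (0::'a)"
      by (auto simp: wedge_sign_def)
    with 1 show ?thesis
      by (simp add: s_int_dmono dcoord_mult_dmono additive.zero [OF additive_fibre_int])
  next
    case 2
    then have "ffilter (\<lambda>i. i \<le> 0 + 1) (finsert 0 S) = {|0, 1|}"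
      by (auto simp: fset_eq_iff)
    moreover have "simplex_int 1 k {|0, 1|} = (0::'a)"
      unfolding simplex_int_def
    proof (rule sum.neutral, rule ballI, rule if_not_P)
      fix i :: nat assume "i \<in> {..1}"
      then have "i \<in> fset {|0, 1|}"
        by auto
      then show "fset {|0, 1|} \<noteq> {..1} - {i}"
        by blast
    qed
    ultimately show ?thesis
      using 2 by (simp add: s_int_dmono dcoord_mult_dmono fibre_int_dmono)
  next
    case 3
    have "ffilter (\<lambda>i. i \<le> 0 + 1) (finsert 0 S) = {|0|}"
    proof (rule fset_eqI)
      show "i |\<in>| ffilter (\<lambda>i. i \<le> 0 + 1) (finsert 0 S) \<longleftrightarrow> i |\<in>| {|0|}" for i
        using 3 by (cases "i = 1") auto
    qed
    moreover have "wedge_sign {|0|} S = (1::'a)"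
      using 3 by (simp add: wedge_sign_single_left)
    moreover have "fibre_set 2 (finsert 0 S) = fibre_set 2 S"
      by (rule fibre_set_finsert_low) simp
    moreover have "simplex_int 1 k {|0|} = (- (fact (expo k 1) * fact (expo k 0) / fact (expo k 1 + expo k 0 + 1)) :: 'a)"
      by (simp only: simplex_int_edge) (simp add: mult.commute add.commute)
    ultimately have "fibre_int 0 (dcoord 0 * dmono c k S) =
      dmono (- (c * (fact (expo k 1) * fact (expo k 0) / fact (expo k 1 + expo k 0 + 1)))) (fibre_exp 2 k) (fibre_set 2 S)"
      unfolding dcoord_mult_dmono fibre_int_dmono by (simp del: fact_Suc add: numeral_2_eq_2)
    with 3 show ?thesis
      by (simp add: s_int_dmono neg del: fact_Suc)
  qed
qed (rule additive_s_int)

lemma function_map_contraction_map: "function_map (contraction_map j)"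
  unfolding function_map_def contraction_map_def coord_s_def coord_t_def coord_v_def
  by (auto intro!: add_in_forms_on mult_in_forms_on coord_in_forms_on
      one_in_forms_on zero_in_forms_on)

text \<open>
  The exchange of \<open>s\<close> and \<open>t\<^sub>0\<close> turns the contraction \<open>s e\<^sub>j + t\<^sub>0 v\<close> into the join map \<open>s v + t\<^sub>0 e\<^sub>j\<close>.
\<close>

lemma join_int_0:
  fixes a :: "'a::field_char_0 dform"
  shows "join_int 0 (\<lambda>_. j) a = - fibre_int 0 (subst_form (contraction_map j) a)"
proof -
  have "(\<lambda>l. subst_form swap_map (contraction_map j l)) = (join_map 0 (\<lambda>_. j) :: nat \<Rightarrow> 'a dform)"
    by (simp add: fun_eq_iff contraction_map_def join_map_def coord_s_def coord_t_def coord_v_def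
        additive.add [OF additive_subst_form] subst_form_mult [OF function_map_coord]
        subst_form_coord [OF function_map_coord] additive.zero [OF additive_subst_form])
  then show ?thesis
    by (simp only: join_int_def fibre_int_swap [symmetric]
        subst_form_comp [OF function_map_coord function_map_contraction_map])
qed

section \<open>The coefficient of the first differential\<close>

text \<open>
  Contraction with the vector field \<open>\<partial>/\<partial>x\<^sub>0\<close>. It has no sign, as \<open>dx\<^sub>0\<close> is the first differential in every
  basis monomial that contains it.
\<close>

definition contract0 :: "'a::comm_ring_1 dform \<Rightarrow> 'a dform" where
  "contract0 a = (\<Sum>p\<in>supp a. if 0 |\<in>| snd p then dmono (coeff a p) (fst p) (snd p |-| {|0|}) else 0)"

lemma additive_contract0: "additive contract0"
  unfolding contract0_def [abs_def]
  by (rule additive_extension [where F = "\<lambda>p c. if 0 |\<in>| snd p then dmono c (fst p) (snd p |-| {|0|}) else 0"])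
    (simp_all add: dmono_add)

lemma contract0_dmono: "contract0 (dmono c k S) = (if 0 |\<in>| S then dmono c k (S |-| {|0|}) else 0)"
  unfolding contract0_def
  by (subst sum_supp_dmono [where F = "\<lambda>p c. if 0 |\<in>| snd p then dmono c (fst p) (snd p |-| {|0|}) else 0"]) simp_all

lemma contract0_mult_coord: "contract0 (a * coord i) = contract0 a * coord i"
  by (rule additive_eqI [where F = "\<lambda>a. contract0 (a * coord i)" and G = "\<lambda>a. contract0 a * coord i"])
    (unfold_locales, simp_all add: distrib_right distrib_left additive.add [OF additive_contract0] contract0_dmono
      coord_commute [symmetric] coord_mult_dmono)

lemma contract0_mult_dcoord:
  assumes "i \<noteq> 0"
  shows "contract0 (a * dcoord i) = contract0 a * dcoord i"
proof (rule additive_eqI [where F = "\<lambda>a. contract0 (a * dcoord i)" and G = "\<lambda>a. contract0 a * dcoord i"])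
  show "additive (\<lambda>a. contract0 (a * dcoord i))" "additive (\<lambda>a. contract0 a * dcoord i)"
    by standard (simp_all add: distrib_right additive.add [OF additive_contract0])
  fix c :: 'a and k S
  have "{(a, b). a |\<in>| S \<and> b |\<in>| {|i|} \<and> b < a} = {(a, b). a |\<in>| S |-| {|0|} \<and> b |\<in>| {|i|} \<and> b < a}"
    by auto
  moreover have "S |\<inter>| {|i|} = {||} \<longleftrightarrow> (S |-| {|0|}) |\<inter>| {|i|} = {||}"
    using assms by auto
  ultimately have "wedge_sign S {|i|} = (wedge_sign (S |-| {|0|}) {|i|} :: 'a)"
    by (simp only: wedge_sign_def)
  moreover have "finsert i S |-| {|0|} = finsert i (S |-| {|0|})"
    using assms by auto
  ultimately show "contract0 (dmono c k S * dcoord i) = contract0 (dmono c k S) * dcoord i"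
    using assms by (simp add: dmono_mult_dcoord contract0_dmono)
qed

lemma contract0_mult:
  assumes "b \<in> forms_on V W" "0 \<notin> W"
  shows "contract0 (a * b) = contract0 a * b"
  using assms(1)
proof (induction arbitrary: a rule: forms_on_induct)
  case (const c)
  show ?case
    by (rule additive_eqI [where F = "\<lambda>a. contract0 (a * dconst c)" and G = "\<lambda>a. contract0 a * dconst c"])
      (unfold_locales, simp_all add: distrib_right distrib_left additive.add [OF additive_contract0] contract0_dmono
        dconst_commute [symmetric] dmono_split [symmetric])
next
  case (coord i b)
  then show ?case
    by (simp only: mult.assoc [symmetric] contract0_mult_coord)
next
  case (dcoord i b)
  then have "i \<noteq> 0"
    using assms(2) by metis
  then show ?case
    by (simp only: mult.assoc [symmetric] contract0_mult_dcoord [OF \<open>i \<noteq> 0\<close>] dcoord.IH)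
qed (simp add: distrib_left additive.add [OF additive_contract0])

lemma contract0_cancel:
  assumes "\<alpha> \<in> forms_on V W" "\<beta> \<in> forms_on V W" "0 \<notin> W"
  shows "contract0 (dcoord 0 * \<alpha> + \<beta>) = \<alpha>"
proof -
  have "contract0 (dcoord 0) = (1 :: 'a dform)" "contract0 1 = (0 :: 'a dform)"
    by (simp_all add: dcoord_def one_dform_def contract0_dmono)
  then show ?thesis
    using contract0_mult [OF assms(1,3), of "dcoord 0"] contract0_mult [OF assms(2,3), of 1]
    by (simp add: additive.add [OF additive_contract0])
qed

lemma contract0_in_forms_on: "a \<in> forms_on V W \<Longrightarrow> contract0 a \<in> forms_on V W"
  by (induction rule: forms_on_dmono_induct)
    (auto simp: additive.add [OF additive_contract0] contract0_dmono
      intro!: add_in_forms_on dmono_in_forms_on zero_in_forms_on)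

section \<open>Ideals generated by normal elements\<close>

text \<open>
  The generators of the ideals are normal, that is, they can be moved from left to right of any form
  at the price of changing the form. For such generators the left combinations are already a
  two-sided ideal, so additive maps need to be examined only on multiples \<open>x * g\<close>.
\<close>

inductive_set left_span :: "'a::comm_ring_1 dform set \<Rightarrow> 'a dform set \<Rightarrow> 'a dform set" for A G where
  zero: "0 \<in> left_span A G"
| mult: "x \<in> A \<Longrightarrow> g \<in> G \<Longrightarrow> x * g \<in> left_span A G"
| add: "a \<in> left_span A G \<Longrightarrow> b \<in> left_span A G \<Longrightarrow> a + b \<in> left_span A G"

lemma dform_ring_simps:
  "carrier (dform_ring N) = forms_on {..N} {..N}" "a \<otimes>\<^bsub>dform_ring N\<^esub> b = a * b"
  "a \<oplus>\<^bsub>dform_ring N\<^esub> b = a + b" "\<zero>\<^bsub>dform_ring N\<^esub> = 0" "\<one>\<^bsub>dform_ring N\<^esub> = 1"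
  by (simp_all add: dform_ring_def)

lemma genideal_subset_left_span:
  fixes G :: "'a::comm_ring_1 dform set"
  assumes G: "G \<subseteq> forms_on {..N} {..N}"
    and normal: "\<And>g x. g \<in> G \<Longrightarrow> x \<in> forms_on {..N} {..N} \<Longrightarrow> \<exists>x'\<in>forms_on {..N} {..N}. g * x = x' * g"
  shows "Idl\<^bsub>dform_ring N\<^esub> G \<subseteq> left_span (forms_on {..N} {..N}) G"
proof -
  let ?R = "dform_ring N :: 'a dform ring" and ?A = "forms_on {..N} {..N} :: 'a dform set"
  let ?L = "left_span ?A G"
  have sub: "a \<in> ?A" if "a \<in> ?L" for a
    using that by induction (use G in \<open>auto simp: zero_in_forms_on mult_in_forms_on add_in_forms_on\<close>)
  have left: "x * a \<in> ?L" if "a \<in> ?L" "x \<in> ?A" for a x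
    using that
    by (induction) (auto simp: distrib_left mult.assoc [symmetric] intro: left_span.intros mult_in_forms_on)
  have right: "a * x \<in> ?L" if "a \<in> ?L" "x \<in> ?A" for a x
    using that
  proof induction
    case (mult y g)
    obtain x' where "x' \<in> ?A" "g * x = x' * g"
      using normal [OF mult(2,3)] by blast
    then have "y * g * x = y * x' * g" "y * x' \<in> ?A"
      using mult(1) by (simp_all add: mult.assoc mult_in_forms_on)
    then show ?case
      using mult(2) left_span.mult by metis
  qed (auto simp: distrib_right intro: left_span.intros)
  have neg: "- a \<in> ?L" if "a \<in> ?L" for a
    using left [OF that, of "- 1"] by (simp add: uminus_in_forms_on one_in_forms_on)
  interpret R: Ring.ring ?R
    by (rule ring_dform_ring)
  have "ideal ?L ?R"
  proof (rule idealI)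
    show "Ring.ring ?R"
      by (rule ring_dform_ring)
    show "subgroup ?L (add_monoid ?R)"
    proof (rule R.add.subgroupI)
      show "\<ominus>\<^bsub>?R\<^esub> a \<in> ?L" if "a \<in> ?L" for a
      proof -
        have "\<ominus>\<^bsub>?R\<^esub> a = - a"
          using sub [OF that] by (intro R.minus_equality) (simp_all add: dform_ring_simps uminus_in_forms_on)
        then show ?thesis
          using neg [OF that] by simp
      qed
      show "?L \<noteq> {}"
        using left_span.zero by fast
    qed (use sub left_span.add in \<open>auto simp: dform_ring_simps\<close>)
  qed (simp_all add: dform_ring_simps left right)
  moreover have "G \<subseteq> ?L"
    using left_span.mult [OF one_in_forms_on, of _ G] by auto
  ultimately show ?thesis
    unfolding genideal_def by auto
qed

lemma ideal_dform_ring: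
  assumes "ideal I (dform_ring N)"
  shows "0 \<in> I" "a \<in> I \<Longrightarrow> b \<in> I \<Longrightarrow> a + b \<in> I" "a \<in> I \<Longrightarrow> x \<in> forms_on {..N} {..N} \<Longrightarrow> x * a \<in> I"
    "a \<in> I \<Longrightarrow> x \<in> forms_on {..N} {..N} \<Longrightarrow> a * x \<in> I" "a \<in> I \<Longrightarrow> - a \<in> I" "a \<in> I \<Longrightarrow> b \<in> I \<Longrightarrow> a - b \<in> I"
    "a \<in> I \<Longrightarrow> a \<in> forms_on {..N} {..N}"
proof -
  interpret ideal I "dform_ring N"
    by (rule assms)
  show z: "0 \<in> I" and add: "\<And>a b. a \<in> I \<Longrightarrow> b \<in> I \<Longrightarrow> a + b \<in> I"
    using additive_subgroup.zero_closed [OF is_additive_subgroup] additive_subgroup.a_closed [OF is_additive_subgroup]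
    by (simp_all add: dform_ring_simps)
  show left: "\<And>a x. a \<in> I \<Longrightarrow> x \<in> forms_on {..N} {..N} \<Longrightarrow> x * a \<in> I"
    and "\<And>a x. a \<in> I \<Longrightarrow> x \<in> forms_on {..N} {..N} \<Longrightarrow> a * x \<in> I"
    using I_l_closed I_r_closed by (simp_all add: dform_ring_simps)
  show neg: "\<And>a. a \<in> I \<Longrightarrow> - a \<in> I"
    using left [of _ "- 1"] by (simp add: uminus_in_forms_on one_in_forms_on)
  show "a \<in> I \<Longrightarrow> b \<in> I \<Longrightarrow> a - b \<in> I"
    using add [of a "- b"] neg [of b] by simp
  show "a \<in> I \<Longrightarrow> a \<in> forms_on {..N} {..N}"
    using a_subset by (auto simp: dform_ring_simps)
qed

section \<open>The ideals of the relations\<close>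

definition simplex_rel :: "nat \<Rightarrow> 'a::comm_ring_1 dform" where
  "simplex_rel N = (\<Sum>i\<le>N. coord i) - 1"

definition simplex_drel :: "nat \<Rightarrow> 'a::comm_ring_1 dform" where
  "simplex_drel N = (\<Sum>i\<le>N. dcoord i)"

lemma ext_d_simplex_rel: "ext_d (simplex_rel N) = simplex_drel N"
  by (simp add: simplex_rel_def simplex_drel_def additive.diff [OF additive_ext_d]
      additive.sum [OF additive_ext_d] ext_d_coord)

lemma simplex_rel_in_forms_on: "{..N} \<subseteq> V \<Longrightarrow> simplex_rel N \<in> forms_on V W"
  "{..N} \<subseteq> W \<Longrightarrow> simplex_drel N \<in> forms_on V W"
  unfolding simplex_rel_def simplex_drel_def
  by (auto intro!: minus_in_forms_on sum_in_forms_on coord_in_forms_on one_in_forms_on dcoord_in_forms_on)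

lemma shift_in_forms_on:
  assumes "a \<in> forms_on V W" "(\<lambda>i. i + r) ` V \<subseteq> V'" "(\<lambda>i. i + r) ` W \<subseteq> W'"
  shows "shift r a \<in> forms_on V' W'"
  unfolding shift_def
  by (rule subst_form_in_forms_on [OF function_map_coord _ _ assms(1)])
    (use assms in \<open>auto simp: ext_d_coord intro!: coord_in_forms_on dcoord_in_forms_on\<close>)

text \<open>
  The function \<open>\<Sum>\<^sub>i x\<^sub>i - 1\<close> is central, and \<open>\<Sum>\<^sub>i dx\<^sub>i\<close> can be moved past any form by
  \<open>dcoord_mult_swap\<close>.
\<close>

lemma normal_simplex_rel:
  fixes x :: "'a::comm_ring_1 dform"
  assumes "x \<in> forms_on V V"
  shows "\<exists>x'\<in>forms_on V V. shift r (simplex_rel N) * x = x' * shift r (simplex_rel N)"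
    and "\<exists>x'\<in>forms_on V V. shift r (simplex_drel N) * x = x' * shift r (simplex_drel N)"
proof -
  have "shift r (simplex_rel N) \<in> (fun_forms :: 'a dform set)"
    using simplex_rel_in_forms_on(1) by (rule shift_in_forms_on) auto
  then have "shift r (simplex_rel N) * x = x * shift r (simplex_rel N)"
    by (rule function_commute)
  with assms show "\<exists>x'\<in>forms_on V V. shift r (simplex_rel N) * x = x' * shift r (simplex_rel N)"
    by blast
  obtain x' where "x' \<in> forms_on V V" "\<And>i. dcoord i * x = x' * dcoord i"
    using dcoord_mult_swap [OF assms] by metis
  then show "\<exists>x'\<in>forms_on V V. shift r (simplex_drel N) * x = x' * shift r (simplex_drel N)"
    by (intro bexI [of _ x']) (simp_all add: simplex_drel_def additive.sum [OF additive_shift]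
        shift_simps sum_distrib_left sum_distrib_right)
qed

lemma shift_0: "shift 0 a = a"
  by (simp add: shift_def subst_form_ident)

lemma simplex_ideal_eq: "simplex_ideal n = Idl\<^bsub>dform_ring n\<^esub> {simplex_rel n, simplex_drel n}"
  by (simp add: simplex_ideal_def simplex_rel_def simplex_drel_def)

lemma sum_atMost_split: "(\<Sum>i\<le>n + 1. f i) = f 0 + (\<Sum>i\<le>n. f (i + 1))" for f :: "nat \<Rightarrow> 'b::comm_monoid_add"
  by (simp add: sum.atMost_Suc_shift del: sum.atMost_Suc)

lemma product_ideal_eq: "product_ideal n m = Idl\<^bsub>dform_ring (n + m + 2)\<^esub>
   {simplex_rel (n + 1), simplex_drel (n + 1), shift (n + 2) (simplex_rel m), shift (n + 2) (simplex_drel m)}"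
proof -
  have "coord_s + (\<Sum>i\<le>n. coord_t i) - 1 = (simplex_rel (n + 1) :: 'a dform)"
    unfolding simplex_rel_def sum_atMost_split by (simp add: coord_s_def coord_t_def)
  moreover have "ext_d coord_s + (\<Sum>i\<le>n. ext_d (coord_t i)) = (simplex_drel (n + 1) :: 'a dform)"
    unfolding simplex_drel_def sum_atMost_split by (simp add: coord_s_def coord_t_def ext_d_coord)
  moreover have "(\<Sum>l\<le>m. coord_v n l) - 1 = (shift (n + 2) (simplex_rel m) :: 'a dform)"
    by (simp add: simplex_rel_def coord_v_def additive.diff [OF additive_shift]
        additive.sum [OF additive_shift] shift_simps add_ac)
  moreover have "(\<Sum>l\<le>m. ext_d (coord_v n l)) = (shift (n + 2) (simplex_drel m) :: 'a dform)"
    by (simp add: simplex_drel_def coord_v_def ext_d_coord additive.sum [OF additive_shift] shift_simps add_ac)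
  ultimately show ?thesis
    unfolding product_ideal_def by simp
qed

lemma product_gens_in_forms_on:
  "simplex_rel (n + 1) \<in> forms_on {..n + m + 2} {..n + m + 2}"
  "simplex_drel (n + 1) \<in> forms_on {..n + m + 2} {..n + m + 2}"
  "shift (n + 2) (simplex_rel m) \<in> forms_on {..n + m + 2} {..n + m + 2}"
  "shift (n + 2) (simplex_drel m) \<in> forms_on {..n + m + 2} {..n + m + 2}"
  by (rule simplex_rel_in_forms_on, force, rule simplex_rel_in_forms_on, force,
    rule shift_in_forms_on [where V = "{..m}" and W = "{..m}"], rule simplex_rel_in_forms_on, auto,
    rule shift_in_forms_on [where V = "{..m}" and W = "{..m}"], rule simplex_rel_in_forms_on, auto)

lemma simplex_ideal_gens: "simplex_rel n \<in> simplex_ideal n" "simplex_drel n \<in> simplex_ideal n"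
  unfolding simplex_ideal_eq
  by (rule subsetD [OF ring.genideal_self [OF ring_dform_ring]];
      simp add: dform_ring_simps simplex_rel_in_forms_on)+

lemma product_ideal_gens:
  "simplex_rel (n + 1) \<in> product_ideal n m" "simplex_drel (n + 1) \<in> product_ideal n m"
  "shift (n + 2) (simplex_rel m) \<in> product_ideal n m" "shift (n + 2) (simplex_drel m) \<in> product_ideal n m"
  unfolding product_ideal_eq
  by (rule subsetD [OF ring.genideal_self [OF ring_dform_ring]];
      simp add: dform_ring_simps product_gens_in_forms_on [unfolded One_nat_def add_2_eq_Suc' add_Suc_right add_0_right])+

lemma simplex_ideal_induct [consumes 1, case_names zero add rel drel]:
  assumes "a \<in> simplex_ideal n" "P 0" "\<And>a b. P a \<Longrightarrow> P b \<Longrightarrow> P (a + b)"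
    "\<And>x. x \<in> forms_on {..n} {..n} \<Longrightarrow> P (x * simplex_rel n)"
    "\<And>x. x \<in> forms_on {..n} {..n} \<Longrightarrow> P (x * simplex_drel n)"
  shows "P a"
proof -
  have "a \<in> left_span (forms_on {..n} {..n}) {simplex_rel n, simplex_drel n}"
    using assms(1) unfolding simplex_ideal_eq
    by (rule subsetD [OF genideal_subset_left_span, rotated -1])
      (use normal_simplex_rel [where r = 0 and V = "{..n}"] in \<open>auto simp: simplex_rel_in_forms_on shift_0\<close>)
  then show ?thesis
    by induction (use assms in auto)
qed

lemma product_ideal_induct [consumes 1, case_names zero add rel drel rel' drel']:
  assumes "a \<in> product_ideal n m" "P 0" "\<And>a b. P a \<Longrightarrow> P b \<Longrightarrow> P (a + b)"
    "\<And>x. x \<in> forms_on {..n + m + 2} {..n + m + 2} \<Longrightarrow> P (x * simplex_rel (n + 1))"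
    "\<And>x. x \<in> forms_on {..n + m + 2} {..n + m + 2} \<Longrightarrow> P (x * simplex_drel (n + 1))"
    "\<And>x. x \<in> forms_on {..n + m + 2} {..n + m + 2} \<Longrightarrow> P (x * shift (n + 2) (simplex_rel m))"
    "\<And>x. x \<in> forms_on {..n + m + 2} {..n + m + 2} \<Longrightarrow> P (x * shift (n + 2) (simplex_drel m))"
  shows "P a"
proof -
  let ?V = "{..n + m + 2}"
  let ?G = "{simplex_rel (n + 1), simplex_drel (n + 1), shift (n + 2) (simplex_rel m), shift (n + 2) (simplex_drel m)}"
  have "?G \<subseteq> forms_on ?V ?V"
    by (intro insert_subsetI empty_subsetI product_gens_in_forms_on)
  moreover have "\<exists>x'\<in>forms_on ?V ?V. g * x = x' * g" if "g \<in> ?G" "x \<in> forms_on ?V ?V" for g x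
    using that(1) normal_simplex_rel [OF that(2), of 0 "n + 1", unfolded shift_0]
      normal_simplex_rel [OF that(2), of "n + 2" m] by (elim insertE emptyE) (simp_all only:)
  ultimately have "a \<in> left_span (forms_on ?V ?V) ?G"
    using assms(1) unfolding product_ideal_eq
    by (intro subsetD [OF genideal_subset_left_span]) blast+
  then show ?thesis
  proof induction
    case (mult x g)
    then show ?case
      using assms(4-7) by (elim insertE emptyE) (simp_all only:)
  qed (use assms(2,3) in auto)
qed

lemmas simplex_ideal_closed = ideal_dform_ring [OF ideal_simplex_ideal]
lemmas product_ideal_closed = ideal_dform_ring [OF ideal_product_ideal]

text \<open>
  The integral kills the relations of the first factor; those of the second factor can be taken out
  of it.
\<close>

lemma fibre_int_product_ideal:
  assumes "a \<in> product_ideal n m"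
  shows "fibre_int n a \<in> simplex_ideal m"
  using assms
proof (induction rule: product_ideal_induct)
  case (rel x)
  then show ?case
    by (simp only: simplex_rel_def fibre_int_relations simplex_ideal_closed(1))
next
  case (drel x)
  then show ?case
    by (simp only: simplex_drel_def fibre_int_relations simplex_ideal_closed(1))
next
  case (rel' x)
  then show ?case
    by (simp only: fibre_int_mult_shift simplex_ideal_closed(3) simplex_ideal_gens fibre_int_in_forms_on)
next
  case (drel' x)
  then show ?case
    by (simp only: fibre_int_mult_shift simplex_ideal_closed(3) simplex_ideal_gens fibre_int_in_forms_on)
qed (simp_all add: additive.add [OF additive_fibre_int] additive.zero [OF additive_fibre_int] simplex_ideal_closed)

text \<open>
  The assumption on the sum says that the map \<open>\<phi>\<close> takes the product of the two simplices to the
  simplex. Applying \<open>d\<close> to it gives the statement for the relation between the differentials.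
\<close>

lemma subst_form_simplex_ideal:
  fixes \<phi> :: "nat \<Rightarrow> 'a::comm_ring_1 dform"
  assumes \<phi>: "function_map \<phi>" "\<And>l. l \<le> m \<Longrightarrow> \<phi> l \<in> forms_on {..n + m + 2} {}"
    and c: "c \<in> forms_on {..n + m + 2} {}"
    and sum: "(\<Sum>l\<le>m. \<phi> l) - 1 = c * shift (n + 2) (simplex_rel m) + simplex_rel (n + 1)"
    and a: "a \<in> simplex_ideal m"
  shows "subst_form \<phi> a \<in> product_ideal n m"
proof -
  let ?V = "{..n + m + 2}"
  have fn: "f \<in> forms_on ?V ?V" "ext_d f \<in> forms_on ?V ?V" if "f \<in> forms_on ?V {}" for f :: "'a dform"
    using that ext_d_in_forms_on by (auto intro: forms_on_mono)
  have rel: "subst_form \<phi> (simplex_rel m) = c * shift (n + 2) (simplex_rel m) + simplex_rel (n + 1)"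
    unfolding sum [symmetric]
    by (simp add: simplex_rel_def additive.diff [OF additive_subst_form] additive.sum [OF additive_subst_form]
        subst_form_coord [OF \<phi>(1)])
  have "simplex_rel m \<in> (fun_forms :: 'a dform set)"
    by (rule simplex_rel_in_forms_on) simp
  then have "subst_form \<phi> (simplex_drel m) = ext_d (subst_form \<phi> (simplex_rel m))"
    "ext_d (shift (n + 2) (simplex_rel m)) = (shift (n + 2) (simplex_drel m) :: 'a dform)"
    by (simp_all add: ext_d_subst_form [OF \<phi>(1)] shift_def ext_d_subst_form [OF function_map_coord] ext_d_simplex_rel)
  then have drel: "subst_form \<phi> (simplex_drel m) = ext_d c * shift (n + 2) (simplex_rel m) +
      c * shift (n + 2) (simplex_drel m) + simplex_drel (n + 1)"
    unfolding rel by (simp add: additive.add [OF additive_ext_d] ext_d_function_mult [OF c] ext_d_simplex_rel)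
  have gens: "subst_form \<phi> (simplex_rel m) \<in> product_ideal n m" "subst_form \<phi> (simplex_drel m) \<in> product_ideal n m"
    unfolding rel drel by (intro product_ideal_closed(2,3) product_ideal_gens fn c)+
  have coeffs: "subst_form \<phi> x \<in> forms_on ?V ?V" if "x \<in> forms_on {..m} {..m}" for x
    by (rule subst_form_in_forms_on [OF \<phi>(1) _ _ that]) (use fn \<phi>(2) in auto)
  show ?thesis
    using a
    by (induction rule: simplex_ideal_induct)
      (simp_all only: gens coeffs additive.add [OF additive_subst_form] additive.zero [OF additive_subst_form]
        subst_form_mult [OF \<phi>(1)] product_ideal_closed)
qed

section \<open>Passing to the quotients\<close>

lemma coset_eq: "I +>\<^bsub>dform_ring N\<^esub> a = (\<lambda>i. i + a) ` I"
  by (auto simp: a_r_coset_def' dform_ring_simps)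

lemma coset_eq_iff:
  assumes "ideal I (dform_ring N)"
  shows "I +>\<^bsub>dform_ring N\<^esub> a = I +>\<^bsub>dform_ring N\<^esub> b \<longleftrightarrow> a - b \<in> I"
proof
  assume "I +>\<^bsub>dform_ring N\<^esub> a = I +>\<^bsub>dform_ring N\<^esub> b"
  moreover have "0 + a \<in> I +>\<^bsub>dform_ring N\<^esub> a"
    unfolding coset_eq using ideal_dform_ring(1) [OF assms] by blast
  ultimately show "a - b \<in> I"
    by (auto simp: coset_eq)
next
  assume ab: "a - b \<in> I"
  have "i + x \<in> (\<lambda>i. i + y) ` I" if "x - y \<in> I" "i \<in> I" for i x y
    using ideal_dform_ring(2) [OF assms that(2,1)] by (intro image_eqI [of _ _ "i + (x - y)"]) simp_all
  moreover have "b - a \<in> I"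
    using ideal_dform_ring(5) [OF assms ab] by simp
  ultimately show "I +>\<^bsub>dform_ring N\<^esub> a = I +>\<^bsub>dform_ring N\<^esub> b"
    unfolding coset_eq using ab by blast
qed

lemma descend_coset:
  assumes "ideal I (dform_ring N)" "\<And>i. i \<in> I \<Longrightarrow> cls (F (i + a)) = cls (F a)"
  shows "descend cls F (I +>\<^bsub>dform_ring N\<^esub> a) = cls (F a)"
  unfolding descend_def coset_eq using assms(2) ideal_dform_ring(1) [OF assms(1)] by auto

lemma Omega_class_eqI: "a - b \<in> simplex_ideal m \<Longrightarrow> Omega_class m a = Omega_class m b"
  by (simp add: Omega_class_def coset_eq_iff [OF ideal_simplex_ideal])

lemma prod_class_eq_iff: "prod_class n m a = prod_class n m b \<longleftrightarrow> a - b \<in> product_ideal n m"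
  by (simp only: prod_class_def coset_eq_iff [OF ideal_product_ideal])

lemma Omega_carrierE:
  assumes "\<eta> \<in> carrier (Omega m)"
  obtains a where "a \<in> forms_on {..m} {..m}" "\<eta> = Omega_class m a"
  using assms unfolding Omega_def FactRing_def A_RCOSETS_def' Omega_class_def
  by (auto simp: dform_ring_simps)

lemma Omega_class_in_carrier: "a \<in> forms_on {..m} {..m} \<Longrightarrow> Omega_class m a \<in> carrier (Omega m)"
  unfolding Omega_def FactRing_def A_RCOSETS_def' Omega_class_def by (auto simp: dform_ring_simps)

lemma pullback_Omega_class:
  assumes "\<And>i. i \<in> simplex_ideal m \<Longrightarrow> subst_form \<phi> i \<in> product_ideal n m"
  shows "pullback n m \<phi> (Omega_class m a) = prod_class n m (subst_form \<phi> a)"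
  unfolding pullback_def Omega_class_def
  by (rule descend_coset [OF ideal_simplex_ideal])
    (simp add: prod_class_eq_iff additive.add [OF additive_subst_form] assms)

lemma descend_prod_class:
  assumes "additive F" "\<And>i. i \<in> product_ideal n m \<Longrightarrow> F i \<in> simplex_ideal m"
  shows "descend (Omega_class m) F (prod_class n m b) = Omega_class m (F b)"
  unfolding prod_class_def
  by (rule descend_coset [OF ideal_product_ideal], rule Omega_class_eqI)
    (simp add: additive.add [OF assms(1)] assms(2))

lemma join_map_simplex_ideal:
  assumes f: "\<And>i. i \<le> n \<Longrightarrow> f i \<le> m" and a: "a \<in> simplex_ideal m"
  shows "subst_form (join_map n f) a \<in> product_ideal n m"
proof (rule subst_form_simplex_ideal [OF function_map_join_map _ _ _ a])
  show "coord_s \<in> forms_on {..n + m + 2} {}"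
    by (simp add: coord_s_def coord_in_forms_on)
  show "join_map n f l \<in> forms_on {..n + m + 2} {}" if "l \<le> m" for l
    unfolding join_map_def coord_s_def coord_t_def coord_v_def using that
    by (auto intro!: add_in_forms_on mult_in_forms_on sum_in_forms_on coord_in_forms_on
        one_in_forms_on zero_in_forms_on)
  have "(\<Sum>l\<le>m. \<Sum>i\<le>n. coord_t i * (if l = f i then 1 else 0)) = (\<Sum>i\<le>n. coord_t i :: 'a dform)"
    by (subst sum.swap) (simp add: sum_distrib_left [symmetric] f)
  then show "(\<Sum>l\<le>m. join_map n f l) - 1 = coord_s * shift (n + 2) (simplex_rel m) + (simplex_rel (n + 1) :: 'a dform)"
    unfolding simplex_rel_def sum_atMost_split join_map_def sum.distrib
    by (simp add: sum_distrib_left [symmetric] additive.diff [OF additive_shift] additive.sum [OF additive_shift]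
        shift_simps right_diff_distrib coord_v_def coord_s_def coord_t_def add_ac)
qed

lemma join_map_in_forms_on:
  assumes "a \<in> forms_on {..m} {..m}"
  shows "subst_form (join_map n f) a \<in> forms_on {..n + m + 2} {..n + m + 2}"
proof -
  have "join_map n f l \<in> forms_on {..n + m + 2} {}" if "l \<le> m" for l
    unfolding join_map_def coord_s_def coord_t_def coord_v_def using that
    by (auto intro!: add_in_forms_on mult_in_forms_on sum_in_forms_on coord_in_forms_on
        one_in_forms_on zero_in_forms_on)
  then show ?thesis
    by (intro subst_form_in_forms_on [OF function_map_join_map _ _ assms])
      (auto intro: forms_on_mono ext_d_in_forms_on)
qed

lemma join_int_in_forms_on: "a \<in> forms_on {..m} {..m} \<Longrightarrow> join_int n f a \<in> forms_on {..m} {..m}"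
  unfolding join_int_def by (intro fibre_int_in_forms_on join_map_in_forms_on)

lemma k_simplex_Omega_class:
  assumes "\<And>i. i \<le> n \<Longrightarrow> f i \<le> m"
  shows "k_simplex m n f (Omega_class m a) = Omega_class m (join_int n f a)"
proof -
  have "pullback n m (join_map n f) (Omega_class m a) = prod_class n m (subst_form (join_map n f) a)"
    by (intro pullback_Omega_class join_map_simplex_ideal assms)
  then show ?thesis
    by (simp only: k_simplex_def join_int_def descend_prod_class [OF additive_fibre_int fibre_int_product_ideal])
qed

section \<open>The vertex homotopies\<close>

text \<open>
  The substitution \<open>t\<^sub>0 = 1 - s\<close>.
\<close>

definition eliminate_t :: "nat \<Rightarrow> 'a::comm_ring_1 dform" where
  "eliminate_t i = (if i = 1 then 1 - coord 0 else coord i)"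

lemma function_map_eliminate_t: "function_map eliminate_t"
  by (simp add: function_map_def eliminate_t_def minus_in_forms_on one_in_forms_on coord_in_forms_on)

lemma ext_d_eliminate_t: "ext_d (eliminate_t i) = (if i = 1 then - dcoord 0 else dcoord i)"
  by (simp add: eliminate_t_def additive.diff [OF additive_ext_d] ext_d_coord)

lemma eliminate_t_in_forms_on:
  assumes "a \<in> forms_on {..m + 2} {..m + 2}"
  shows "subst_form eliminate_t a \<in> forms_on ({..m + 2} - {1}) ({..m + 2} - {1})"
proof (rule subst_form_in_forms_on [OF function_map_eliminate_t _ _ assms])
  fix i assume "i \<in> {..m + 2}"
  then show "eliminate_t i \<in> forms_on ({..m + 2} - {1}) ({..m + 2} - {1})"
    unfolding eliminate_t_def by (auto intro!: minus_in_forms_on one_in_forms_on coord_in_forms_on)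
  show "ext_d (eliminate_t i) \<in> forms_on ({..m + 2} - {1}) ({..m + 2} - {1})"
    unfolding ext_d_eliminate_t using \<open>i \<in> {..m + 2}\<close>
    by (auto intro!: dcoord_in_forms_on uminus_in_forms_on)
qed

lemma eliminate_t_fixes:
  assumes "a \<in> forms_on V W" "1 \<notin> V \<union> W"
  shows "subst_form eliminate_t a = a"
proof -
  have "subst_form eliminate_t a = subst_form coord a"
    by (rule subst_form_cong [OF function_map_eliminate_t function_map_coord _ assms(1)])
      (use assms(2) in \<open>auto simp: eliminate_t_def\<close>)
  then show ?thesis
    by (simp add: subst_form_ident)
qed

lemma eliminate_t_cong:
  fixes a :: "'a::comm_ring_1 dform"
  assumes "a \<in> forms_on {..m + 2} {..m + 2}"
  shows "subst_form eliminate_t a - a \<in> product_ideal 0 m"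
  using assms
proof (induction rule: forms_on_induct)
  case (add a b)
  then show ?case
    using product_ideal_closed(2) [OF add.IH] by (simp add: additive.add [OF additive_subst_form] algebra_simps)
next
  case (const c)
  show ?case
    by (simp add: product_ideal_closed)
next
  case (coord i a)
  have "eliminate_t i - coord i \<in> (product_ideal 0 m :: 'a dform set)"
  proof (cases "i = 1")
    case True
    then have "eliminate_t i - coord i = (- simplex_rel (0 + 1) :: 'a dform)"
      by (simp add: eliminate_t_def simplex_rel_def)
    then show ?thesis
      by (simp only: product_ideal_closed(5) product_ideal_gens)
  qed (simp add: eliminate_t_def product_ideal_closed(1))
  moreover have "subst_form eliminate_t a \<in> forms_on {..0 + m + 2} {..0 + m + 2}"
    using eliminate_t_in_forms_on [OF coord.hyps(2)] by (rule forms_on_mono) auto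
  moreover have "coord i \<in> forms_on {..0 + m + 2} {..0 + m + 2}"
    using coord.hyps(1) by (simp add: coord_in_forms_on)
  ultimately have "(eliminate_t i - coord i) * subst_form eliminate_t a +
      coord i * (subst_form eliminate_t a - a) \<in> product_ideal 0 m"
    using coord.IH by (intro product_ideal_closed(2) product_ideal_closed(3) product_ideal_closed(4))
  then show ?case
    by (simp add: subst_form_coord_mult [OF function_map_eliminate_t] algebra_simps)
next
  case (dcoord i a)
  have "ext_d (eliminate_t i) - dcoord i \<in> (product_ideal 0 m :: 'a dform set)"
  proof (cases "i = 1")
    case True
    then have "ext_d (eliminate_t i) - dcoord i = (- simplex_drel (0 + 1) :: 'a dform)"
      by (simp add: ext_d_eliminate_t simplex_drel_def)
    then show ?thesis
      by (simp only: product_ideal_closed(5) product_ideal_gens)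
  qed (simp add: ext_d_eliminate_t product_ideal_closed(1))
  moreover have "subst_form eliminate_t a \<in> forms_on {..0 + m + 2} {..0 + m + 2}"
    using eliminate_t_in_forms_on [OF dcoord.hyps(2)] by (rule forms_on_mono) auto
  moreover have "dcoord i \<in> forms_on {..0 + m + 2} {..0 + m + 2}"
    using dcoord.hyps(1) by (simp add: dcoord_in_forms_on)
  ultimately have "(ext_d (eliminate_t i) - dcoord i) * subst_form eliminate_t a +
      dcoord i * (subst_form eliminate_t a - a) \<in> product_ideal 0 m"
    using dcoord.IH by (intro product_ideal_closed(2) product_ideal_closed(3) product_ideal_closed(4))
  then show ?case
    by (simp add: subst_form_dcoord_mult [OF function_map_eliminate_t] algebra_simps)
qed

text \<open>
  Moving \<open>ds\<close> to the front yields the decomposition \<open>ds \<and> \<alpha> + \<beta>\<close>.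
\<close>

lemma split_first_dcoord:
  assumes "a \<in> forms_on V (insert 0 W)"
  obtains \<alpha> \<beta> where "\<alpha> \<in> forms_on V W" "\<beta> \<in> forms_on V W" "a = dcoord 0 * \<alpha> + \<beta>"
proof -
  have "\<exists>\<alpha>\<in>forms_on V W. \<exists>\<beta>\<in>forms_on V W. a = dcoord 0 * \<alpha> + \<beta>"
    using assms
  proof (induction rule: forms_on_induct)
    case (add a b)
    then obtain \<alpha> \<beta> \<alpha>' \<beta>' where *: "\<alpha> \<in> forms_on V W" "\<beta> \<in> forms_on V W" "a = dcoord 0 * \<alpha> + \<beta>"
      "\<alpha>' \<in> forms_on V W" "\<beta>' \<in> forms_on V W" "b = dcoord 0 * \<alpha>' + \<beta>'"
      by blast
    then have "a + b = dcoord 0 * (\<alpha> + \<alpha>') + (\<beta> + \<beta>')"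
      by (simp add: distrib_left)
    with * show ?case
      by (intro bexI [of _ "\<alpha> + \<alpha>'"] bexI [of _ "\<beta> + \<beta>'"]) (simp_all add: add_in_forms_on)
  next
    case (const c)
    have "dconst c = dcoord 0 * 0 + dconst c"
      by simp
    then show ?case
      using dconst_in_forms_on zero_in_forms_on by blast
  next
    case (coord i a)
    then obtain \<alpha> \<beta> where *: "\<alpha> \<in> forms_on V W" "\<beta> \<in> forms_on V W" "a = dcoord 0 * \<alpha> + \<beta>"
      by blast
    then have "coord i * a = dcoord 0 * (coord i * \<alpha>) + coord i * \<beta>"
      by (simp add: distrib_left coord_left_commute [of "dcoord 0"])
    moreover have "coord i * \<alpha> \<in> forms_on V W" "coord i * \<beta> \<in> forms_on V W"
      using * coord.hyps(1) by (simp_all add: mult_in_forms_on coord_in_forms_on)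
    ultimately show ?case
      by blast
  next
    case (dcoord i a)
    then obtain \<alpha> \<beta> where *: "\<alpha> \<in> forms_on V W" "\<beta> \<in> forms_on V W" "a = dcoord 0 * \<alpha> + \<beta>"
      by blast
    show ?case
    proof (cases "i = 0")
      case True
      then have "dcoord i * a = dcoord 0 * \<beta> + 0"
        by (simp add: * distrib_left mult.assoc [symmetric] dcoord_square)
      then show ?thesis
        using *(2) zero_in_forms_on by blast
    next
      case False
      have "dcoord i * (dcoord 0 * \<alpha>) = - (dcoord 0 * (dcoord i * \<alpha>))"
        by (simp only: mult.assoc [symmetric] dcoord_anticommute [of i 0] mult_minus_left)
      then have "dcoord i * a = dcoord 0 * (- (dcoord i * \<alpha>)) + dcoord i * \<beta>"
        by (simp add: * distrib_left)
      moreover have "- (dcoord i * \<alpha>) \<in> forms_on V W" "dcoord i * \<beta> \<in> forms_on V W"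
        using * False dcoord.hyps(1) by (simp_all add: mult_in_forms_on dcoord_in_forms_on uminus_in_forms_on)
      ultimately show ?thesis
        by blast
    qed
  qed
  then show ?thesis
    using that by blast
qed

text \<open>
  The substitution \<open>t\<^sub>0 = 1 - s\<close> kills the relations of the first factor, and those of the second do not
  involve \<open>ds\<close>. Taking the coefficient of \<open>ds\<close> after the substitution therefore maps the ideal to itself,
  and it maps \<open>ds \<and> \<alpha> + \<beta>\<close> to \<open>\<alpha>\<close>.
\<close>

lemma first_dcoord_coefficient_unique:
  fixes \<alpha> \<beta> :: "'a::comm_ring_1 dform"
  assumes "\<alpha> \<in> forms_on ({..m + 2} - {1}) {2..m + 2}" "\<beta> \<in> forms_on ({..m + 2} - {1}) {2..m + 2}"
    and "dcoord 0 * \<alpha> + \<beta> \<in> product_ideal 0 m"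
  shows "\<alpha> \<in> product_ideal 0 m"
proof -
  have "contract0 (subst_form eliminate_t x) \<in> product_ideal 0 m" if "x \<in> product_ideal 0 m" for x :: "'a dform"
    using that
  proof (induction rule: product_ideal_induct)
    case (rel x)
    have "subst_form eliminate_t (simplex_rel (0 + 1)) = (0 :: 'a dform)"
      by (simp add: simplex_rel_def additive.diff [OF additive_subst_form] additive.add [OF additive_subst_form]
          subst_form_coord [OF function_map_eliminate_t] eliminate_t_def)
    then show ?case
      by (simp only: subst_form_mult [OF function_map_eliminate_t] mult_zero_right
          additive.zero [OF additive_contract0] product_ideal_closed(1))
  next
    case (drel x)
    have "subst_form eliminate_t (simplex_drel (0 + 1)) = (0 :: 'a dform)"
      by (simp add: simplex_drel_def additive.add [OF additive_subst_form]
          subst_form_dcoord [OF function_map_eliminate_t] ext_d_eliminate_t)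
    then show ?case
      by (simp only: subst_form_mult [OF function_map_eliminate_t] mult_zero_right
          additive.zero [OF additive_contract0] product_ideal_closed(1))
  next
    case (rel' x)
    have shift: "shift (0 + 2) (simplex_rel m) \<in> (forms_on {2..m + 2} {2..m + 2} :: 'a dform set)"
      by (rule shift_in_forms_on [OF simplex_rel_in_forms_on(1) [of m "{..m}" "{}"]]) auto
    have fix_: "subst_form eliminate_t (shift (0 + 2) (simplex_rel m)) = (shift (0 + 2) (simplex_rel m) :: 'a dform)"
      using shift by (rule eliminate_t_fixes) simp
    have "contract0 (subst_form eliminate_t x) \<in> forms_on {..0 + m + 2} {..0 + m + 2}"
      using contract0_in_forms_on [OF eliminate_t_in_forms_on] rel' by (auto intro: forms_on_mono)
    then show ?case
      unfolding subst_form_mult [OF function_map_eliminate_t] fix_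
      by (subst contract0_mult [OF shift]) (simp, intro product_ideal_closed(3) product_ideal_gens)
  next
    case (drel' x)
    have shift: "shift (0 + 2) (simplex_drel m) \<in> (forms_on {2..m + 2} {2..m + 2} :: 'a dform set)"
      by (rule shift_in_forms_on [OF simplex_rel_in_forms_on(2) [of m "{..m}" "{}"]]) auto
    have fix_: "subst_form eliminate_t (shift (0 + 2) (simplex_drel m)) = (shift (0 + 2) (simplex_drel m) :: 'a dform)"
      using shift by (rule eliminate_t_fixes) simp
    have "contract0 (subst_form eliminate_t x) \<in> forms_on {..0 + m + 2} {..0 + m + 2}"
      using contract0_in_forms_on [OF eliminate_t_in_forms_on] drel' by (auto intro: forms_on_mono)
    then show ?case
      unfolding subst_form_mult [OF function_map_eliminate_t] fix_
      by (subst contract0_mult [OF shift]) (simp, intro product_ideal_closed(3) product_ideal_gens)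
  qed (simp_all add: additive.add [OF additive_subst_form] additive.zero [OF additive_subst_form]
      additive.add [OF additive_contract0] additive.zero [OF additive_contract0] product_ideal_closed)
  then have "contract0 (subst_form eliminate_t (dcoord 0 * \<alpha> + \<beta>)) \<in> product_ideal 0 m"
    using assms(3) by blast
  moreover have "subst_form eliminate_t \<gamma> = \<gamma>" if "\<gamma> \<in> forms_on ({..m + 2} - {1}) {2..m + 2}" for \<gamma> :: "'a dform"
    using that by (rule eliminate_t_fixes) simp
  then have "subst_form eliminate_t (dcoord 0 * \<alpha> + \<beta>) = dcoord 0 * \<alpha> + \<beta>"
    using assms(1,2) by (simp add: additive.add [OF additive_subst_form]
        subst_form_dcoord_mult [OF function_map_eliminate_t] ext_d_eliminate_t)
  moreover have "contract0 (dcoord 0 * \<alpha> + \<beta>) = \<alpha>"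
    using assms(1,2) by (rule contract0_cancel) simp
  ultimately show ?thesis
    by simp
qed

lemma contraction_map_simplex_ideal:
  assumes j: "j \<le> m" and a: "a \<in> simplex_ideal m"
  shows "subst_form (contraction_map j) a \<in> product_ideal 0 m"
proof (rule subst_form_simplex_ideal [OF function_map_contraction_map _ _ _ a])
  show "coord_t 0 \<in> forms_on {..0 + m + 2} {}"
    by (simp add: coord_t_def coord_in_forms_on)
  show "contraction_map j l \<in> forms_on {..0 + m + 2} {}" if "l \<le> m" for l
    unfolding contraction_map_def coord_s_def coord_t_def coord_v_def using that
    by (auto intro!: add_in_forms_on mult_in_forms_on coord_in_forms_on one_in_forms_on zero_in_forms_on)
  show "(\<Sum>l\<le>m. contraction_map j l) - 1 = coord_t 0 * shift (0 + 2) (simplex_rel m) + (simplex_rel (0 + 1) :: 'a dform)"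
    unfolding simplex_rel_def contraction_map_def sum.distrib
    by (simp add: sum_distrib_left [symmetric] additive.diff [OF additive_shift] additive.sum [OF additive_shift]
        shift_simps right_diff_distrib coord_v_def coord_s_def coord_t_def add_ac j)
qed

lemma contraction_map_in_forms_on:
  assumes "a \<in> forms_on {..m} {..m}"
  shows "subst_form (contraction_map j) a \<in> forms_on {..m + 2} {..m + 2}"
proof -
  have "contraction_map j l \<in> forms_on {..m + 2} {}" if "l \<le> m" for l
    unfolding contraction_map_def coord_s_def coord_t_def coord_v_def using that
    by (auto intro!: add_in_forms_on mult_in_forms_on coord_in_forms_on
        one_in_forms_on zero_in_forms_on)
  then show ?thesis
    by (intro subst_form_in_forms_on [OF function_map_contraction_map _ _ assms])
      (auto intro: forms_on_mono ext_d_in_forms_on)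
qed

lemma prod_class_ops:
  assumes "a \<in> forms_on {..n + m + 2} {..n + m + 2}" "b \<in> forms_on {..n + m + 2} {..n + m + 2}"
  shows "prod_class n m a \<otimes>\<^bsub>Omega_prod n m\<^esub> prod_class n m b = prod_class n m (a * b)"
    and "prod_class n m a \<oplus>\<^bsub>Omega_prod n m\<^esub> prod_class n m b = prod_class n m (a + b)"
proof -
  interpret ring_hom_ring "dform_ring (n + m + 2)" "Omega_prod n m" "prod_class n m"
    using ideal.rcos_ring_hom_ring [OF ideal_product_ideal [of n m]]
    by (simp only: Omega_prod_def prod_class_def [abs_def])
  show "prod_class n m a \<otimes>\<^bsub>Omega_prod n m\<^esub> prod_class n m b = prod_class n m (a * b)"
    "prod_class n m a \<oplus>\<^bsub>Omega_prod n m\<^esub> prod_class n m b = prod_class n m (a + b)"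
    using hom_mult [of a b] hom_add [of a b] assms by (simp_all add: dform_ring_simps)
qed

lemma fibre_int_0_no_differentials:
  assumes "\<beta> \<in> forms_on V {2..}"
  shows "fibre_int 0 \<beta> = 0"
  using assms
proof (induction rule: forms_on_dmono_induct)
  case (dmono c k S)
  have "ffilter (\<lambda>i. i \<le> 0 + 1) S = {||}"
    using subsetD [OF dmono(2)] by (force simp: fset_eq_iff)
  then show ?case
    by (simp only: fibre_int_dmono simplex_int_empty mult_zero_right dmono_0)
qed (simp add: additive.add [OF additive_fibre_int])

text \<open>
  Elimination of \<open>t\<^sub>0\<close> produces a form \<open>\<alpha>\<close> as required by the definition of \<open>h_vertex\<close>. As \<open>\<beta>\<close> has no
  differential along the edge, its integral vanishes; so integrating \<open>\<alpha>\<close> in \<open>s\<close> amounts to integrating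
  the whole pullback over the edge.
\<close>

lemma h_vertex_Omega_class:
  fixes a :: "'a::field_char_0 dform"
  assumes j: "j \<le> m" and a: "a \<in> forms_on {..m} {..m}"
  shows "h_vertex m j (Omega_class m a) = Omega_class m (join_int 0 (\<lambda>_. j) a)"
proof -
  define b where "b = subst_form (contraction_map j) a"
  let ?V = "{..m + 2} - {1}" and ?W = "{2..m + 2}"
  let ?F = "forms_on {..0 + m + 2} {..0 + m + 2} :: 'a dform set"
  have b: "b \<in> forms_on {..m + 2} {..m + 2}"
    unfolding b_def by (rule contraction_map_in_forms_on [OF a])
  have pull: "pullback 0 m (contraction_map j) (Omega_class m a) = prod_class 0 m b"
    unfolding b_def by (intro pullback_Omega_class contraction_map_simplex_ideal j)
  have VW: "{..m + 2} - {1} = insert 0 ?W"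
    by auto
  obtain \<alpha> \<beta> where \<alpha>\<beta>: "\<alpha> \<in> forms_on ?V ?W" "\<beta> \<in> forms_on ?V ?W" "subst_form eliminate_t b = dcoord 0 * \<alpha> + \<beta>"
    using split_first_dcoord [of "subst_form eliminate_t b" ?V ?W] eliminate_t_in_forms_on [OF b]
    unfolding VW by metis
  have full: "x \<in> ?F" if "x \<in> forms_on ?V ?W" for x :: "'a dform"
    using that by (rule forms_on_mono) auto
  have ds: "ext_d coord_s = (dcoord 0 :: 'a dform)" "dcoord 0 \<in> ?F"
    by (simp_all add: coord_s_def ext_d_coord dcoord_in_forms_on)
  have ops: "prod_class 0 m (ext_d coord_s) \<otimes>\<^bsub>Omega_prod 0 m\<^esub> prod_class 0 m x \<oplus>\<^bsub>Omega_prod 0 m\<^esub> prod_class 0 m y =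
      prod_class 0 m (dcoord 0 * x + y)" if "x \<in> forms_on ?V ?W" "y \<in> forms_on ?V ?W" for x y :: "'a dform"
    using full [OF that(1)] full [OF that(2)] ds by (simp only: prod_class_ops mult_in_forms_on)
  have diff: "(dcoord 0 * \<alpha> + \<beta>) - b \<in> product_ideal 0 m"
    using eliminate_t_cong [OF b] by (simp only: \<alpha>\<beta>(3))
  have "(THE \<alpha>. \<alpha> \<in> Omega_s m \<and> (\<exists>\<beta>\<in>Omega_s m. pullback 0 m (contraction_map j) (Omega_class m a) =
        prod_class 0 m (ext_d coord_s) \<otimes>\<^bsub>Omega_prod 0 m\<^esub> \<alpha> \<oplus>\<^bsub>Omega_prod 0 m\<^esub> \<beta>)) = prod_class 0 m \<alpha>"
  proof (rule the_equality, intro conjI)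
    show "prod_class 0 m \<alpha> \<in> Omega_s m"
      unfolding Omega_s_def using \<alpha>\<beta>(1) by blast
    have "prod_class 0 m \<beta> \<in> Omega_s m"
      unfolding Omega_s_def using \<alpha>\<beta>(2) by blast
    moreover have "prod_class 0 m b = prod_class 0 m (dcoord 0 * \<alpha> + \<beta>)"
      using product_ideal_closed(5) [OF diff] by (simp add: prod_class_eq_iff)
    ultimately show "\<exists>\<beta>\<in>Omega_s m. pullback 0 m (contraction_map j) (Omega_class m a) =
        prod_class 0 m (ext_d coord_s) \<otimes>\<^bsub>Omega_prod 0 m\<^esub> prod_class 0 m \<alpha> \<oplus>\<^bsub>Omega_prod 0 m\<^esub> \<beta>"
      using ops [OF \<alpha>\<beta>(1,2)] pull by (intro bexI [of _ "prod_class 0 m \<beta>"]) simp_all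
  next
    fix A assume "A \<in> Omega_s m \<and> (\<exists>\<beta>\<in>Omega_s m. pullback 0 m (contraction_map j) (Omega_class m a) =
        prod_class 0 m (ext_d coord_s) \<otimes>\<^bsub>Omega_prod 0 m\<^esub> A \<oplus>\<^bsub>Omega_prod 0 m\<^esub> \<beta>)"
    then obtain x y where xy: "x \<in> forms_on ?V ?W" "y \<in> forms_on ?V ?W" "A = prod_class 0 m x"
      "prod_class 0 m b = prod_class 0 m (dcoord 0 * x + y)"
      unfolding Omega_s_def pull using ops by auto
    then have "b - (dcoord 0 * x + y) \<in> product_ideal 0 m"
      by (simp only: prod_class_eq_iff)
    then have "(dcoord 0 * \<alpha> + \<beta> - b) + (b - (dcoord 0 * x + y)) \<in> product_ideal 0 m"
      by (rule product_ideal_closed(2) [OF diff])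
    then have "dcoord 0 * (\<alpha> - x) + (\<beta> - y) \<in> product_ideal 0 m"
      by (simp add: algebra_simps)
    then have "\<alpha> - x \<in> product_ideal 0 m"
      using \<alpha>\<beta>(1,2) xy(1,2) by (intro first_dcoord_coefficient_unique [of "\<alpha> - x" m "\<beta> - y"] minus_in_forms_on)
    then have "prod_class 0 m \<alpha> = prod_class 0 m x"
      by (simp only: prod_class_eq_iff)
    then show "A = prod_class 0 m \<alpha>"
      using xy(3) by simp
  qed
  then have "h_vertex m j (Omega_class m a) = descend (Omega_class m) s_int (prod_class 0 m \<alpha>)"
    unfolding h_vertex_def by (simp only:)
  also have "\<dots> = Omega_class m (s_int \<alpha>)"
  proof (rule descend_prod_class [OF additive_s_int])
    fix i :: "'a dform" assume "i \<in> product_ideal 0 m"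
    then have "dcoord 0 * i \<in> product_ideal 0 m"
      by (rule product_ideal_closed(3) [OF _ ds(2)])
    then show "s_int i \<in> simplex_ideal m"
      unfolding s_int_eq_fibre_int by (intro simplex_ideal_closed(5) fibre_int_product_ideal)
  qed
  also have "\<dots> = Omega_class m (- fibre_int 0 b)"
  proof (rule Omega_class_eqI)
    have "\<beta> \<in> forms_on ?V {2..}"
      using \<alpha>\<beta>(2) by (rule forms_on_mono) auto
    then have "s_int \<alpha> - - fibre_int 0 b = - fibre_int 0 (dcoord 0 * \<alpha> + \<beta> - b)"
      by (simp add: s_int_eq_fibre_int additive.diff [OF additive_fibre_int] additive.add [OF additive_fibre_int]
          fibre_int_0_no_differentials)
    then show "s_int \<alpha> - - fibre_int 0 b \<in> simplex_ideal m"
      using diff by (simp only: simplex_ideal_closed(5) fibre_int_product_ideal)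
  qed
  finally show ?thesis
    by (simp only: join_int_0 b_def)
qed

lemma h_simplex_Omega_class:
  assumes "\<And>i. i \<le> n \<Longrightarrow> f i \<le> m" "a \<in> forms_on {..m} {..m}"
  shows "h_simplex m n f (Omega_class m a) = Omega_class m (join_int n f a)"
  using assms(1)
proof (induction n)
  case 0
  have "join_map 0 (\<lambda>_. f 0) = (join_map 0 f :: nat \<Rightarrow> 'a dform)"
    by (simp add: fun_eq_iff join_map_def)
  then have "join_int 0 (\<lambda>_. f 0) a = join_int 0 f a"
    by (simp add: join_int_def)
  then show ?case
    using h_vertex_Omega_class [OF 0 assms(2), of 0] by (simp add: h_simplex_def)
next
  case (Suc n)
  have "h_simplex m (Suc n) f (Omega_class m a) = h_vertex m (f (Suc n)) (h_simplex m n f (Omega_class m a))"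
    by (simp add: h_simplex_def)
  also have "\<dots> = Omega_class m (join_int 0 (\<lambda>_. f (Suc n)) (join_int n f a))"
    using Suc by (simp add: h_vertex_Omega_class join_int_in_forms_on assms(2))
  finally show ?case
    by (simp only: join_int_Suc)
qed

lemma whitney_in_carrier:
  assumes "\<And>i. i \<le> n \<Longrightarrow> f i \<le> m"
  shows "whitney m n f \<in> carrier (Omega m)"
proof -
  have factors: "prod_list (map (\<lambda>j. dcoord (f j)) (filter (\<lambda>j. j \<noteq> i) [0..<Suc n])) \<in> forms_on {..m} {..m}" for i
  proof (intro prod_list_in_forms_on dcoord_in_forms_on)
    fix j assume "j \<in> set (filter (\<lambda>j. j \<noteq> i) [0..<Suc n])"
    then have "j \<le> n"
      unfolding set_filter set_upt by simp
    then show "f j \<in> {..m}"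
      using assms by simp
  qed
  have sign: "(- 1) ^ i \<in> forms_on V W" for i V W
    by (intro power_in_forms_on uminus_in_forms_on one_in_forms_on)
  show ?thesis
    unfolding whitney_def
    by (intro Omega_class_in_carrier mult_in_forms_on dconst_in_forms_on sum_in_forms_on sign
        coord_in_forms_on factors) (simp add: assms)
qed

theorem theorem5p1:
  fixes m :: nat
    and \<eta> :: "'a::field_char_0 dform set"
  assumes "\<eta> \<in> carrier (Omega m)"
  shows "k_op m \<eta> = h_op m \<eta>"
proof -
  obtain a where a: "a \<in> forms_on {..m} {..m}" "\<eta> = Omega_class m a"
    using assms by (rule Omega_carrierE)
  interpret R: Ring.ring "Omega m :: 'a dform set ring"
    unfolding Omega_def by (rule ideal.quotient_is_ring [OF ideal_simplex_ideal])
  have f: "f i \<le> m" if "f \<in> strict_incr n m" "i \<le> n" for f n i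
    using that by (auto simp: strict_incr_def)
  have eq: "k_simplex m n f \<eta> = h_simplex m n f \<eta>" if "f \<in> strict_incr n m" for n f
    using f [OF that] by (simp add: a k_simplex_Omega_class h_simplex_Omega_class)
  have closed: "whitney m n f \<otimes>\<^bsub>Omega m\<^esub> h_simplex m n f \<eta> \<in> carrier (Omega m)" if "f \<in> strict_incr n m" for n f
    using f [OF that] a(1)
    by (intro R.m_closed whitney_in_carrier) (simp_all add: a(2) h_simplex_Omega_class Omega_class_in_carrier join_int_in_forms_on)
  show ?thesis
    unfolding k_op_def h_op_def
  proof (rule R.finsum_cong' [OF refl])
    show inner: "(\<Oplus>\<^bsub>Omega m\<^esub>f\<in>strict_incr n m. whitney m n f \<otimes>\<^bsub>Omega m\<^esub> k_simplex m n f \<eta>) =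
        (\<Oplus>\<^bsub>Omega m\<^esub>f\<in>strict_incr n m. whitney m n f \<otimes>\<^bsub>Omega m\<^esub> h_simplex m n f \<eta>)" for n
      by (rule R.finsum_cong' [OF refl]) (use closed eq in auto)
    show "(\<lambda>n. \<Oplus>\<^bsub>Omega m\<^esub>f\<in>strict_incr n m. whitney m n f \<otimes>\<^bsub>Omega m\<^esub> h_simplex m n f \<eta>) \<in> {..m} \<rightarrow> carrier (Omega m)"
      using closed by (intro funcsetI R.finsum_closed) auto
  qed
qed

end
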